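(* Let $\mathcal{T}$ be a simply connected T-mesh, let $(m,m')\in\mathbb{Z}_{\ge 0}^2$, and let $\mathbf{r}$ be a smoothness distribution on $\mathcal{T}$ such that $H_0(\mathcal{I}^{\mathbf{r}})=0$. Let $A$ be a (horizontal or vertical) segment of $\mathcal{T}$, let $r\in\mathbb{Z}_{\ge -1}$ satisfy $r\le \mathbf{r}(\tau)$ for every edge $\tau\in A$, and define the smoothness distribution $\mathbf{s}$ by $$\mathbf{s}(\tau)=\begin{cases}\mathbf{r}(\tau) & \text{for } \tau\notin A\cap \mathring{\mathcal{T}}_1,\\ r & \text{for } \tau\in A\cap\mathring{\mathcal{T}}_1.\end{cases}$$ Suppose that at least one of the following two requirements is satisfied: (a) $A\subsetneq B$ for some segment $B$ such that $\mathbf{s}(\tau)\le r$ for all edges $\tau\in B$; (b) $A$ is horizontal and $\omega^{\mathbf{s}}(A)\ge m+1$, or $A$ is vertical and $\omega^{\mathbf{r}}(A)\ge m'+1$. Then $H_0(\mathcal{I}^{\mathbf{s}})=0$ and $\dim \mathcal{R}^{\mathbf{s}}=\chi(\mathcal{Q}^{\mathbf{s}})$.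
   Context: **T-mesh.** A T-mesh $\mathcal{T}$ of $\mathbb{R}^2$ consists of a finite collection $\mathcal{T}_2$ of axis-aligned open rectangles $\sigma$ of non-zero measure (faces), a finite set $\mathcal{T}_1$ of closed axis-aligned segments $\tau$ (edges), which are edges of the closures of the faces, and the set $\mathcal{T}_0$ of vertices $\gamma$ (endpoints) of the edges, such that: the boundary $\partial\sigma$ of each face is a finite union of edges in $\mathcal{T}_1$; for distinct faces $\sigma,\sigma'$, $\overline{\sigma}\cap\overline{\sigma'}=\partial\sigma\cap\partial\sigma'$ is a finite (possibly empty) union of edges in $\mathcal{T}_1$ and vertices in $\mathcal{T}_0$; for distinct edges $\tau,\tau'$, $\tau\cap\tau'$ is empty or a single vertex in $\mathcal{T}_0$. Every vertex is contained in at least one horizontal and at least one vertical edge. The domain is $\Omega=\bigcup_{\sigma\in\mathcal{T}_2}\overline{\sigma}$. $\mathcal{T}$ is called simply connected if $\Omega$ is simply connected and its interior $\mathring\Omega$ is connected. An edge is interior if it intersects $\mathring\Omega$, otherwise it is a boundary edge; a vertex is interior if it lies in $\mathring\Omega$. $\mathring{\mathcal{T}}_1$ and $\mathring{\mathcal{T}}_0$ denote the sets of interior edges and interior vertices; ${}^h\mathcal{T}_1$ and ${}^v\mathcal{T}_1$ denote the sets of horizontal and vertical edges. **Splines.** With $(s,t)$ the (horizontal, vertical) coordinates, $\mathcal{P}_{mm'}$ is the real vector space spanned by $s^it^j$, $0\le i\le m$, $0\le j\le m'$. A smoothness distribution is a map $\mathbf{r}:\mathcal{T}_1\to\mathbb{Z}_{\ge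 -1}$ with $\mathbf{r}(\tau)=-1$ for all $\tau\notin\mathring{\mathcal{T}}_1$. The spline space $\mathcal{R}^{\mathbf{r}}=\mathcal{R}^{\mathbf{r}}_{mm'}(\mathcal{T})$ consists of the piecewise polynomial functions $f$ with $f|_\sigma\in\mathcal{P}_{mm'}$ for every face $\sigma$ that are $C^{\mathbf{r}(\tau)}$ smooth across every interior edge $\tau$; equivalently, for $\tau\in\mathring{\mathcal{T}}_1$ shared by faces $\sigma,\sigma'$, $\ell_\tau^{\mathbf{r}(\tau)+1}$ divides $f|_\sigma-f|_{\sigma'}$, where $\ell_\tau$ is a non-zero linear polynomial vanishing on $\tau$ (no condition if $\mathbf{r}(\tau)=-1$). For a vertex $\gamma$, put $\mathbf{r}_h(\gamma)=\min\{\mathbf{r}(\tau):\gamma\in\tau\in{}^v\mathcal{T}_1\}$ and $\mathbf{r}_v(\gamma)=\min\{\mathbf{r}(\tau):\gamma\in\tau\in{}^h\mathcal{T}_1\}$. **Complexes.** For an interior edge $\tau$, $\mathfrak{I}^{\mathbf{r}}_\tau\subseteq\mathcal{P}_{mm'}$ is the subspace of all elements of $\mathcal{P}_{mm'}$ that are polynomial multiples of $\ell_\tau^{\mathbf{r}(\tau)+1}$ (equal to $\mathcal{P}_{mm'}$ if $\mathbf{r}(\tau)=-1$); for an interior vertex $\gamma$, $\mathfrak{I}^{\mathbf{r}}_\gamma=\sum_{\tau\ni\gamma}\mathfrak{I}^{\mathbf{r}}_\tau$. Fix orientations of the cells and let $\partial$ be the usual cellular boundary map with all boundary edges and boundary vertices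 set to zero (i.e. relative to the boundary of $\Omega$). Then $\mathcal{I}^{\mathbf{r}}$ is the chain complex $0\to\bigoplus_{\tau\in\mathring{\mathcal{T}}_1}[\tau]\mathfrak{I}^{\mathbf{r}}_\tau\xrightarrow{\partial}\bigoplus_{\gamma\in\mathring{\mathcal{T}}_0}[\gamma]\mathfrak{I}^{\mathbf{r}}_\gamma\to 0$ (terms in degrees $2,1,0$, the degree-2 term being $0$), so $H_0(\mathcal{I}^{\mathbf{r}})$ is the cokernel of this map $\partial$. $\mathcal{Q}^{\mathbf{r}}$ is the complex $\bigoplus_{\sigma\in\mathcal{T}_2}[\sigma]\mathcal{P}_{mm'}\to\bigoplus_{\tau\in\mathring{\mathcal{T}}_1}[\tau]\mathcal{P}_{mm'}/\mathfrak{I}^{\mathbf{r}}_\tau\to\bigoplus_{\gamma\in\mathring{\mathcal{T}}_0}[\gamma]\mathcal{P}_{mm'}/\mathfrak{I}^{\mathbf{r}}_\gamma\to0$ (terms in degrees $2,1,0$, maps induced by $\partial$), and $\chi(\mathcal{Q}^{\mathbf{r}})=\dim\mathcal{Q}^{\mathbf{r}}_2-\dim\mathcal{Q}^{\mathbf{r}}_1+\dim\mathcal{Q}^{\mathbf{r}}_0$ is its Euler characteristic. The same definitions apply to any smoothness distribution in place of $\mathbf{r}$. **Segments and weights.** A horizontal (resp. vertical) segment is a finite set $A\subseteq\mathring{\mathcal{T}}_1\cup\mathcal{T}_0$ consisting of horizontal (resp. vertical) interior edges together with their vertices, such that $\bigcup_{\tau\in A}\tau$ is connected and $A$ contains at least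 one edge. Its weight is $\omega^{\mathbf{r}}(A)=\sum_{\gamma\in A}(m-\mathbf{r}_h(\gamma))_+$ if $A$ is horizontal and $\omega^{\mathbf{r}}(A)=\sum_{\gamma\in A}(m'-\mathbf{r}_v(\gamma))_+$ if $A$ is vertical, where the sums are over the vertices in $A$ and $x_+=\max(x,0)$. *)

theory Defs
  imports
    "HOL-Analysis.Analysis"
    "HOL-Analysis.Finite_Function_Topology"
    "HOL-Computational_Algebra.Polynomial"
begin

instantiation poly :: (real_vector) real_vector
begin

definition scaleR_poly :: "real \<Rightarrow> 'a poly \<Rightarrow> 'a poly" where
  "scaleR_poly c p = map_poly (scaleR c) p"

lemma coeff_scaleR_poly [simp]: "coeff (c *\<^sub>R p) n = c *\<^sub>R coeff p n"
  by (simp add: scaleR_poly_def coeff_map_poly)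

instance
  by standard (simp_all add: poly_eq_iff scaleR_add_right scaleR_add_left)

end


section \<open>T-meshes\<close>

record tmesh =
  faces :: "(real \<times> real) set set"
  edges :: "(real \<times> real) set set"

definition horizontal :: "(real \<times> real) set \<Rightarrow> bool" where
  "horizontal \<tau> \<longleftrightarrow> (\<exists>a b c. a < b \<and> \<tau> = {a..b} \<times> {c})"

definition vertical :: "(real \<times> real) set \<Rightarrow> bool" where
  "vertical \<tau> \<longleftrightarrow> (\<exists>a c d. c < d \<and> \<tau> = {a} \<times> {c..d})"

text \<open>Every edge is oriented in the direction of increasing coordinate.  One of the two
  projections of an edge is a single point, so the coordinatewise infimum and supremum are the
  two endpoints.\<close>

definition edge_start :: "(real \<times> real) set \<Rightarrow> real \<times> real" where
  "edge_start \<tau> = (Inf (fst ` \<tau>), Inf (snd ` \<tau>))"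

definition edge_end :: "(real \<times> real) set \<Rightarrow> real \<times> real" where
  "edge_end \<tau> = (Sup (fst ` \<tau>), Sup (snd ` \<tau>))"

definition endpoints :: "(real \<times> real) set \<Rightarrow> (real \<times> real) set" where
  "endpoints \<tau> = {edge_start \<tau>, edge_end \<tau>}"

definition vertices :: "tmesh \<Rightarrow> (real \<times> real) set" where
  "vertices T = (\<Union>\<tau>\<in>edges T. endpoints \<tau>)"

text \<open>An edge need only be a part of a side of a face: at a T-junction, a side of a face consists
  of several edges.\<close>

definition is_tmesh :: "tmesh \<Rightarrow> bool" where
  "is_tmesh T \<longleftrightarrow>
     finite (faces T) \<and>
     (\<forall>\<sigma>\<in>faces T. \<exists>a b c d. a < b \<and> c < d \<and> \<sigma> = {a<..<b} \<times> {c<..<d}) \<and>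
     finite (edges T) \<and>
     (\<forall>\<tau>\<in>edges T. (horizontal \<tau> \<or> vertical \<tau>) \<and> (\<exists>\<sigma>\<in>faces T. \<tau> \<subseteq> frontier \<sigma>)) \<and>
     (\<forall>\<sigma>\<in>faces T. \<exists>E\<subseteq>edges T. frontier \<sigma> = \<Union>E) \<and>
     (\<forall>\<sigma>\<in>faces T. \<forall>\<sigma>'\<in>faces T. \<sigma> \<noteq> \<sigma>' \<longrightarrow>
        closure \<sigma> \<inter> closure \<sigma>' = frontier \<sigma> \<inter> frontier \<sigma>' \<and>
        (\<exists>E\<subseteq>edges T. \<exists>V\<subseteq>vertices T. closure \<sigma> \<inter> closure \<sigma>' = \<Union>E \<union> V)) \<and>
     (\<forall>\<tau>\<in>edges T. \<forall>\<tau>'\<in>edges T. \<tau> \<noteq> \<tau>' \<longrightarrow>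
        \<tau> \<inter> \<tau>' = {} \<or> (\<exists>\<gamma>\<in>vertices T. \<tau> \<inter> \<tau>' = {\<gamma>})) \<and>
     (\<forall>\<gamma>\<in>vertices T. (\<exists>\<tau>\<in>edges T. horizontal \<tau> \<and> \<gamma> \<in> \<tau>) \<and>
                      (\<exists>\<tau>\<in>edges T. vertical \<tau> \<and> \<gamma> \<in> \<tau>))"

definition mesh_domain :: "tmesh \<Rightarrow> (real \<times> real) set" where
  "mesh_domain T = (\<Union>\<sigma>\<in>faces T. closure \<sigma>)"

definition simply_connected_tmesh :: "tmesh \<Rightarrow> bool" where
  "simply_connected_tmesh T \<longleftrightarrow>
     is_tmesh T \<and> simply_connected (mesh_domain T) \<and> connected (interior (mesh_domain T))"

definition interior_edges :: "tmesh \<Rightarrow> (real \<times> real) set set" where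
  "interior_edges T = {\<tau> \<in> edges T. \<tau> \<inter> interior (mesh_domain T) \<noteq> {}}"

definition interior_vertices :: "tmesh \<Rightarrow> (real \<times> real) set" where
  "interior_vertices T = vertices T \<inter> interior (mesh_domain T)"


section \<open>Splines\<close>

text \<open>Polynomials in \<open>s\<close> and \<open>t\<close>: the outer variable of \<^typ>\<open>real poly poly\<close> is \<open>t\<close>, and the
  coefficients are polynomials in \<open>s\<close>.\<close>

type_synonym poly2 = "real poly poly"

definition var_s :: poly2 where "var_s = [:[:0, 1:]:]"

definition var_t :: poly2 where "var_t = [:0, 1:]"

definition eval2 :: "poly2 \<Rightarrow> real \<times> real \<Rightarrow> real" where
  "eval2 p x = poly (poly p [:snd x:]) (fst x)"

definition polys :: "nat \<Rightarrow> nat \<Rightarrow> poly2 set" where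
  "polys m m' = span {var_s ^ i * var_t ^ j | i j. i \<le> m \<and> j \<le> m'}"

definition smoothness_distribution :: "tmesh \<Rightarrow> ((real \<times> real) set \<Rightarrow> int) \<Rightarrow> bool" where
  "smoothness_distribution T r \<longleftrightarrow>
     (\<forall>\<tau>\<in>edges T. - 1 \<le> r \<tau> \<and> (\<tau> \<notin> interior_edges T \<longrightarrow> r \<tau> = - 1))"

text \<open>The polynomial is determined by \<open>\<tau>\<close> up to a non-zero constant factor.\<close>

definition edge_poly :: "(real \<times> real) set \<Rightarrow> poly2" where
  "edge_poly \<tau> = (SOME l. l \<noteq> 0 \<and> (\<exists>a b c. l = a *\<^sub>R var_s + b *\<^sub>R var_t + c *\<^sub>R 1) \<and>
                          (\<forall>x\<in>\<tau>. eval2 l x = 0))"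

text \<open>The direct sum of the spaces \<open>V k\<close>, \<open>k \<in> K\<close>; an element \<open>c\<close> stands for the formal sum
  of the \<open>[k] c(k)\<close>.\<close>

definition chains :: "'k set \<Rightarrow> ('k \<Rightarrow> poly2 set) \<Rightarrow> ('k, poly2) poly_mapping set" where
  "chains K V = {c. Poly_Mapping.keys c \<subseteq> K \<and> (\<forall>k\<in>K. Poly_Mapping.lookup c k \<in> V k)}"

text \<open>A piecewise polynomial function \<open>f\<close> is given by its polynomial pieces on the faces.\<close>

definition spline_space ::
  "tmesh \<Rightarrow> nat \<Rightarrow> nat \<Rightarrow> ((real \<times> real) set \<Rightarrow> int) \<Rightarrow> ((real \<times> real) set, poly2) poly_mapping set" where
  "spline_space T m m' r =
     {f \<in> chains (faces T) (\<lambda>_. polys m m').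
        \<forall>\<tau>\<in>interior_edges T. \<forall>\<sigma>\<in>faces T. \<forall>\<sigma>'\<in>faces T. \<tau> \<subseteq> closure \<sigma> \<inter> closure \<sigma>' \<longrightarrow>
          edge_poly \<tau> ^ nat (r \<tau> + 1) dvd Poly_Mapping.lookup f \<sigma> - Poly_Mapping.lookup f \<sigma>'}"

definition r_h :: "tmesh \<Rightarrow> ((real \<times> real) set \<Rightarrow> int) \<Rightarrow> real \<times> real \<Rightarrow> int" where
  "r_h T r \<gamma> = Min (r ` {\<tau> \<in> edges T. vertical \<tau> \<and> \<gamma> \<in> \<tau>})"

definition r_v :: "tmesh \<Rightarrow> ((real \<times> real) set \<Rightarrow> int) \<Rightarrow> real \<times> real \<Rightarrow> int" where
  "r_v T r \<gamma> = Min (r ` {\<tau> \<in> edges T. horizontal \<tau> \<and> \<gamma> \<in> \<tau>})"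


section \<open>Quotient spaces\<close>

definition quotient_space :: "'a::real_vector set \<Rightarrow> 'a set \<Rightarrow> 'a set set" where
  "quotient_space V W = (\<lambda>v. (+) v ` W) ` V"

text \<open>\<open>B\<close> is a set of representatives of a finite basis of \<open>V / W\<close>: every coset is a linear
  combination of the cosets of the elements of \<open>B\<close>, with unique coefficients.\<close>

definition quotient_basis :: "'a::real_vector set \<Rightarrow> 'a set \<Rightarrow> 'a set \<Rightarrow> bool" where
  "quotient_basis V W B \<longleftrightarrow> finite B \<and> B \<subseteq> V \<and>
     (\<forall>X\<in>quotient_space V W.
        \<exists>!a. (\<forall>b. b \<notin> B \<longrightarrow> a b = (0::real)) \<and> X = (+) (\<Sum>b\<in>B. a b *\<^sub>R b) ` W)"

definition quotient_dim :: "'a::real_vector set \<Rightarrow> 'a set \<Rightarrow> nat" where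
  "quotient_dim V W = card (SOME B. quotient_basis V W B)"


section \<open>The complexes\<close>

definition edge_ideal ::
  "nat \<Rightarrow> nat \<Rightarrow> ((real \<times> real) set \<Rightarrow> int) \<Rightarrow> (real \<times> real) set \<Rightarrow> poly2 set" where
  "edge_ideal m m' r \<tau> = {p \<in> polys m m'. edge_poly \<tau> ^ nat (r \<tau> + 1) dvd p}"

definition vertex_ideal ::
  "tmesh \<Rightarrow> nat \<Rightarrow> nat \<Rightarrow> ((real \<times> real) set \<Rightarrow> int) \<Rightarrow> real \<times> real \<Rightarrow> poly2 set" where
  "vertex_ideal T m m' r \<gamma> = span (\<Union>\<tau>\<in>{\<tau> \<in> interior_edges T. \<gamma> \<in> \<tau>}. edge_ideal m m' r \<tau>)"

definition I_1 ::
  "tmesh \<Rightarrow> nat \<Rightarrow> nat \<Rightarrow> ((real \<times> real) set \<Rightarrow> int) \<Rightarrow> ((real \<times> real) set, poly2) poly_mapping set" where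
  "I_1 T m m' r = chains (interior_edges T) (edge_ideal m m' r)"

definition I_0 ::
  "tmesh \<Rightarrow> nat \<Rightarrow> nat \<Rightarrow> ((real \<times> real) set \<Rightarrow> int) \<Rightarrow> (real \<times> real, poly2) poly_mapping set" where
  "I_0 T m m' r = chains (interior_vertices T) (vertex_ideal T m m' r)"

text \<open>The generator \<open>[\<gamma>] p\<close>, with boundary vertices set to zero.\<close>

definition vertex_chain :: "tmesh \<Rightarrow> real \<times> real \<Rightarrow> poly2 \<Rightarrow> (real \<times> real, poly2) poly_mapping" where
  "vertex_chain T \<gamma> p = (if \<gamma> \<in> interior_vertices T then Poly_Mapping.single \<gamma> p else 0)"

definition boundary ::
  "tmesh \<Rightarrow> ((real \<times> real) set, poly2) poly_mapping \<Rightarrow> (real \<times> real, poly2) poly_mapping" where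
  "boundary T c =
     (\<Sum>\<tau>\<in>interior_edges T. vertex_chain T (edge_end \<tau>) (Poly_Mapping.lookup c \<tau>)
                           - vertex_chain T (edge_start \<tau>) (Poly_Mapping.lookup c \<tau>))"

definition H_0 ::
  "tmesh \<Rightarrow> nat \<Rightarrow> nat \<Rightarrow> ((real \<times> real) set \<Rightarrow> int) \<Rightarrow> (real \<times> real, poly2) poly_mapping set set" where
  "H_0 T m m' r = quotient_space (I_0 T m m' r) (boundary T ` I_1 T m m' r)"

text \<open>The zero coset is the only element.\<close>

definition H_0_zero :: "tmesh \<Rightarrow> nat \<Rightarrow> nat \<Rightarrow> ((real \<times> real) set \<Rightarrow> int) \<Rightarrow> bool" where
  "H_0_zero T m m' r \<longleftrightarrow> H_0 T m m' r = {boundary T ` I_1 T m m' r}"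

text \<open>Euler characteristic of the complex \<open>Q\<close>.  The direct sum of the quotients
  \<open>polys m m' / edge_ideal m m' r \<tau>\<close> is taken as the quotient of the direct sums (a coset of the
  direct sum of the ideals is a tuple of cosets), and likewise for the vertices.\<close>

definition euler_Q :: "tmesh \<Rightarrow> nat \<Rightarrow> nat \<Rightarrow> ((real \<times> real) set \<Rightarrow> int) \<Rightarrow> int" where
  "euler_Q T m m' r =
     int (dim (chains (faces T) (\<lambda>_. polys m m')))
     - int (quotient_dim (chains (interior_edges T) (\<lambda>_. polys m m')) (I_1 T m m' r))
     + int (quotient_dim (chains (interior_vertices T) (\<lambda>_. polys m m')) (I_0 T m m' r))"


section \<open>Segments\<close>

text \<open>A segment is represented by its set of edges; its vertices are their endpoints.\<close>

definition segment_vertices :: "(real \<times> real) set set \<Rightarrow> (real \<times> real) set" where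
  "segment_vertices A = (\<Union>\<tau>\<in>A. endpoints \<tau>)"

definition horizontal_segment :: "tmesh \<Rightarrow> (real \<times> real) set set \<Rightarrow> bool" where
  "horizontal_segment T A \<longleftrightarrow>
     A \<subseteq> interior_edges T \<and> (\<forall>\<tau>\<in>A. horizontal \<tau>) \<and> A \<noteq> {} \<and> connected (\<Union>A)"

definition vertical_segment :: "tmesh \<Rightarrow> (real \<times> real) set set \<Rightarrow> bool" where
  "vertical_segment T A \<longleftrightarrow>
     A \<subseteq> interior_edges T \<and> (\<forall>\<tau>\<in>A. vertical \<tau>) \<and> A \<noteq> {} \<and> connected (\<Union>A)"

definition segment :: "tmesh \<Rightarrow> (real \<times> real) set set \<Rightarrow> bool" where
  "segment T A \<longleftrightarrow> horizontal_segment T A \<or> vertical_segment T A"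

definition horizontal_weight ::
  "tmesh \<Rightarrow> nat \<Rightarrow> ((real \<times> real) set \<Rightarrow> int) \<Rightarrow> (real \<times> real) set set \<Rightarrow> int" where
  "horizontal_weight T m r A = (\<Sum>\<gamma>\<in>segment_vertices A. max (int m - r_h T r \<gamma>) 0)"

definition vertical_weight ::
  "tmesh \<Rightarrow> nat \<Rightarrow> ((real \<times> real) set \<Rightarrow> int) \<Rightarrow> (real \<times> real) set set \<Rightarrow> int" where
  "vertical_weight T m' r A = (\<Sum>\<gamma>\<in>segment_vertices A. max (int m' - r_v T r \<gamma>) 0)"

end

theory Submission
  imports Defs
begin

text \<open>The theorem has two independent halves: vanishing of \<open>H\<^sub>0\<close> yields the dimension formula for every
smoothness distribution, and vanishing of \<open>H\<^sub>0\<close> survives the passage from \<open>r\<close> to \<open>s\<close>.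

\<^bold>\<open>Dimension formula\<close> (\<open>dim_spline_space\<close>).  A face-wise polynomial function is a spline iff its jumps across
the interior edges lie in the edge ideals.  So the spline space is the kernel of the map
\<open>C\<^sub>2 \<rightarrow> C\<^sub>1 / I\<^sub>1\<close> that takes jumps, and the formula follows once \<open>C\<^sub>2 \<rightarrow> C\<^sub>1 / I\<^sub>1 \<rightarrow> C\<^sub>0 / I\<^sub>0 \<rightarrow> 0\<close> is exact; two
applications of rank-nullity modulo a subspace (\<open>dim_preimage_add_dim_sum\<close>) then do the count.
Exactness has three ingredients.  The jumps around an interior vertex cancel (\<open>net_inflow_jump\<close>).  Every
interior vertex starts an edge that leads right or up, so that iterating this step pushes any
\<open>0\<close>-chain to the boundary (\<open>boundary_surj\<close>).  Finally, if \<open>\<partial>c\<close> lies in \<open>I\<^sub>0\<close>, then \<open>H\<^sub>0 = 0\<close> provides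
\<open>i \<in> I\<^sub>1\<close> with \<open>\<partial>(c - i) = 0\<close>, and relative \<open>1\<close>-cycles are jumps.

The last statement is where topology enters (\<open>cycle_is_jump\<close>).  The boundary of a relative cycle sits
on vertices outside the interior of \<open>\<Omega>\<close>.  Since \<open>\<Omega>\<close> is compact, simply connected and locally path
connected, its complement is connected, so these vertices can be joined to one
point by axis-parallel paths that avoid the interior, which completes the relative cycle to a cycle in
the plane.  For such a cycle let \<open>G False z\<close> count, with coefficients, the horizontal pieces below \<open>z\<close>,
and \<open>G True z\<close> the vertical pieces to the left of \<open>z\<close>.  A piece from \<open>p\<close> to \<open>q\<close> contributes
\<open>quadrant p z - quadrant q z\<close> to one of the two counts, where \<open>quadrant p\<close> is the indicator function
of the open quadrant up and to the right of \<open>p\<close>; over a cycle these differences add up to \<open>0\<close>, whence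
\<open>G False = - G True\<close>.  While \<open>z\<close> moves vertically, the first count changes only
across horizontal pieces; while \<open>z\<close> moves horizontally, the second one changes only across vertical pieces.
So the common value, up to sign, is constant on faces, and its jumps are the coefficients of the cycle.

\<^bold>\<open>Lowering the smoothness\<close> (\<open>H_0_zero_lower_segment\<close>).  Passing to \<open>s\<close> only adds to \<open>I\<^sub>0\<close> the chains \<open>[\<gamma>] p\<close>
with \<open>\<gamma>\<close> on \<open>A\<close> and \<open>p\<close> in the common edge ideal \<open>J\<close> of the lowered edges.  The
edges of \<open>A\<close> make the class of \<open>[\<gamma>] p\<close> in the cokernel independent of \<open>\<gamma>\<close>, so it suffices to see
that it vanishes at one vertex.  In case (a), \<open>A\<close> has a vertex on an edge of \<open>B - A\<close>, whose old
ideal already contains \<open>J\<close>.  In case (b), the class vanishes for those \<open>p\<close> that are divisible by the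
power of the transversal linear form prescribed at any one of the vertices of \<open>A\<close>, and the weight is large
enough for sums of such \<open>p\<close> to exhaust \<open>J\<close>.  This is a statement on univariate polynomials
(\<open>span_power_linear_multiples\<close>): a functional \<open>\<phi>\<close> that vanishes on all these multiples gives a polynomial
\<open>y \<mapsto> \<phi> ((x - y)\<^sup>m)\<close> of degree at most \<open>m\<close> with more than \<open>m\<close> zeros, counted with multiplicity.

Horizontal and vertical edges are treated together: a Boolean \<open>w\<close> says which coordinate plays the role
of the first one.\<close>

section \<open>Dimensions modulo a subspace\<close>

lemma ex1_eqD: "\<exists>!x. P x \<Longrightarrow> P x \<Longrightarrow> P y \<Longrightarrow> x = y"
  by blast

text \<open>Polynomials and chains form types of infinite dimension; the dimension counts take place in the subspaces
  of bounded degree, which have a finite spanning set.\<close>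
definition fin_subspace :: "'a::real_vector set \<Rightarrow> bool" where
  "fin_subspace V \<longleftrightarrow> subspace V \<and> (\<exists>S. finite S \<and> V \<subseteq> span S)"

lemma fin_subspace_subset:
  "fin_subspace V \<Longrightarrow> subspace W \<Longrightarrow> W \<subseteq> V \<Longrightarrow> fin_subspace W"
  unfolding fin_subspace_def by blast

lemma fin_subspace_basis_extend:
  assumes "fin_subspace V" "independent C" "C \<subseteq> V"
  obtains B where "C \<subseteq> B" "finite B" "independent B" "span B = V"
proof -
  from assms obtain B where B: "C \<subseteq> B" "B \<subseteq> V" "independent B" "V \<subseteq> span B"
    using maximal_independent_subset_extend by metis
  obtain S where "finite S" "V \<subseteq> span S" using assms unfolding fin_subspace_def by auto
  then have "finite B" using B independent_span_bound by (meson order_trans)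
  moreover have "span B = V"
    using B assms unfolding fin_subspace_def by (metis span_subspace)
  ultimately show ?thesis using that B by auto
qed

text \<open>A family that is independent modulo \<open>W\<close> forms, together with a basis of \<open>W\<close>, a basis of the span.\<close>
lemma dim_eq_add_card_independent_mod:
  fixes f :: "'a::real_vector \<Rightarrow> 'b::real_vector"
  assumes W: "fin_subspace W" and fin: "finite B"
    and indep: "\<And>a. (\<Sum>b\<in>B. a b *\<^sub>R f b) \<in> W \<Longrightarrow> \<forall>b\<in>B. a b = 0"
    and U: "span (W \<union> f ` B) = U"
  shows "dim U = dim W + card B"
proof -
  have subW: "subspace W" using W by (simp add: fin_subspace_def)
  obtain C where C: "finite C" "independent C" "span C = W"
    using fin_subspace_basis_extend[OF W independent_empty] by auto
  have inj: "inj_on f B"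
  proof (rule inj_onI)
    fix x y assume xy: "x \<in> B" "y \<in> B" "f x = f y"
    show "x = y"
    proof (rule ccontr)
      assume "x \<noteq> y"
      have "(\<Sum>b\<in>B. (of_bool (b = x) - of_bool (b = y)) *\<^sub>R f b)
            = (\<Sum>b\<in>B. of_bool (b = x) *\<^sub>R f b) - (\<Sum>b\<in>B. of_bool (b = y) *\<^sub>R f b)"
        by (simp add: scaleR_diff_left sum_subtractf)
      also have "\<dots> = f x - f y"
        using xy fin by (simp add: of_bool_def if_distrib[of "\<lambda>c. c *\<^sub>R _"] cong: if_cong)
      also have "\<dots> \<in> W" using xy subW by (simp add: subspace_0)
      finally have "of_bool (x = x) - of_bool (x = y) = (0::real)"
        using indep[of "\<lambda>b. of_bool (b = x) - of_bool (b = y)"] xy by blast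
      then show False using \<open>x \<noteq> y\<close> by simp
    qed
  qed
  have key: "\<And>a c. (\<Sum>b\<in>B. a b *\<^sub>R f b) + (\<Sum>x\<in>C. c x *\<^sub>R x) = 0 \<Longrightarrow> (\<forall>b\<in>B. a b = 0) \<and> (\<forall>x\<in>C. c x = 0)"
  proof
    fix a c assume eq: "(\<Sum>b\<in>B. a b *\<^sub>R f b) + (\<Sum>x\<in>C. c x *\<^sub>R x) = 0"
    then have "(\<Sum>b\<in>B. a b *\<^sub>R f b) = - (\<Sum>x\<in>C. c x *\<^sub>R x)" by (simp add: eq_neg_iff_add_eq_0)
    also have "\<dots> \<in> span C" by (intro span_neg span_sum span_scale span_base)
    finally show *: "\<forall>b\<in>B. a b = 0" using indep C by auto
    with eq have "(\<Sum>x\<in>C. c x *\<^sub>R x) = 0" by simp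
    then show "\<forall>x\<in>C. c x = 0" using independentD[OF C(2,1) order_refl] by blast
  qed
  have disj: "C \<inter> f ` B = {}"
  proof (rule ccontr)
    assume "C \<inter> f ` B \<noteq> {}"
    then obtain b where b: "b \<in> B" "f b \<in> C" by auto
    have "(\<Sum>b'\<in>B. of_bool (b' = b) *\<^sub>R f b') = f b"
      using b fin by (simp add: of_bool_def if_distrib[of "\<lambda>c. c *\<^sub>R _"] cong: if_cong)
    also have "\<dots> \<in> W" using b C span_base by blast
    finally show False using indep b by fastforce
  qed
  have "independent (C \<union> f ` B)"
  proof (subst independent_explicit_module, intro allI impI)
    fix S g v assume S: "finite S" "S \<subseteq> C \<union> f ` B" "(\<Sum>u\<in>S. g u *\<^sub>R u) = 0" "v \<in> S"
    define g' where "g' = (\<lambda>u. if u \<in> S then g u else 0)"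
    have "0 = (\<Sum>u\<in>S. g u *\<^sub>R u)" using S by simp
    also have "\<dots> = (\<Sum>u\<in>C \<union> f ` B. g' u *\<^sub>R u)"
      unfolding g'_def using S C fin by (intro sum.mono_neutral_cong_left) auto
    also have "\<dots> = (\<Sum>b\<in>B. g' (f b) *\<^sub>R f b) + (\<Sum>x\<in>C. g' x *\<^sub>R x)"
      using C fin disj inj by (simp add: sum.union_disjoint sum.reindex)
    finally have "(\<forall>b\<in>B. g' (f b) = 0) \<and> (\<forall>x\<in>C. g' x = 0)" using key by metis
    moreover have "g' v = g v" using S by (simp add: g'_def)
    ultimately show "g v = 0" using S(2,4) by (auto simp: subset_iff)
  qed
  moreover have "span (C \<union> f ` B) = U"
    unfolding U[symmetric] C(3)[symmetric] by (simp only: span_Un span_span)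
  ultimately have "dim U = card (C \<union> f ` B)"
    by (metis dim_span_eq_card_independent)
  also have "\<dots> = card C + card B"
    using C fin disj inj by (simp add: card_Un_disjoint card_image)
  also have "card C = dim W" using C by (metis dim_span_eq_card_independent)
  finally show ?thesis .
qed

text \<open>Rank-nullity for the map \<open>V \<rightarrow> U / W\<close> induced by \<open>f\<close>: its kernel is the preimage of \<open>W\<close>, and it is onto by the
  choice of \<open>U\<close>.  In terms of bases: a basis of the kernel is extended to one of \<open>V\<close>, and the
  images of the added vectors are a basis of \<open>U\<close> modulo \<open>W\<close>.\<close>
lemma dim_preimage_add_dim_sum:
  fixes f :: "'a::real_vector \<Rightarrow> 'b::real_vector"
  assumes f: "linear f" and V: "fin_subspace V" and W: "fin_subspace W"
    and U: "U = {f v + w | v w. v \<in> V \<and> w \<in> W}"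
  shows "dim {v\<in>V. f v \<in> W} + dim U = dim V + dim W"
proof -
  interpret linear f by fact
  let ?K = "{v\<in>V. f v \<in> W}"
  have sV: "subspace V" and sW: "subspace W" using V W by (auto simp: fin_subspace_def)
  have sK: "subspace ?K"
    using sV sW by (auto simp: subspace_def add scaleR)
  have finK: "fin_subspace ?K" by (rule fin_subspace_subset[OF V sK]) auto
  obtain C where C: "finite C" "independent C" "span C = ?K"
    using fin_subspace_basis_extend[OF finK independent_empty] by auto
  then have "C \<subseteq> V" using span_superset by blast
  then obtain B where B: "C \<subseteq> B" "finite B" "independent B" "span B = V"
    using fin_subspace_basis_extend[OF V] C by metis
  let ?D = "B - C"
  have dimV: "dim V = dim ?K + card ?D"
  proof -
    have "dim V = card B" "dim ?K = card C"
      using B C by (metis dim_span_eq_card_independent)+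
    moreover have "card C + card ?D = card B"
      using B C by (metis card_Diff_subset card_mono le_add_diff_inverse)
    ultimately show ?thesis by simp
  qed
  have "dim U = dim W + card ?D"
  proof (rule dim_eq_add_card_independent_mod[OF W, of _ f])
    show "finite ?D" using B by simp
  next
    fix a assume a: "(\<Sum>b\<in>?D. a b *\<^sub>R f b) \<in> W"
    let ?v = "\<Sum>b\<in>?D. a b *\<^sub>R b"
    have "?v \<in> V" using B by (metis (no_types, lifting) DiffD1 span_base span_scale span_sum)
    moreover have "f ?v \<in> W" using a by (simp add: sum scaleR)
    ultimately have "?v \<in> span C" using C by simp
    then obtain c where c: "?v = (\<Sum>x\<in>C. c x *\<^sub>R x)" using C by (auto simp: span_finite)
    have "(\<Sum>x\<in>B. (if x \<in> C then - c x else a x) *\<^sub>R x)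
          = (\<Sum>x\<in>C. (if x \<in> C then - c x else a x) *\<^sub>R x) + (\<Sum>x\<in>?D. (if x \<in> C then - c x else a x) *\<^sub>R x)"
      using B by (metis (no_types, lifting) sum.subset_diff add.commute)
    also have "\<dots> = - (\<Sum>x\<in>C. c x *\<^sub>R x) + ?v"
      by (simp add: sum_negf)
    also have "\<dots> = 0" using c by simp
    finally have "\<forall>x\<in>B. (if x \<in> C then - c x else a x) = 0"
      using independentD[OF B(3,2) order_refl, of "\<lambda>x. if x \<in> C then - c x else a x"] by simp
    then show "\<forall>b\<in>?D. a b = 0" by auto
  next
    show "span (W \<union> f ` ?D) = U"
    proof
      have "subspace U"
      proof -
        have "U = {x + y | x y. x \<in> f ` V \<and> y \<in> W}" unfolding U by blast
        then show ?thesis using subspace_sums[OF linear_subspace_image[OF f sV] sW] by simp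
      qed
      moreover have "W \<subseteq> U" unfolding U using sV
        by (force intro: exI[of _ 0] simp: zero subspace_0)
      moreover have "f ` ?D \<subseteq> U"
      proof -
        have "?D \<subseteq> V" using B span_superset by blast
        then show ?thesis unfolding U using sW subspace_0 by force
      qed
      ultimately show "span (W \<union> f ` ?D) \<subseteq> U" by (simp add: span_minimal)
    next
      have fB: "f b \<in> span (W \<union> f ` ?D)" if "b \<in> B" for b
      proof (cases "b \<in> C")
        case True
        then have "f b \<in> W" using C span_base by blast
        then show ?thesis by (simp add: span_base)
      next
        case False then show ?thesis using that by (auto intro: span_base)
      qed
      have "f ` V \<subseteq> span (W \<union> f ` ?D)"
      proof -
        have "f ` V = span (f ` B)" using B f by (metis linear_span_image)
        also have "\<dots> \<subseteq> span (W \<union> f ` ?D)" using fB by (intro span_minimal) auto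
        finally show ?thesis .
      qed
      then show "U \<subseteq> span (W \<union> f ` ?D)"
        unfolding U by (auto intro!: span_add intro: span_base)
    qed
  qed
  with dimV show ?thesis by simp
qed

lemma coset_eq_iff:
  assumes "subspace W"
  shows "(+) x ` W = (+) y ` W \<longleftrightarrow> x - y \<in> W"
proof
  assume "(+) x ` W = (+) y ` W"
  then have "x + 0 \<in> (+) y ` W" using assms by (metis image_eqI subspace_0)
  then show "x - y \<in> W" by auto
next
  have *: "(+) x ` W \<subseteq> (+) y ` W" if "x - y \<in> W" for x y :: 'a
  proof clarify
    fix w assume "w \<in> W"
    then have "(x - y) + w \<in> W" using that assms by (simp add: subspace_add)
    moreover have "x + w = y + ((x - y) + w)" by simp
    ultimately show "x + w \<in> (+) y ` W" by (metis image_eqI)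
  qed
  assume "x - y \<in> W"
  moreover from this have "y - x \<in> W" using assms by (metis minus_diff_eq subspace_neg)
  ultimately show "(+) x ` W = (+) y ` W" using * by blast
qed

lemma quotient_basis_card:
  assumes V: "fin_subspace V" and W: "subspace W" and WV: "W \<subseteq> V" and B: "quotient_basis V W B"
  shows "dim V = dim W + card B"
proof (rule dim_eq_add_card_independent_mod[where f = "\<lambda>b. b" and B = B])
  have sV: "subspace V" using V by (simp add: fin_subspace_def)
  show "fin_subspace W" using fin_subspace_subset V W WV by blast
  show fin: "finite B" and BV: "span (W \<union> (\<lambda>b. b) ` B) = V"
  proof -
    show "finite B" using B by (simp add: quotient_basis_def)
    show "span (W \<union> (\<lambda>b. b) ` B) = V"
    proof
      show "span (W \<union> (\<lambda>b. b) ` B) \<subseteq> V"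
        using B WV sV by (intro span_minimal) (auto simp: quotient_basis_def)
      show "V \<subseteq> span (W \<union> (\<lambda>b. b) ` B)"
      proof
        fix v assume v: "v \<in> V"
        then have "(+) v ` W \<in> quotient_space V W" by (simp add: quotient_space_def)
        then obtain a where "(+) v ` W = (+) (\<Sum>b\<in>B. a b *\<^sub>R b) ` W"
          using B unfolding quotient_basis_def by meson
        then have "v - (\<Sum>b\<in>B. a b *\<^sub>R b) \<in> W" using coset_eq_iff[OF W] by blast
        then have "(v - (\<Sum>b\<in>B. a b *\<^sub>R b)) + (\<Sum>b\<in>B. a b *\<^sub>R b) \<in> span (W \<union> (\<lambda>b. b) ` B)"
          by (intro span_add span_sum span_scale) (auto intro: span_base)
        then show "v \<in> span (W \<union> (\<lambda>b. b) ` B)" by simp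
      qed
    qed
  qed
  fix a assume a: "(\<Sum>b\<in>B. a b *\<^sub>R b) \<in> W"
  define a' where "a' = (\<lambda>b. if b \<in> B then a b else 0)"
  have a': "(\<Sum>b\<in>B. a' b *\<^sub>R b) = (\<Sum>b\<in>B. a b *\<^sub>R b)" by (simp add: a'_def)
  have "(+) 0 ` W \<in> quotient_space V W"
    using sV subspace_0 unfolding quotient_space_def by blast
  then have ex1: "\<exists>!a. (\<forall>b. b \<notin> B \<longrightarrow> a b = (0::real)) \<and> (+) 0 ` W = (+) (\<Sum>b\<in>B. a b *\<^sub>R b) ` W"
    using B unfolding quotient_basis_def by (elim conjE) (erule (1) bspec)
  have "(\<forall>b. b \<notin> B \<longrightarrow> a' b = (0::real)) \<and> (+) 0 ` W = (+) (\<Sum>b\<in>B. a' b *\<^sub>R b) ` W"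
    unfolding a' coset_eq_iff[OF W] using a W by (auto simp: a'_def subspace_neg)
  moreover have "(\<forall>b. b \<notin> B \<longrightarrow> (\<lambda>_. 0) b = (0::real)) \<and> (+) 0 ` W = (+) (\<Sum>b\<in>B. (\<lambda>_. 0) b *\<^sub>R b) ` W"
    by simp
  ultimately have "a' = (\<lambda>_. 0)" by (rule ex1_eqD[OF ex1])
  then show "\<forall>b\<in>B. a b = 0" unfolding a'_def by meson
qed

lemma quotient_basis_exists:
  assumes V: "fin_subspace V" and W: "subspace W" and WV: "W \<subseteq> V"
  shows "\<exists>B. quotient_basis V W B"
proof -
  have finW: "fin_subspace W" using fin_subspace_subset V W WV by blast
  obtain C where C: "finite C" "independent C" "span C = W"
    using fin_subspace_basis_extend[OF finW independent_empty] by auto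
  then have "C \<subseteq> V" using WV span_superset by blast
  then obtain B where B: "C \<subseteq> B" "finite B" "independent B" "span B = V"
    using fin_subspace_basis_extend[OF V] C by metis
  let ?D = "B - C"
  have indep: "\<forall>b\<in>?D. a b = 0" if a: "(\<Sum>b\<in>?D. a b *\<^sub>R b) \<in> W" for a
  proof -
    obtain c where c: "(\<Sum>b\<in>?D. a b *\<^sub>R b) = (\<Sum>x\<in>C. c x *\<^sub>R x)" 
      using a C by (auto simp: span_finite)
    have "(\<Sum>x\<in>B. (if x \<in> C then - c x else a x) *\<^sub>R x)
          = (\<Sum>x\<in>C. (if x \<in> C then - c x else a x) *\<^sub>R x) + (\<Sum>x\<in>?D. (if x \<in> C then - c x else a x) *\<^sub>R x)"
      using B by (metis (no_types, lifting) sum.subset_diff add.commute)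
    also have "\<dots> = 0" using c by (simp add: sum_negf)
    finally have "\<forall>x\<in>B. (if x \<in> C then - c x else a x) = 0"
      using independentD[OF B(3,2) order_refl, of "\<lambda>x. if x \<in> C then - c x else a x"] by simp
    then show ?thesis by auto
  qed
  have "quotient_basis V W ?D"
    unfolding quotient_basis_def
  proof (intro conjI ballI)
    show "finite ?D" "?D \<subseteq> V" using B span_superset by auto
    fix X assume "X \<in> quotient_space V W"
    then obtain v where v: "v \<in> V" "X = (+) v ` W" by (auto simp: quotient_space_def)
    obtain a where a: "v = (\<Sum>b\<in>B. a b *\<^sub>R b)" using v B by (auto simp: span_finite)
    define a' where "a' = (\<lambda>b. if b \<in> ?D then a b else 0)"
    have "v = (\<Sum>b\<in>C. a b *\<^sub>R b) + (\<Sum>b\<in>?D. a b *\<^sub>R b)"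
      unfolding a using B by (metis (no_types, lifting) sum.subset_diff add.commute)
    also have "(\<Sum>b\<in>?D. a b *\<^sub>R b) = (\<Sum>b\<in>?D. a' b *\<^sub>R b)" by (simp add: a'_def)
    finally have "v - (\<Sum>b\<in>?D. a' b *\<^sub>R b) = (\<Sum>b\<in>C. a b *\<^sub>R b)" by simp
    also have "\<dots> \<in> W" using C by (metis (no_types, lifting) span_base span_scale span_sum)
    finally have ex: "X = (+) (\<Sum>b\<in>?D. a' b *\<^sub>R b) ` W" using v coset_eq_iff[OF W] by blast
    show "\<exists>!a. (\<forall>b. b \<notin> ?D \<longrightarrow> a b = (0::real)) \<and> X = (+) (\<Sum>b\<in>?D. a b *\<^sub>R b) ` W"
    proof (rule ex1I)
      show "(\<forall>b. b \<notin> ?D \<longrightarrow> a' b = (0::real)) \<and> X = (+) (\<Sum>b\<in>?D. a' b *\<^sub>R b) ` W"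
        using ex by (auto simp: a'_def)
      fix e assume e: "(\<forall>b. b \<notin> ?D \<longrightarrow> e b = (0::real)) \<and> X = (+) (\<Sum>b\<in>?D. e b *\<^sub>R b) ` W"
      then have "(\<Sum>b\<in>?D. e b *\<^sub>R b) - (\<Sum>b\<in>?D. a' b *\<^sub>R b) \<in> W"
        using ex coset_eq_iff[OF W] by blast
      then have "(\<Sum>b\<in>?D. (e b - a' b) *\<^sub>R b) \<in> W"
        by (simp add: sum_subtractf scaleR_diff_left)
      then have "\<forall>b\<in>?D. e b - a' b = 0" by (rule indep)
      moreover have "e b = a' b" if "b \<notin> ?D" for b
        using e that unfolding a'_def by (simp only: if_False) blast
      ultimately show "e = a'" by (metis eq_iff_diff_eq_0 ext)
    qed
  qed
  then show ?thesis by blast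
qed

lemma quotient_dim_eq:
  assumes "fin_subspace V" "subspace W" "W \<subseteq> V"
  shows "int (quotient_dim V W) = int (dim V) - int (dim W)"
proof -
  have "quotient_basis V W (SOME B. quotient_basis V W B)"
    using quotient_basis_exists[OF assms] by (rule someI_ex)
  from quotient_basis_card[OF assms this] show ?thesis by (simp add: quotient_dim_def)
qed

section \<open>Polynomials in one and in two variables\<close>

lemma scaleR_real_poly: "(c::real) *\<^sub>R (p :: real poly) = smult c p"
  by (rule poly_eqI) simp

lemma scaleR_poly2: "(c::real) *\<^sub>R (p :: poly2) = smult [:c:] p"
  by (rule poly_eqI) (simp add: scaleR_real_poly)

lemma separating_functional:
  fixes S :: "'a::real_vector set"
  assumes S: "subspace S" and q: "q \<notin> S"
  obtains \<phi> :: "'a \<Rightarrow> real" where "linear \<phi>" "\<And>x. x \<in> S \<Longrightarrow> \<phi> x = 0" "\<phi> q = 1"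
proof -
  obtain C where C: "C \<subseteq> S" "independent C" "S \<subseteq> span C" using basis_exists by metis
  then have spanC: "span C = S" using S by (simp add: span_subspace)
  have "independent (insert q C)" using C q spanC by (simp add: independent_insertI)
  then obtain \<phi> :: "'a \<Rightarrow> real" where \<phi>: "linear \<phi>" "\<forall>x\<in>insert q C. \<phi> x = of_bool (x = q)"
    using linear_independent_extend[of "insert q C" "\<lambda>x. of_bool (x = q)"] by blast
  have "\<phi> x = 0" if "x \<in> S" for x
  proof (rule linear_eq_0_on_span[OF \<phi>(1)])
    show "\<And>x. x \<in> C \<Longrightarrow> \<phi> x = 0" using \<phi> C q by auto
    show "x \<in> span C" using that spanC by simp
  qed
  then show ?thesis using that \<phi> by force
qed

text \<open>A nonzero polynomial has at most as many zeros, with multiplicity, as its degree.\<close>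
lemma power_linear_dvd_imp_eq_0:
  fixes h :: "real poly"
  assumes fin: "finite I" and inj: "inj_on a I" and deg: "degree h < (\<Sum>i\<in>I. n i)"
    and dvd: "\<And>i. i \<in> I \<Longrightarrow> [:- a i, 1:] ^ n i dvd h"
  shows "h = 0"
proof (rule ccontr)
  assume h: "h \<noteq> 0"
  have "(\<Sum>i\<in>I. n i) \<le> (\<Sum>i\<in>I. order (a i) h)"
    using dvd h by (intro sum_mono) (simp add: order_divides)
  also have "\<dots> = (\<Sum>x\<in>a ` I. order x h)" using inj by (simp add: sum.reindex)
  also have "\<dots> = (\<Sum>x\<in>a ` I \<inter> {x. poly h x = 0}. order x h)"
    using fin h by (intro sum.mono_neutral_right) (auto simp: order_root)
  also have "\<dots> \<le> (\<Sum>x | poly h x = 0. order x h)"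
    using h by (intro sum_mono2) (auto simp: poly_roots_finite)
  also have "\<dots> \<le> degree h" using h by (rule sum_order_le_degree)
  finally show False using deg by simp
qed

lemma const_poly_power: "[:c:] ^ n = [:c ^ n:]"
  by (induction n) (simp_all add: one_pCons mult.commute)

text \<open>Let \<open>\<phi>\<close> be a functional that vanishes on \<open>S\<close> but not at \<open>q\<close>, and consider
  \<open>h y = \<phi> ((x - y)\<^sup>m)\<close>, a polynomial of degree at most \<open>m\<close> in \<open>y\<close>.  Expanding \<open>x - y = (x - b) - (y - b)\<close>
  gives the Taylor expansion \<open>H b\<close> of \<open>h\<close> at \<open>b\<close>.  At \<open>b = a i\<close> the terms with
  \<open>(x - a i) ^ (m - l) \<in> S\<close> drop out, and what remains is divisible by \<open>(y - a i) ^ (m + 1 - k i)\<close>.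
  By \<open>weight\<close>, \<open>h\<close> has too many zeros.  So \<open>h = 0\<close>, and its coefficients are nonzero multiples of the
  values \<open>\<phi> (x ^ j)\<close>, which forces \<open>\<phi> q = 0\<close>.\<close>
lemma span_power_linear_multiples:
  fixes S :: "real poly set"
  assumes S: "subspace S" and fin: "finite I" and inj: "inj_on a I"
    and weight: "m + 1 \<le> (\<Sum>i\<in>I. m + 1 - k i)"
    and mult: "\<And>i q. i \<in> I \<Longrightarrow> degree q \<le> m \<Longrightarrow> [:- a i, 1:] ^ k i dvd q \<Longrightarrow> q \<in> S"
    and q: "degree q \<le> m"
  shows "q \<in> S"
proof (rule ccontr)
  assume "q \<notin> S"
  with S obtain \<phi> :: "real poly \<Rightarrow> real"
    where \<phi>: "linear \<phi>" and \<phi>0: "\<And>x. x \<in> S \<Longrightarrow> \<phi> x = 0" and \<phi>q: "\<phi> q = 1"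
    using separating_functional by metis
  interpret \<phi>: linear \<phi> by fact
  have smult: "\<phi> (smult c p) = c * \<phi> p" for c p
    using \<phi>.scaleR[of c p] by (simp add: scaleR_real_poly)
  \<comment> \<open>The Taylor expansion at \<open>b\<close> of \<open>y \<mapsto> \<phi> ((x - y)\<^sup>m)\<close>; it does not depend on \<open>b\<close>.\<close>
  define H where "H b = (\<Sum>l\<le>m. smult (of_nat (m choose l) * (-1) ^ l * \<phi> ([:- b, 1:] ^ (m - l))) ([:- b, 1:] ^ l))" for b
  have "poly (H b) y = \<phi> ([:- y, 1:] ^ m)" for b y
  proof -
    have "[:- y, 1:] ^ m = ([:- (y - b):] + [:- b, 1:]) ^ m" by simp
    also have "\<dots> = (\<Sum>l\<le>m. of_nat (m choose l) * [:- (y - b):] ^ l * [:- b, 1:] ^ (m - l))"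
      by (rule binomial_ring)
    also have "\<dots> = (\<Sum>l\<le>m. smult (of_nat (m choose l) * (- (y - b)) ^ l) ([:- b, 1:] ^ (m - l)))"
      by (intro sum.cong) (simp_all add: of_nat_poly const_poly_power mult.commute)
    finally have pow: "[:- y, 1:] ^ m = (\<Sum>l\<le>m. smult (of_nat (m choose l) * (- (y - b)) ^ l) ([:- b, 1:] ^ (m - l)))" .
    have "\<phi> ([:- y, 1:] ^ m) = (\<Sum>l\<le>m. of_nat (m choose l) * (- (y - b)) ^ l * \<phi> ([:- b, 1:] ^ (m - l)))"
      unfolding pow \<phi>.sum smult ..
    also have "\<dots> = poly (H b) y"
      unfolding H_def poly_sum power_minus[of "y - b"] by (intro sum.cong refl) simp
    finally show ?thesis ..
  qed
  then have "poly (H b) = poly (H 0)" for b by (intro ext) simp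
  then have H: "H b = H 0" for b by (simp add: poly_eq_poly_eq_iff)
  have "H 0 = 0"
  proof (rule power_linear_dvd_imp_eq_0[OF fin inj])
    have "degree (H 0) \<le> m"
      unfolding H_def by (intro degree_sum_le) (auto intro!: order_trans[OF degree_smult_le] simp: degree_linear_power)
    then show "degree (H 0) < (\<Sum>i\<in>I. m + 1 - k i)" using weight by linarith
    fix i assume i: "i \<in> I"
    have "[:- a i, 1:] ^ (m + 1 - k i) dvd H (a i)"
      unfolding H_def
    proof (intro dvd_sum)
      fix l assume l: "l \<in> {..m}"
      show "[:- a i, 1:] ^ (m + 1 - k i) dvd
         smult (of_nat (m choose l) * (- 1) ^ l * \<phi> ([:- a i, 1:] ^ (m - l))) ([:- a i, 1:] ^ l)"
      proof (cases "k i \<le> m - l")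
        case True
        then have "[:- a i, 1:] ^ (m - l) \<in> S"
          using i by (intro mult) (auto simp: degree_linear_power le_imp_power_dvd)
        then show ?thesis by (simp add: \<phi>0)
      next
        case False
        then show ?thesis by (intro dvd_smult le_imp_power_dvd) simp
      qed
    qed
    then show "[:- a i, 1:] ^ (m + 1 - k i) dvd H 0" by (simp only: H[of "a i"])
  qed
  have \<phi>mon: "\<phi> (monom 1 j) = 0" if "j \<le> m" for j
  proof -
    have mon: "[:- 0, 1:] ^ n = monom (1::real) n" for n by (simp add: monom_altdef)
    have "0 = coeff (H 0) (m - j)" using \<open>H 0 = 0\<close> by simp
    also have "\<dots> = (\<Sum>l\<le>m. if l = m - j then of_nat (m choose l) * (-1) ^ l * \<phi> (monom 1 (m - l)) else 0)"
      unfolding H_def coeff_sum mon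
      by (intro sum.cong) auto
    also have "\<dots> = of_nat (m choose (m - j)) * (-1) ^ (m - j) * \<phi> (monom 1 j)"
      using that by simp
    finally show ?thesis using that by (auto simp: not_less)
  qed
  have "q = (\<Sum>i\<le>m. smult (coeff q i) (monom 1 i))"
    using poly_as_sum_of_monoms'[OF q] by (simp add: smult_monom)
  then have "\<phi> q = (\<Sum>i\<le>m. coeff q i * \<phi> (monom 1 i))" by (metis (no_types, lifting) \<phi>.sum smult sum.cong)
  also have "\<dots> = 0" by (simp add: \<phi>mon)
  finally show False using \<phi>q by simp
qed

text \<open>A polynomial in \<open>s\<close> for \<open>w = False\<close>, in \<open>t\<close> for \<open>w = True\<close>.\<close>
definition univariate :: "bool \<Rightarrow> real poly \<Rightarrow> poly2" where
  "univariate w a = (if w then map_poly (\<lambda>c. [:c:]) a else [:a:])"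

text \<open>The coefficient of the \<open>i\<close>-th power of the variable selected by \<open>w\<close>, as a polynomial in the other
  variable.\<close>
definition slice :: "bool \<Rightarrow> nat \<Rightarrow> poly2 \<Rightarrow> real poly" where
  "slice w i p = (if w then coeff p i else map_poly (\<lambda>c. coeff c i) p)"

lemma const_poly_sum: "[:\<Sum>i\<in>A. f i:] = (\<Sum>i\<in>A. [:f i:])"
proof (induction A rule: infinite_finite_induct)
  case (insert x F)
  then show ?case by (simp flip: insert.IH)
qed auto

lemma univariate_mult: "univariate w (a * b) = univariate w a * univariate w b"
  unfolding univariate_def
  by (auto intro!: poly_eqI simp: coeff_map_poly coeff_mult const_poly_sum mult.commute)

lemma univariate_1 [simp]: "univariate w 1 = 1"
  by (simp add: univariate_def one_pCons map_poly_pCons)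

lemma univariate_power: "univariate w (a ^ n) = univariate w a ^ n"
  by (induction n) (simp_all add: univariate_mult)

lemma univariate_dvd: "a dvd b \<Longrightarrow> univariate w a dvd univariate w b"
  by (auto simp: univariate_mult elim!: dvdE)

lemma coeff_univariate_mult_univariate: "coeff (coeff (univariate w a * univariate (\<not> w) b) j) i =
    (if w then coeff a j * coeff b i else coeff a i * coeff b j)"
proof (cases w)
  case True
  then have "univariate w a * univariate (\<not> w) b = smult b (map_poly (\<lambda>c. [:c:]) a)"
    by (simp add: univariate_def)
  then show ?thesis using True by (simp add: coeff_map_poly)
next
  case False
  then show ?thesis by (simp add: univariate_def coeff_map_poly)
qed

text \<open>Slices are linear over the polynomials in the other variable.  Hence divisibility of a bivariate
  polynomial by such a polynomial can be read off its slices.\<close>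
lemma slice_univariate_mult: "slice w i (univariate (\<not> w) b * g) = b * slice w i g"
proof (cases w)
  case True then show ?thesis by (simp add: univariate_def slice_def)
next
  case False
  then show ?thesis
    unfolding univariate_def slice_def
    by (auto intro!: poly_eqI simp: coeff_map_poly coeff_mult coeff_sum)
qed

lemma mem_polys_iff: "p \<in> polys m m' \<longleftrightarrow> (\<forall>j i. coeff (coeff p j) i \<noteq> 0 \<longrightarrow> i \<le> m \<and> j \<le> m')"
proof -
  have mon: "var_s ^ i * var_t ^ j = monom (monom 1 i) j" for i j
  proof -
    have "var_s ^ i = [:monom 1 i:]" by (simp add: var_s_def const_poly_power monom_altdef)
    moreover have "var_t ^ j = monom 1 j" by (simp add: var_t_def monom_altdef)
    ultimately show ?thesis by (simp add: smult_monom)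
  qed
  let ?P = "{p::poly2. \<forall>j i. coeff (coeff p j) i \<noteq> 0 \<longrightarrow> i \<le> m \<and> j \<le> m'}"
  have "polys m m' \<subseteq> ?P"
    unfolding polys_def mon
  proof (rule span_minimal)
    show "subspace ?P"
      by (rule subspaceI) (auto, (metis add.right_neutral)+)
  qed (auto simp: coeff_monom split: if_splits)
  moreover have "p \<in> polys m m'" if "p \<in> ?P" for p
  proof -
    have "p = (\<Sum>j\<le>m'. \<Sum>i\<le>m. coeff (coeff p j) i *\<^sub>R (monom (monom 1 i) j))"
    proof (intro poly_eqI)
      fix j i
      have "coeff (coeff (\<Sum>j\<le>m'. \<Sum>i\<le>m. coeff (coeff p j) i *\<^sub>R (monom (monom 1 i) j)) j) i
        = (\<Sum>j'\<le>m'. if j' = j then (\<Sum>i'\<le>m. if i' = i then coeff (coeff p j') i' else 0) else 0)"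
        unfolding coeff_sum by (intro sum.cong) (auto simp: coeff_sum coeff_monom if_distrib[of "\<lambda>c. _ * c"] cong: if_cong)
      also have "\<dots> = coeff (coeff p j) i"
        using that by auto
      finally show "coeff (coeff p j) i = coeff (coeff (\<Sum>j\<le>m'. \<Sum>i\<le>m. coeff (coeff p j) i *\<^sub>R (monom (monom 1 i) j)) j) i" ..
    qed
    also have "\<dots> \<in> polys m m'"
      unfolding polys_def mon by (intro span_sum span_scale span_base) auto
    finally show ?thesis .
  qed
  ultimately show ?thesis by blast
qed

definition bidegree :: "nat \<Rightarrow> nat \<Rightarrow> bool \<Rightarrow> nat" where
  "bidegree m m' w = (if w then m' else m)"

lemma univariate_mult_univariate_in_polys:
  assumes "degree a \<le> bidegree m m' w" "degree b \<le> bidegree m m' (\<not> w)"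
  shows "univariate w a * univariate (\<not> w) b \<in> polys m m'"
  using assms unfolding mem_polys_iff coeff_univariate_mult_univariate bidegree_def
  by (auto split: if_splits intro: le_degree order_trans)

lemma linear_univariate_mult: "linear (\<lambda>a. univariate w a * q)"
proof (rule linearI)
  have add: "univariate w (a + b) = univariate w a + univariate w b" for a b
    unfolding univariate_def by (auto intro!: poly_eqI simp: coeff_map_poly)
  show "univariate w (a + b) * q = univariate w a * q + univariate w b * q" for a b
    by (simp add: add distrib_right)
  have "univariate w (c *\<^sub>R a) = smult [:c:] (univariate w a)" for c a
    unfolding univariate_def scaleR_real_poly by (auto intro!: poly_eqI simp: coeff_map_poly mult.commute)
  then show "univariate w (c *\<^sub>R a) * q = c *\<^sub>R (univariate w a * q)" for c a
    by (simp add: scaleR_poly2)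
qed

lemma coeff_coeff_slice: "coeff (slice w i p) j = (if w then coeff (coeff p i) j else coeff (coeff p j) i)"
  by (simp add: slice_def coeff_map_poly)

lemma degree_slice:
  assumes "p \<in> polys m m'"
  shows "degree (slice w i p) \<le> bidegree m m' (\<not> w)"
  using assms by (intro degree_le) (auto simp: mem_polys_iff coeff_coeff_slice bidegree_def dest: leD)

lemma polys_eq_sum_slices:
  assumes "p \<in> polys m m'"
  shows "p = (\<Sum>i\<le>bidegree m m' w. univariate w (monom 1 i) * univariate (\<not> w) (slice w i p))"
proof (intro poly_eqI)
  fix j i
  have "coeff (coeff (\<Sum>i\<le>bidegree m m' w. univariate w (monom 1 i) * univariate (\<not> w) (slice w i p)) j) i
    = (\<Sum>i'\<le>bidegree m m' w. if i' = (if w then j else i) then coeff (coeff p j) i else 0)"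
    unfolding coeff_sum coeff_univariate_mult_univariate coeff_coeff_slice
    by (intro sum.cong) (auto simp: coeff_monom)
  also have "\<dots> = coeff (coeff p j) i"
    using assms by (auto simp: mem_polys_iff bidegree_def)
  finally show "coeff (coeff p j) i = coeff (coeff (\<Sum>i\<le>bidegree m m' w. univariate w (monom 1 i) * univariate (\<not> w) (slice w i p)) j) i" ..
qed

section \<open>Segments and rectangles parallel to the axes\<close>

text \<open>The point with coordinates \<open>x\<close> along the direction \<open>w\<close> and \<open>y\<close> across it; \<open>w = False\<close> is the horizontal
  direction.  Likewise \<open>seg w\<close> is a segment in the direction \<open>w\<close> and \<open>rect w a b c d\<close> has the extent \<open>(a, b)\<close>
  along \<open>w\<close>.  Statements for all \<open>w\<close> treat horizontal and vertical edges in one go.\<close>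
definition pt :: "bool \<Rightarrow> real \<Rightarrow> real \<Rightarrow> real \<times> real" where
  "pt w x y = (if w then (y, x) else (x, y))"

definition co :: "bool \<Rightarrow> real \<times> real \<Rightarrow> real" where
  "co w p = (if w then snd p else fst p)"

definition seg :: "bool \<Rightarrow> real \<Rightarrow> real \<Rightarrow> real \<Rightarrow> (real \<times> real) set" where
  "seg w a b c = (if w then {c} \<times> {a..b} else {a..b} \<times> {c})"

definition rect :: "bool \<Rightarrow> real \<Rightarrow> real \<Rightarrow> real \<Rightarrow> real \<Rightarrow> (real \<times> real) set" where
  "rect w a b c d = (if w then {c<..<d} \<times> {a<..<b} else {a<..<b} \<times> {c<..<d})"

lemma pt_co [simp]: "pt w (co w p) (co (\<not> w) p) = p"
  by (simp add: pt_def co_def)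

lemma co_pt [simp]: "co w (pt w x y) = x" "co (\<not> w) (pt w x y) = y"
  by (simp_all add: pt_def co_def)

lemma pt_eq_iff [simp]: "pt w x y = pt w x' y' \<longleftrightarrow> x = x' \<and> y = y'"
  by (auto simp: pt_def)

lemma pt_Not: "pt (\<not> w) x y = pt w y x"
  by (simp add: pt_def)

lemma mem_seg [simp]: "pt w x y \<in> seg w a b c \<longleftrightarrow> a \<le> x \<and> x \<le> b \<and> y = c"
  by (auto simp: pt_def seg_def)

lemma mem_seg_Not: "pt w x y \<in> seg (\<not> w) a b c \<longleftrightarrow> a \<le> y \<and> y \<le> b \<and> x = c"
  by (auto simp: pt_def seg_def)

lemma mem_rect [simp]: "pt w x y \<in> rect w a b c d \<longleftrightarrow> a < x \<and> x < b \<and> c < y \<and> y < d"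
  by (auto simp: pt_def rect_def)

lemma rect_Not: "rect (\<not> w) a b c d = rect w c d a b"
  by (auto simp: rect_def)

lemma open_rect [simp]: "open (rect w a b c d)"
  by (auto simp: rect_def intro!: open_Times)

lemma closure_rect:
  "a < b \<Longrightarrow> c < d \<Longrightarrow> closure (rect w a b c d) = (if w then {c..d} \<times> {a..b} else {a..b} \<times> {c..d})"
  by (auto simp: rect_def closure_Times)

lemma mem_closure_rect:
  "a < b \<Longrightarrow> c < d \<Longrightarrow> pt w x y \<in> closure (rect w a b c d) \<longleftrightarrow> a \<le> x \<and> x \<le> b \<and> c \<le> y \<and> y \<le> d"
  by (auto simp: closure_rect pt_def)

lemma frontier_rect: "frontier (rect w a b c d) = closure (rect w a b c d) - rect w a b c d"
  by (simp add: frontier_def interior_open)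

lemma edge_ends_seg:
  "a < b \<Longrightarrow> edge_start (seg w a b c) = pt w a c" "a < b \<Longrightarrow> edge_end (seg w a b c) = pt w b c"
  by (auto simp: edge_start_def edge_end_def seg_def pt_def fst_image_times snd_image_times)

lemma edge_ends_rect:
  assumes "a < b" "c < d"
  shows "edge_start (rect w a b c d) = pt w a c" "edge_end (rect w a b c d) = pt w b d"
  using assms by (auto simp: edge_start_def edge_end_def rect_def pt_def fst_image_times snd_image_times)

lemma seg_eq_iff:
  assumes "a < b" "a' < b'"
  shows "seg w a b c = seg w' a' b' c' \<longleftrightarrow> w = w' \<and> a = a' \<and> b = b' \<and> c = c'"
proof
  assume eq: "seg w a b c = seg w' a' b' c'"
  have *: "pt w a c \<in> seg w' a' b' c'" "pt w b c \<in> seg w' a' b' c'"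
    using assms unfolding eq[symmetric] by auto
  have w: "w' = w"
  proof (rule ccontr)
    assume "w' \<noteq> w" then have "w' = (\<not> w)" by blast
    then show False using * assms by (simp add: mem_seg_Not)
  qed
  have "pt w a' c' \<in> seg w a b c" "pt w b' c' \<in> seg w a b c" using eq w assms by auto
  then show "w = w' \<and> a = a' \<and> b = b' \<and> c = c'" using * w by auto
qed simp

lemma horizontal_iff: "horizontal \<tau> \<longleftrightarrow> (\<exists>a b c. a < b \<and> \<tau> = seg False a b c)"
  by (simp add: horizontal_def seg_def)

lemma vertical_iff: "vertical \<tau> \<longleftrightarrow> (\<exists>a b c. a < b \<and> \<tau> = seg True a b c)"
  unfolding vertical_def seg_def by auto

lemma horizontal_seg:
  assumes "a < b" shows "horizontal (seg w a b c) \<longleftrightarrow> \<not> w"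
proof
  assume "horizontal (seg w a b c)"
  then show "\<not> w" unfolding horizontal_iff using assms by (auto simp: seg_eq_iff)
next
  assume "\<not> w"
  then have "a < b \<and> seg w a b c = seg False a b c" using assms by simp
  then show "horizontal (seg w a b c)" unfolding horizontal_iff by blast
qed

lemma vertical_seg:
  assumes "a < b" shows "vertical (seg w a b c) \<longleftrightarrow> w"
proof
  assume "vertical (seg w a b c)"
  then show "w" unfolding vertical_iff using assms by (auto simp: seg_eq_iff)
next
  assume "w"
  then have "a < b \<and> seg w a b c = seg True a b c" using assms by simp
  then show "vertical (seg w a b c)" unfolding vertical_iff by blast
qed

lemma open_contains_box:
  assumes "open W" "pt w x y \<in> W"
  obtains e where "e > 0" "\<And>x' y'. \<bar>x' - x\<bar> < e \<Longrightarrow> \<bar>y' - y\<bar> < e \<Longrightarrow> pt w x' y' \<in> W"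
proof -
  obtain e where e: "e > 0" "ball (pt w x y) e \<subseteq> W" using assms open_contains_ball by blast
  show ?thesis
  proof (rule that[of "e / 2"])
    fix x' y' assume "\<bar>x' - x\<bar> < e / 2" "\<bar>y' - y\<bar> < e / 2"
    moreover have "dist (pt w x y) (pt w x' y') \<le> \<bar>x' - x\<bar> + \<bar>y' - y\<bar>"
      unfolding pt_def using sqrt_sum_squares_le_sum_abs[of "x' - x" "y' - y"]
      by (auto simp: dist_prod_def dist_real_def power2_commute add.commute)
    ultimately show "pt w x' y' \<in> W" using e by (intro subsetD[OF e(2)]) simp
  qed (use e in auto)
qed

lemma finite_real_isolated:
  fixes y :: real
  assumes "finite N"
  obtains e where "e > 0" "\<And>z. z \<in> N \<Longrightarrow> \<bar>z - y\<bar> \<le> e \<Longrightarrow> z = y"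
proof -
  obtain d where d: "d > 0" "\<forall>z\<in>N. z \<noteq> y \<longrightarrow> d \<le> dist y z" using finite_set_avoid[OF assms] by blast
  show ?thesis using d by (intro that[of "d/2"]) (auto simp: dist_real_def abs_minus_commute)
qed

lemma real_avoid_finite:
  fixes a b :: real
  assumes "finite N" "a < b" obtains x where "a < x" "x < b" "x \<notin> N"
proof -
  have "infinite ({a<..<b} - N)" using assms by (simp add: Diff_infinite_finite)
  then obtain x where "x \<in> {a<..<b} - N" by (metis finite.emptyI ex_in_conv)
  then show ?thesis using that by auto
qed

text \<open>Finitely many exceptional values: a line on which one coordinate avoids them meets the mesh only
  in interior points of faces and in relative interiors of transversal edges.\<close>
definition grid :: "tmesh \<Rightarrow> real set" where
  "grid T = (\<Union>S\<in>faces T \<union> edges T. fst ` endpoints S \<union> snd ` endpoints S)"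

lemma grid_pt: "pt w x y \<in> endpoints S \<Longrightarrow> S \<in> faces T \<union> edges T \<Longrightarrow> x \<in> grid T \<and> y \<in> grid T"
proof
  assume *: "pt w x y \<in> endpoints S" "S \<in> faces T \<union> edges T"
  have "x \<in> fst ` endpoints S \<union> snd ` endpoints S" "y \<in> fst ` endpoints S \<union> snd ` endpoints S"
    using imageI[OF *(1), of fst] imageI[OF *(1), of snd] by (auto simp: pt_def split: if_splits)
  with *(2) show "x \<in> grid T" "y \<in> grid T" unfolding grid_def by blast+
qed

section \<open>Axis-parallel paths outside a set\<close>

text \<open>In the complex plane, a simply connected, locally path connected set is Borsukian (every continuous
  map from it to the circle has a logarithm), and compact Borsukian sets are those that do not separate the
  plane.  A linear identification carries this over.\<close>
lemma connected_Compl_simply_connected_compact: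
  fixes S :: "(real \<times> real) set"
  assumes "compact S" "simply_connected S" "locally path_connected S"
  shows "connected (- S)"
proof -
  define f where "f = (\<lambda>p::real \<times> real. Complex (fst p) (snd p))"
  have lf: "linear f" by (rule linearI) (auto simp: f_def complex_eq_iff)
  have inj: "inj f" by (auto simp: f_def inj_def complex_eq_iff prod_eq_iff)
  have sur: "surj f" by (metis f_def fst_conv snd_conv complex.exhaust surj_def)
  have homeo: "S homeomorphic f ` S"
    using linear_homeomorphic_image[OF lf inj] by blast
  have comp: "compact (f ` S)" using assms(1) homeo homeomorphic_compactness by blast
  have "simply_connected (f ` S)" using homeomorphic_simply_connected homeo assms(2) by blast
  moreover have "locally path_connected (f ` S)"
    using homeomorphic_locally[OF homeo, of path_connected path_connected] homeomorphic_path_connectedness assms(3)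
    by (meson homeomorphic_def homeomorphic_path_connectedness)
  ultimately have "Borsukian (f ` S)" by (rule simply_connected_imp_Borsukian)
  then have "connected (- (f ` S))" using Borsukian_separation_compact comp by blast
  moreover have "- (f ` S) = f ` (- S)" using inj sur by (simp add: bij_image_Compl_eq bij_def)
  ultimately have "connected (f ` (- S))" by simp
  moreover have "- S homeomorphic f ` (- S)" using linear_homeomorphic_image[OF lf inj] by blast
  ultimately show ?thesis using homeomorphic_connectedness by blast
qed

text \<open>As a function of \<open>z\<close>, the indicator of the open quadrant up and to the right of \<open>p\<close>.  The difference of these
  functions for the two ends of a horizontal segment tells whether the segment lies below \<open>z\<close>, and for
  a vertical segment whether it lies to the left of \<open>z\<close>.\<close>
definition quadrant :: "real \<times> real \<Rightarrow> real \<times> real \<Rightarrow> real" where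
  "quadrant p z = of_bool (fst p < fst z) * of_bool (snd p < snd z)"

lemma quadrant_pt: "quadrant (pt w a c) (pt w x y) = of_bool (a < x) * of_bool (c < y)"
  by (simp add: quadrant_def pt_def)

text \<open>This holds if \<open>p\<close> and \<open>q\<close> are joined by an axis-parallel path outside \<open>W\<close>: let \<open>h False z\<close> count the
  horizontal pieces of the path below \<open>z\<close>, and \<open>h True z\<close> the vertical ones to the left of \<open>z\<close>.  The
  definition retains only what is used of the path, namely that the counts do not
  change along transversal segments inside \<open>W\<close>.  In this form it is visibly an equivalence relation.\<close>
definition crossing_equiv :: "(real \<times> real) set \<Rightarrow> real \<times> real \<Rightarrow> real \<times> real \<Rightarrow> bool" where
  "crossing_equiv W p q \<longleftrightarrow> (\<exists>h. (\<forall>z. h False z + h True z = quadrant p z - quadrant q z) \<and>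
     (\<forall>w x y1 y2. y1 \<le> y2 \<longrightarrow> (\<forall>y. y1 \<le> y \<and> y \<le> y2 \<longrightarrow> pt w x y \<in> W) \<longrightarrow>
        h w (pt w x y1) = h w (pt w x y2)))"

lemma crossing_equiv_sym:
  assumes "crossing_equiv W p q" shows "crossing_equiv W q p"
proof -
  obtain h where "\<forall>z. h False z + h True z = quadrant p z - quadrant q z"
    "\<forall>w x y1 y2. y1 \<le> y2 \<longrightarrow> (\<forall>y. y1 \<le> y \<and> y \<le> y2 \<longrightarrow> pt w x y \<in> W) \<longrightarrow>
        h w (pt w x y1) = h w (pt w x y2)"
    using assms unfolding crossing_equiv_def by blast
  then show ?thesis unfolding crossing_equiv_def
    by (intro exI[of _ "\<lambda>w z. - h w z"]) (auto simp: algebra_simps)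
qed

lemma crossing_equiv_trans:
  assumes "crossing_equiv W p q" "crossing_equiv W q r" shows "crossing_equiv W p r"
proof -
  obtain h where h: "\<forall>z. h False z + h True z = quadrant p z - quadrant q z"
    "\<forall>w x y1 y2. y1 \<le> y2 \<longrightarrow> (\<forall>y. y1 \<le> y \<and> y \<le> y2 \<longrightarrow> pt w x y \<in> W) \<longrightarrow>
        h w (pt w x y1) = h w (pt w x y2)"
    using assms(1) unfolding crossing_equiv_def by blast
  obtain k where k: "\<forall>z. k False z + k True z = quadrant q z - quadrant r z"
    "\<forall>w x y1 y2. y1 \<le> y2 \<longrightarrow> (\<forall>y. y1 \<le> y \<and> y \<le> y2 \<longrightarrow> pt w x y \<in> W) \<longrightarrow>
        k w (pt w x y1) = k w (pt w x y2)"
    using assms(2) unfolding crossing_equiv_def by blast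
  show ?thesis unfolding crossing_equiv_def
  proof (intro exI[of _ "\<lambda>w z. h w z + k w z"] conjI allI impI)
    fix z show "h False z + k False z + (h True z + k True z) = quadrant p z - quadrant r z"
      using h(1)[rule_format, of z] k(1)[rule_format, of z] by simp
  next
    fix w x and y1 y2 :: real
    assume "y1 \<le> y2" "\<forall>y. y1 \<le> y \<and> y \<le> y2 \<longrightarrow> pt w x y \<in> W"
    then have "h w (pt w x y1) = h w (pt w x y2)" "k w (pt w x y1) = k w (pt w x y2)"
      using h(2) k(2) by (blast, blast)
    then show "h w (pt w x y1) + k w (pt w x y1) = h w (pt w x y2) + k w (pt w x y2)" by simp
  qed
qed

text \<open>The count changes between \<open>pt w x y1\<close> and \<open>pt w x y2\<close> only if the segment between them crosses the
  given one.\<close>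
lemma crossing_equiv_segment_le:
  assumes "a \<le> b" and out: "\<And>x. a \<le> x \<Longrightarrow> x \<le> b \<Longrightarrow> pt w x c \<notin> W"
  shows "crossing_equiv W (pt w a c) (pt w b c)"
  unfolding crossing_equiv_def
proof (intro exI[of _ "\<lambda>w' z. if w' = w then quadrant (pt w a c) z - quadrant (pt w b c) z else 0"] conjI allI impI)
  fix w' x and y1 y2 :: real
  assume y: "y1 \<le> y2" "\<forall>y. y1 \<le> y \<and> y \<le> y2 \<longrightarrow> pt w' x y \<in> W"
  show "(if w' = w then quadrant (pt w a c) (pt w' x y1) - quadrant (pt w b c) (pt w' x y1) else 0) =
        (if w' = w then quadrant (pt w a c) (pt w' x y2) - quadrant (pt w b c) (pt w' x y2) else 0)"
  proof (cases "w' = w")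
    case True
    have "\<not> (a < x \<and> x \<le> b \<and> y1 \<le> c \<and> c < y2)"
      using out[of x] y True by auto
    then show ?thesis using True assms(1) y(1) by (auto simp: quadrant_pt of_bool_def)
  qed simp
qed auto

lemma crossing_equiv_segment:
  assumes out: "\<And>x. min a b \<le> x \<Longrightarrow> x \<le> max a b \<Longrightarrow> pt w x c \<notin> W"
  shows "crossing_equiv W (pt w a c) (pt w b c)"
proof (cases "a \<le> b")
  case True then show ?thesis using crossing_equiv_segment_le[of a b] out by simp
next
  case False then show ?thesis using crossing_equiv_segment_le[of b a] out by (simp add: crossing_equiv_sym)
qed

lemma crossing_equiv_box:
  assumes "\<And>x y. min a a' \<le> x \<Longrightarrow> x \<le> max a a' \<Longrightarrow> min c c' \<le> y \<Longrightarrow> y \<le> max c c' \<Longrightarrow> pt w x y \<notin> W"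
  shows "crossing_equiv W (pt w a c) (pt w a' c')"
proof (rule crossing_equiv_trans)
  show "crossing_equiv W (pt w a c) (pt w a' c)" using assms by (intro crossing_equiv_segment) auto
  have "crossing_equiv W (pt (\<not> w) c a') (pt (\<not> w) c' a')"
    using assms by (intro crossing_equiv_segment) (auto simp: pt_Not)
  then show "crossing_equiv W (pt w a' c) (pt w a' c')" by (simp add: pt_Not)
qed

text \<open>Within a box around a point, an L-shaped path consisting of two segments suffices.\<close>
lemma crossing_equiv_connected:
  assumes "open U" "connected U" "p \<in> U" "q \<in> U" "U \<inter> W = {}"
  shows "crossing_equiv W p q"
proof (rule connected_equivalence_relation[OF assms(2-4)])
  show "\<And>x y. crossing_equiv W x y \<Longrightarrow> x \<in> U \<Longrightarrow> y \<in> U \<Longrightarrow> crossing_equiv W y x"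
    by (rule crossing_equiv_sym)
  show "\<And>x y z. crossing_equiv W x y \<Longrightarrow> crossing_equiv W y z \<Longrightarrow> x \<in> U \<Longrightarrow> y \<in> U \<Longrightarrow> z \<in> U \<Longrightarrow> crossing_equiv W x z"
    by (rule crossing_equiv_trans)
  fix p assume p: "p \<in> U"
  obtain x y where xy: "p = pt False x y" by (metis pt_co)
  obtain e where e: "e > 0" "\<And>x' y'. \<bar>x' - x\<bar> < e \<Longrightarrow> \<bar>y' - y\<bar> < e \<Longrightarrow> pt False x' y' \<in> U"
    using open_contains_box assms(1) p xy by metis
  let ?B = "rect False (x - e) (x + e) (y - e) (y + e)"
  show "\<exists>B. openin (top_of_set U) B \<and> p \<in> B \<and> (\<forall>q\<in>B. crossing_equiv W p q)"
  proof (intro exI[of _ ?B] conjI ballI)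
    have "?B \<subseteq> U"
    proof
      fix q assume "q \<in> ?B"
      then obtain x' y' where "q = pt False x' y'" "x - e < x'" "x' < x + e" "y - e < y'" "y' < y + e"
        by (metis pt_co mem_rect)
      then show "q \<in> U" using e(2)[of x' y'] by auto
    qed
    then show "openin (top_of_set U) ?B" using assms(1) by (simp add: openin_open_eq)
    show "p \<in> ?B" using xy e by simp
    fix q assume "q \<in> ?B"
    then obtain x' y' where q: "q = pt False x' y'" "x - e < x'" "x' < x + e" "y - e < y'" "y' < y + e"
      by (metis pt_co mem_rect)
    show "crossing_equiv W p q"
      unfolding q(1) xy
    proof (rule crossing_equiv_box)
      fix u v assume "min x x' \<le> u" "u \<le> max x x'" "min y y' \<le> v" "v \<le> max y y'"
      then have "\<bar>u - x\<bar> < e" "\<bar>v - y\<bar> < e" using q by auto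
      then show "pt False u v \<notin> W" using e(2) assms(5) by blast
    qed
  qed
qed

section \<open>Edge ideals and chains\<close>

lemma eval2_linear: "eval2 (\<alpha> *\<^sub>R var_s + \<beta> *\<^sub>R var_t + \<epsilon> *\<^sub>R 1) (x, y) = \<alpha> * x + \<beta> * y + \<epsilon>"
  by (simp add: eval2_def var_s_def var_t_def scaleR_poly2 one_pCons)

lemma univariate_linear:
  "univariate False [:- c, 1:] = 1 *\<^sub>R var_s + 0 *\<^sub>R var_t + (- c) *\<^sub>R 1"
  "univariate True [:- c, 1:] = 0 *\<^sub>R var_s + 1 *\<^sub>R var_t + (- c) *\<^sub>R 1"
  by (simp_all add: univariate_def var_s_def var_t_def scaleR_poly2 one_pCons map_poly_pCons)

text \<open>A linear polynomial that vanishes at both ends of a segment parallel to an axis does not involve the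
  coordinate along the segment.\<close>
lemma edge_poly_seg:
  assumes "a < b"
  obtains \<beta> where "\<beta> \<noteq> 0" "edge_poly (seg w a b c) = [:[:\<beta>:]:] * univariate (\<not> w) [:- c, 1:]"
proof -
  let ?P = "\<lambda>l. l \<noteq> 0 \<and> (\<exists>a b c. l = a *\<^sub>R var_s + b *\<^sub>R var_t + c *\<^sub>R 1) \<and> (\<forall>x\<in>seg w a b c. eval2 l x = 0)"
  have "?P (univariate (\<not> w) [:- c, 1:])"
  proof (intro conjI ballI)
    show "univariate (\<not> w) [:- c, 1:] \<noteq> 0" by (simp add: univariate_def map_poly_pCons)
    show "\<exists>a b c'. univariate (\<not> w) [:- c, 1:] = a *\<^sub>R var_s + b *\<^sub>R var_t + c' *\<^sub>R 1"
      using univariate_linear[of c] by (cases w) (simp only: simp_thms, blast)+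
    fix x assume "x \<in> seg w a b c"
    then show "eval2 (univariate (\<not> w) [:- c, 1:]) x = 0"
      by (cases w) (auto simp: seg_def univariate_linear eval2_linear simp del: scaleR_zero_left scaleR_one scaleR_minus_left)
  qed
  then have P: "?P (edge_poly (seg w a b c))" unfolding edge_poly_def by (rule someI)
  then obtain \<alpha> \<beta> \<epsilon> where l: "edge_poly (seg w a b c) = \<alpha> *\<^sub>R var_s + \<beta> *\<^sub>R var_t + \<epsilon> *\<^sub>R 1" by blast
  have "pt w a c \<in> seg w a b c" "pt w b c \<in> seg w a b c" using assms by auto
  then have z: "eval2 (edge_poly (seg w a b c)) (pt w a c) = 0" "eval2 (edge_poly (seg w a b c)) (pt w b c) = 0"
    using P by blast+
  show ?thesis
  proof (cases w)
    case True
    then have "\<alpha> * c + \<beta> * a + \<epsilon> = 0" "\<alpha> * c + \<beta> * b + \<epsilon> = 0" using z unfolding l by (auto simp: pt_def eval2_linear)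
    moreover have "\<beta> * (b - a) = (\<alpha> * c + \<beta> * b + \<epsilon>) - (\<alpha> * c + \<beta> * a + \<epsilon>)" by (simp add: algebra_simps)
    ultimately have "\<beta> * (b - a) = 0" by simp
    then have "\<beta> = 0" "\<epsilon> = - \<alpha> * c" using assms \<open>\<alpha> * c + \<beta> * a + \<epsilon> = 0\<close> by auto
    then have "edge_poly (seg w a b c) = [:[:\<alpha>:]:] * univariate (\<not> w) [:- c, 1:]"
      unfolding l using True by (simp add: univariate_def var_s_def scaleR_poly2 one_pCons)
    moreover have "\<alpha> \<noteq> 0" using calculation P by auto
    ultimately show ?thesis using that by blast
  next
    case False
    then have "\<alpha> * a + \<beta> * c + \<epsilon> = 0" "\<alpha> * b + \<beta> * c + \<epsilon> = 0" using z unfolding l by (auto simp: pt_def eval2_linear)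
    moreover have "\<alpha> * (b - a) = (\<alpha> * b + \<beta> * c + \<epsilon>) - (\<alpha> * a + \<beta> * c + \<epsilon>)" by (simp add: algebra_simps)
    ultimately have "\<alpha> * (b - a) = 0" by simp
    then have "\<alpha> = 0" "\<epsilon> = - \<beta> * c" using assms \<open>\<alpha> * a + \<beta> * c + \<epsilon> = 0\<close> by auto
    then have "edge_poly (seg w a b c) = [:[:\<beta>:]:] * univariate (\<not> w) [:- c, 1:]"
      unfolding l using False by (simp add: univariate_def var_t_def scaleR_poly2 one_pCons map_poly_pCons)
    moreover have "\<beta> \<noteq> 0" using calculation P by auto
    ultimately show ?thesis using that by blast
  qed
qed

lemma edge_poly_power_dvd_iff:
  assumes "a < b"
  shows "edge_poly (seg w a b c) ^ k dvd p \<longleftrightarrow> univariate (\<not> w) ([:- c, 1:] ^ k) dvd p"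
proof -
  obtain \<beta> where \<beta>: "\<beta> \<noteq> 0" "edge_poly (seg w a b c) = [:[:\<beta>:]:] * univariate (\<not> w) [:- c, 1:]"
    using edge_poly_seg assms by metis
  have "is_unit ([:[:\<beta>:]:] ^ k :: poly2)"
    using \<beta>(1) by (simp add: const_poly_power is_unit_const_poly_iff dvd_field_iff)
  then show ?thesis unfolding \<beta>(2) power_mult_distrib univariate_power by (simp add: mult_unit_dvd_iff')
qed

lemma edge_ideal_seg:
  assumes "a < b"
  shows "edge_ideal m m' r (seg w a b c) =
    {p \<in> polys m m'. univariate (\<not> w) ([:- c, 1:] ^ nat (r (seg w a b c) + 1)) dvd p}"
  unfolding edge_ideal_def edge_poly_power_dvd_iff[OF assms] ..

lemma subspace_polys: "subspace (polys m m')"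
  unfolding polys_def by (rule subspace_span)

lemma subspace_edge_ideal: "subspace (edge_ideal m m' r \<tau>)"
proof -
  have "q dvd c *\<^sub>R x" if "q dvd x" for q x :: poly2 and c
    unfolding scaleR_poly2 using that by (rule dvd_smult)
  then show ?thesis
    unfolding edge_ideal_def using subspace_polys[of m m']
    by (intro subspaceI) (auto simp: subspace_0 subspace_add subspace_scale)
qed

lemma edge_ideal_antimono:
  "s \<tau> \<le> r \<tau> \<Longrightarrow> edge_ideal m m' r \<tau> \<subseteq> edge_ideal m m' s \<tau>"
  unfolding edge_ideal_def by (auto intro: power_le_dvd)

lemma vertex_ideal_subset_polys: "vertex_ideal T m m' r \<gamma> \<subseteq> polys m m'"
  unfolding vertex_ideal_def by (intro span_minimal subspace_polys) (auto simp: edge_ideal_def)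

lemma lookup_scaleR [simp]: "Poly_Mapping.lookup (a *\<^sub>R c) k = a *\<^sub>R Poly_Mapping.lookup c k"
proof -
  have "finite {k. a *\<^sub>R Poly_Mapping.lookup c k \<noteq> 0}"
    by (rule finite_subset[OF _ finite_lookup[of c]]) auto
  then show ?thesis by (simp add: scaleR_poly_mapping_def Abs_poly_mapping_inverse)
qed

lemma mem_chains_iff:
  "c \<in> chains K V \<longleftrightarrow> (\<forall>k. if k \<in> K then Poly_Mapping.lookup c k \<in> V k else Poly_Mapping.lookup c k = 0)"
  unfolding chains_def by (auto simp: in_keys_iff subset_iff)

lemma subspace_chains: "(\<And>k. k \<in> K \<Longrightarrow> subspace (V k)) \<Longrightarrow> subspace (chains K V)"
  by (rule subspaceI) (auto simp: mem_chains_iff subspace_0 subspace_add subspace_scale lookup_add split: if_splits)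

lemma chains_mono: "(\<And>k. k \<in> K \<Longrightarrow> V k \<subseteq> W k) \<Longrightarrow> chains K V \<subseteq> chains K W"
  by (auto simp: chains_def)

lemma single_in_chains: "k \<in> K \<Longrightarrow> p \<in> V k \<Longrightarrow> (\<And>k. k \<in> K \<Longrightarrow> subspace (V k)) \<Longrightarrow> Poly_Mapping.single k p \<in> chains K V"
  by (auto simp: mem_chains_iff lookup_single when_def subspace_0)

lemma chain_eq_sum_single:
  assumes "finite K" "c \<in> chains K V"
  shows "c = (\<Sum>k\<in>K. Poly_Mapping.single k (Poly_Mapping.lookup c k))"
proof (rule poly_mapping_eqI)
  fix k
  show "Poly_Mapping.lookup c k = Poly_Mapping.lookup (\<Sum>k\<in>K. Poly_Mapping.single k (Poly_Mapping.lookup c k)) k"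
    using assms by (cases "k \<in> K") (auto simp: lookup_sum lookup_single when_def mem_chains_iff)
qed

lemma linear_single: "linear (Poly_Mapping.single k :: 'v::real_vector \<Rightarrow> _)"
  by (rule linearI) (auto intro!: poly_mapping_eqI simp: lookup_add lookup_single when_def)

lemma fin_subspace_chains_polys:
  assumes "finite K" shows "fin_subspace (chains K (\<lambda>_. polys m m'))"
proof -
  define X where "X = {var_s ^ i * var_t ^ j | i j. i \<le> m \<and> j \<le> m'}"
  have "X = (\<lambda>(i, j). var_s ^ i * var_t ^ j) ` ({..m} \<times> {..m'})" by (auto simp: X_def)
  then have finX: "finite X" by simp
  let ?S = "\<Union>k\<in>K. Poly_Mapping.single k ` X"
  have "c \<in> span ?S" if "c \<in> chains K (\<lambda>_. polys m m')" for c
  proof -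
    have "(\<Sum>k\<in>K. Poly_Mapping.single k (Poly_Mapping.lookup c k)) \<in> span ?S"
    proof (rule span_sum)
      fix k assume k: "k \<in> K"
      then have "Poly_Mapping.lookup c k \<in> span X" using that by (auto simp: mem_chains_iff polys_def X_def)
      then have "Poly_Mapping.single k (Poly_Mapping.lookup c k) \<in> span (Poly_Mapping.single k ` X)"
        using linear_span_image[OF linear_single[of k], of X] by blast
      also have "\<dots> \<subseteq> span ?S" using k by (intro span_mono) auto
      finally show "Poly_Mapping.single k (Poly_Mapping.lookup c k) \<in> span ?S" .
    qed
    then show ?thesis using chain_eq_sum_single[OF assms that] by simp
  qed
  then show ?thesis
    unfolding fin_subspace_def using finX assms by (intro conjI subspace_chains subspace_polys exI[of _ ?S]) auto
qed

section \<open>Jumps across an edge\<close>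

definition along :: "bool \<Rightarrow> (real \<times> real) set \<Rightarrow> bool" where
  "along w \<tau> \<longleftrightarrow> (if w then vertical \<tau> else horizontal \<tau>)"

lemma along_seg: "a < b \<Longrightarrow> along w (seg w' a b c) \<longleftrightarrow> w' = w"
  by (auto simp: along_def horizontal_seg vertical_seg)

lemma alongE:
  assumes "along w \<tau>" obtains a b c where "a < b" "\<tau> = seg w a b c"
  using assms that unfolding along_def by (cases w) (auto simp: horizontal_iff vertical_iff)

text \<open>The interior edge \<open>\<tau>\<close> in direction \<open>w\<close> lies in the boundary of exactly two faces; this is the one with smaller
  coordinates across \<open>w\<close>, hence the left one if \<open>\<tau>\<close> is vertical.\<close>
definition lower_face :: "tmesh \<Rightarrow> (real \<times> real) set \<Rightarrow> (real \<times> real) set" where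
  "lower_face T \<tau> = (SOME \<sigma>. \<sigma> \<in> faces T \<and> \<tau> \<subseteq> closure \<sigma> \<and>
     (\<exists>w a b c a' b' c'. a < b \<and> \<tau> = seg w a b c \<and> c' < c \<and> \<sigma> = rect w a' b' c' c))"

definition upper_face :: "tmesh \<Rightarrow> (real \<times> real) set \<Rightarrow> (real \<times> real) set" where
  "upper_face T \<tau> = (SOME \<sigma>. \<sigma> \<in> faces T \<and> \<tau> \<subseteq> closure \<sigma> \<and>
     (\<exists>w a b c a' b' d'. a < b \<and> \<tau> = seg w a b c \<and> c < d' \<and> \<sigma> = rect w a' b' c d'))"

definition ascent :: "tmesh \<Rightarrow> ((real \<times> real) set \<Rightarrow> 'v::real_vector) \<Rightarrow> (real \<times> real) set \<Rightarrow> 'v" where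
  "ascent T g \<tau> = g (upper_face T \<tau>) - g (lower_face T \<tau>)"

text \<open>The sign orients the jump consistently: it is always the value to the left of the directed edge minus the value
  to its right.\<close>
definition jump :: "tmesh \<Rightarrow> ((real \<times> real) set \<Rightarrow> 'v::real_vector) \<Rightarrow> (real \<times> real) set \<Rightarrow> 'v" where
  "jump T g \<tau> = (if vertical \<tau> then - ascent T g \<tau> else ascent T g \<tau>)"

section \<open>Faces and edges of a T-mesh\<close>

locale mesh =
  fixes T :: tmesh
  assumes mesh: "is_tmesh T"
begin

abbreviation "\<Omega> \<equiv> mesh_domain T"

lemma finite_faces: "finite (faces T)" and finite_edges: "finite (edges T)"
  using mesh by (auto simp: is_tmesh_def)

lemma finite_grid: "finite (grid T)"
  unfolding grid_def using finite_faces finite_edges by (auto simp: endpoints_def)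

lemma face_rectE:
  assumes "\<sigma> \<in> faces T"
  obtains a b c d where "a < b" "c < d" "\<sigma> = rect w a b c d"
proof -
  obtain a b c d where "a < b" "c < d" "\<sigma> = {a<..<b} \<times> {c<..<d}"
    using mesh assms unfolding is_tmesh_def by meson
  then show ?thesis using that by (cases w) (auto simp: rect_def)
qed

lemma edge_segE:
  assumes "\<tau> \<in> edges T"
  obtains w a b c where "a < b" "\<tau> = seg w a b c"
proof -
  have "horizontal \<tau> \<or> vertical \<tau>" using mesh assms unfolding is_tmesh_def by meson
  then show ?thesis using that by (auto simp: horizontal_iff vertical_iff)
qed

lemma edge_in_frontier: "\<tau> \<in> edges T \<Longrightarrow> \<exists>\<sigma>\<in>faces T. \<tau> \<subseteq> frontier \<sigma>"
  using mesh unfolding is_tmesh_def by meson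

lemma frontier_edges: "\<sigma> \<in> faces T \<Longrightarrow> \<exists>E\<subseteq>edges T. frontier \<sigma> = \<Union>E"
  using mesh unfolding is_tmesh_def by meson

lemma frontier_point_edge:
  assumes "\<sigma> \<in> faces T" "p \<in> frontier \<sigma>"
  obtains \<tau> where "\<tau> \<in> edges T" "p \<in> \<tau>" "\<tau> \<subseteq> frontier \<sigma>"
  using frontier_edges[OF assms(1)] assms(2) by blast

lemma edges_meet:
  assumes "\<tau> \<in> edges T" "\<tau>' \<in> edges T" "\<tau> \<noteq> \<tau>'" "p \<in> \<tau>" "p \<in> \<tau>'"
  shows "p \<in> vertices T" "\<And>q. q \<in> \<tau> \<Longrightarrow> q \<in> \<tau>' \<Longrightarrow> q = p"
proof -
  have "\<forall>\<tau>\<in>edges T. \<forall>\<tau>'\<in>edges T. \<tau> \<noteq> \<tau>' \<longrightarrow>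
      \<tau> \<inter> \<tau>' = {} \<or> (\<exists>\<gamma>\<in>vertices T. \<tau> \<inter> \<tau>' = {\<gamma>})"
    using mesh unfolding is_tmesh_def by (elim conjE) assumption
  then have "\<tau> \<inter> \<tau>' = {} \<or> (\<exists>\<gamma>\<in>vertices T. \<tau> \<inter> \<tau>' = {\<gamma>})"
    using assms(1-3) by simp
  moreover have "p \<in> \<tau> \<inter> \<tau>'" using assms by simp
  ultimately obtain \<gamma> where \<gamma>: "\<gamma> \<in> vertices T" "\<tau> \<inter> \<tau>' = {\<gamma>}" by (metis empty_iff)
  with \<open>p \<in> \<tau> \<inter> \<tau>'\<close> have "p = \<gamma>" by simp
  then show "p \<in> vertices T" "\<And>q. q \<in> \<tau> \<Longrightarrow> q \<in> \<tau>' \<Longrightarrow> q = p" using \<gamma> by auto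
qed

lemma vertex_edge:
  assumes "\<gamma> \<in> vertices T"
  obtains a b c where "a < b" "seg w a b c \<in> edges T" "\<gamma> \<in> seg w a b c"
proof -
  have "(\<exists>\<tau>\<in>edges T. horizontal \<tau> \<and> \<gamma> \<in> \<tau>) \<and> (\<exists>\<tau>\<in>edges T. vertical \<tau> \<and> \<gamma> \<in> \<tau>)"
    using mesh assms unfolding is_tmesh_def by meson
  then show ?thesis using that by (cases w) (auto simp: horizontal_iff vertical_iff)
qed

lemma face_disjoint_closure:
  assumes "\<sigma> \<in> faces T" "\<sigma>' \<in> faces T" "\<sigma> \<noteq> \<sigma>'"
  shows "\<sigma> \<inter> closure \<sigma>' = {}"
proof -
  have eq: "closure \<sigma> \<inter> closure \<sigma>' = frontier \<sigma> \<inter> frontier \<sigma>'"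
    using mesh assms unfolding is_tmesh_def by meson
  obtain a b c d where "\<sigma> = rect False a b c d" using face_rectE[OF assms(1)] by metis
  then have "\<sigma> \<inter> frontier \<sigma> = {}" by (auto simp: frontier_rect)
  then show ?thesis using eq closure_subset[of \<sigma>] by blast
qed

lemma face_eqI:
  "\<sigma> \<in> faces T \<Longrightarrow> \<sigma>' \<in> faces T \<Longrightarrow> p \<in> \<sigma> \<Longrightarrow> p \<in> \<sigma>' \<Longrightarrow> \<sigma> = \<sigma>'"
  using face_disjoint_closure closure_subset by blast

lemma edge_disjoint_face:
  assumes "\<tau> \<in> edges T" "\<sigma> \<in> faces T" shows "\<tau> \<inter> \<sigma> = {}"
proof -
  obtain \<sigma>' where \<sigma>': "\<sigma>' \<in> faces T" "\<tau> \<subseteq> frontier \<sigma>'" using edge_in_frontier assms by blast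
  obtain a b c d where "\<sigma>' = rect False a b c d" using face_rectE[OF \<sigma>'(1)] by metis
  then have "\<tau> \<subseteq> closure \<sigma>' - \<sigma>'" using \<sigma>' by (simp add: frontier_rect)
  then show ?thesis using face_disjoint_closure[of \<sigma> \<sigma>'] \<sigma>' assms by (cases "\<sigma> = \<sigma>'") auto
qed

lemma face_subset_domain: "\<sigma> \<in> faces T \<Longrightarrow> closure \<sigma> \<subseteq> \<Omega>"
  by (auto simp: mesh_domain_def)

lemma face_in_interior: "\<sigma> \<in> faces T \<Longrightarrow> \<sigma> \<subseteq> interior \<Omega>"
  by (rule interior_maximal, meson closure_subset face_subset_domain order_trans)
     (metis face_rectE open_rect)

lemma grid_face: "rect w a b c d \<in> faces T \<Longrightarrow> a < b \<Longrightarrow> c < d \<Longrightarrow> {a,b,c,d} \<subseteq> grid T"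
  using grid_pt[of w a c "rect w a b c d" T] grid_pt[of w b d "rect w a b c d" T]
  by (auto simp: endpoints_def edge_ends_rect)

lemma grid_edge: "seg w a b c \<in> edges T \<Longrightarrow> a < b \<Longrightarrow> {a,b,c} \<subseteq> grid T"
  using grid_pt[of w a c "seg w a b c" T] grid_pt[of w b c "seg w a b c" T]
  by (auto simp: endpoints_def edge_ends_seg)

lemma grid_vertex: "pt w x y \<in> vertices T \<Longrightarrow> x \<in> grid T \<and> y \<in> grid T"
  unfolding vertices_def using grid_pt by blast

text \<open>An edge in the other direction has the fixed coordinate \<open>x\<close>, which would lie in the grid.\<close>
lemma edge_through_generic:
  assumes "\<tau> \<in> edges T" "pt w x y \<in> \<tau>" "x \<notin> grid T"
  obtains a b where "a < x" "x < b" "\<tau> = seg w a b y"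
proof -
  obtain w' a b c where \<tau>: "a < b" "\<tau> = seg w' a b c" using edge_segE assms by metis
  show ?thesis
  proof (cases "w' = w")
    case True
    then have "a \<noteq> x" "b \<noteq> x" using \<tau> grid_edge assms by auto
    moreover have "a \<le> x" "x \<le> b" "y = c" using assms(2) \<tau> True by auto
    ultimately show ?thesis using that[of a b] \<tau> True by simp
  next
    case False
    then have "w' = (\<not> w)" by blast
    then have "x = c" using assms \<tau> by (simp add: mem_seg_Not)
    then show ?thesis using \<tau> grid_edge assms by auto
  qed
qed

lemma edge_through_generic_unique:
  assumes "\<tau> \<in> edges T" "\<tau>' \<in> edges T" "pt w x y \<in> \<tau>" "pt w x y \<in> \<tau>'" "x \<notin> grid T"
  shows "\<tau> = \<tau>'"
  using edges_meet(1) grid_vertex assms by metis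

lemma face_at_generic:
  assumes "pt w x y \<in> \<Omega>" "x \<notin> grid T" "y \<notin> grid T"
  obtains \<sigma> where "\<sigma> \<in> faces T" "pt w x y \<in> \<sigma>"
proof -
  obtain \<sigma> where \<sigma>: "\<sigma> \<in> faces T" "pt w x y \<in> closure \<sigma>" using assms by (auto simp: mesh_domain_def)
  obtain a b c d where r: "a < b" "c < d" "\<sigma> = rect w a b c d" using face_rectE[OF \<sigma>(1)] by metis
  have "{a,b,c,d} \<subseteq> grid T" using grid_face \<sigma> r by metis
  then have "pt w x y \<in> \<sigma>" using \<sigma> r assms by (auto simp: mem_closure_rect order_le_less)
  then show ?thesis using that \<sigma> by blast
qed

text \<open>The elementary description of the mesh near a generic point: two faces that face each other across
  the level \<open>y\<close> either coincide, and then the point is interior to a face, or they share an edge through it.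
  All further local structure is derived from this lemma.\<close>
lemma faces_across_level:
  assumes x: "x \<notin> grid T" and y: "y1 < y" "y < y2" and N: "\<forall>z\<in>grid T. y1 \<le> z \<and> z \<le> y2 \<longrightarrow> z = y"
    and \<sigma>: "\<sigma>1 \<in> faces T" "pt w x y1 \<in> \<sigma>1" "\<sigma>2 \<in> faces T" "pt w x y2 \<in> \<sigma>2"
  shows "\<sigma>1 = \<sigma>2 \<and> (\<forall>\<tau>\<in>edges T. pt w x y \<notin> \<tau>) \<or>
    \<sigma>1 \<noteq> \<sigma>2 \<and> (\<exists>a b a1 b1 c1 a2 b2 d2. a < x \<and> x < b \<and> seg w a b y \<in> edges T \<and>
       seg w a b y \<subseteq> closure \<sigma>1 \<and> seg w a b y \<subseteq> closure \<sigma>2 \<and>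
       \<sigma>1 = rect w a1 b1 c1 y \<and> \<sigma>2 = rect w a2 b2 y d2)"
proof -
  obtain a1 b1 c1 d1 where r1: "a1 < b1" "c1 < d1" "\<sigma>1 = rect w a1 b1 c1 d1" using face_rectE \<sigma> by metis
  obtain a2 b2 c2 d2 where r2: "a2 < b2" "c2 < d2" "\<sigma>2 = rect w a2 b2 c2 d2" using face_rectE \<sigma> by metis
  have g: "d1 \<in> grid T" "c2 \<in> grid T" using grid_face[of w a1 b1 c1 d1] grid_face[of w a2 b2 c2 d2] \<sigma> r1 r2 by auto
  show ?thesis
  proof (cases "\<sigma>1 = \<sigma>2")
    case True
    then have "pt w x y2 \<in> rect w a1 b1 c1 d1" using \<sigma> r1 by blast
    then have "pt w x y \<in> \<sigma>1" using \<sigma>(2) y unfolding r1(3) by auto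
    then show ?thesis using edge_disjoint_face \<sigma>(1) True by blast
  next
    case False
    \<comment> \<open>The faces differ, so the first one ends, and the second one begins, at a level between \<open>y1\<close> and
    \<open>y2\<close>; this is a grid value, hence \<open>y\<close>.\<close>
    have "\<not> d1 > y2"
    proof
      assume "d1 > y2"
      then have "pt w x y2 \<in> \<sigma>1" using \<sigma>(2) y unfolding r1(3) by auto
      then show False using face_eqI \<sigma> False by blast
    qed
    moreover have "d1 > y1" using \<sigma>(2) unfolding r1(3) by auto
    ultimately have d1: "d1 = y" using N g by auto
    have "\<not> c2 < y1"
    proof
      assume "c2 < y1"
      then have "pt w x y1 \<in> \<sigma>2" using \<sigma>(4) y unfolding r2(3) by auto
      then show False using face_eqI \<sigma> False by blast
    qed
    moreover have "c2 < y2" using \<sigma>(4) unfolding r2(3) by auto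
    ultimately have c2: "c2 = y" using N g by auto
    have "pt w x y \<in> frontier \<sigma>1" "pt w x y \<in> frontier \<sigma>2"
      using \<sigma>(2,4) r1 r2 d1 c2 by (auto simp: frontier_rect mem_closure_rect)
    then obtain \<tau>1 \<tau>2 where \<tau>: "\<tau>1 \<in> edges T" "pt w x y \<in> \<tau>1" "\<tau>1 \<subseteq> frontier \<sigma>1"
        "\<tau>2 \<in> edges T" "pt w x y \<in> \<tau>2" "\<tau>2 \<subseteq> frontier \<sigma>2"
      using frontier_point_edge \<sigma> by metis
    then have eq: "\<tau>1 = \<tau>2" using edge_through_generic_unique x by blast
    obtain a b where ab: "a < x" "x < b" "\<tau>1 = seg w a b y" using edge_through_generic \<tau> x by metis
    have "\<tau>1 \<subseteq> closure \<sigma>1" "\<tau>1 \<subseteq> closure \<sigma>2" using \<tau> eq by (auto simp: frontier_def)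
    then show ?thesis using False ab \<tau> r1 r2 d1 c2 by blast
  qed
qed

text \<open>An edge cannot enter an open face, so it lies in one of the two sides parallel to it.\<close>
lemma edge_in_closed_face:
  assumes "seg w a b c \<in> edges T" "a < b" "\<sigma> \<in> faces T" "seg w a b c \<subseteq> closure \<sigma>"
  obtains a' b' c' d' where "\<sigma> = rect w a' b' c' d'" "a' \<le> a" "b \<le> b'" "c' < d'" "c = c' \<or> c = d'"
proof -
  obtain a' b' c' d' where r: "a' < b'" "c' < d'" "\<sigma> = rect w a' b' c' d'" using face_rectE assms by metis
  have "pt w a c \<in> closure \<sigma>" "pt w b c \<in> closure \<sigma>" using assms by (auto intro!: subsetD[OF assms(4)])
  then have cl: "a' \<le> a" "b \<le> b'" "c' \<le> c" "c \<le> d'" using r by (auto simp: mem_closure_rect)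
  have "\<not> (c' < c \<and> c < d')"
  proof
    assume "c' < c \<and> c < d'"
    then have "pt w ((a + b) / 2) c \<in> \<sigma>" using cl assms(2) unfolding r(3) by auto
    moreover have "pt w ((a + b) / 2) c \<in> seg w a b c" using assms(2) by auto
    ultimately show False using edge_disjoint_face assms by blast
  qed
  then show ?thesis using that[of a' b' c' d'] r cl by linarith
qed

text \<open>Two rectangles that touch a segment from the same side overlap.\<close>
lemma face_on_side_unique:
  assumes "a < b" "a' \<le> a" "b \<le> b'" "a'' \<le> a" "b \<le> b''"
    and "c' < d'" "c'' < d''" "c' = c'' \<or> d' = d''"
    and "rect w a' b' c' d' \<in> faces T" "rect w a'' b'' c'' d'' \<in> faces T"
  shows "rect w a' b' c' d' = rect w a'' b'' c'' d''"
proof -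
  let ?x = "(a + b) / 2" and ?y = "(max c' c'' + min d' d'') / 2"
  have "pt w ?x ?y \<in> rect w a' b' c' d'" "pt w ?x ?y \<in> rect w a'' b'' c'' d''"
    using assms(1-8) by (auto simp: max_def min_def field_simps)
  then show ?thesis using face_eqI assms by blast
qed

lemma interior_edge_generic_point:
  assumes "seg w a b c \<in> interior_edges T" "a < b"
  obtains x where "a < x" "x < b" "x \<notin> grid T" "pt w x c \<in> interior \<Omega>"
proof -
  obtain p where p: "p \<in> seg w a b c" "p \<in> interior \<Omega>" using assms by (auto simp: interior_edges_def)
  then obtain x0 where x0: "a \<le> x0" "x0 \<le> b" "p = pt w x0 c"
    by (metis pt_co mem_seg)
  then obtain e where e: "e > 0" "\<And>x' y'. \<bar>x' - x0\<bar> < e \<Longrightarrow> \<bar>y' - c\<bar> < e \<Longrightarrow> pt w x' y' \<in> interior \<Omega>"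
    using open_contains_box p by (metis open_interior)
  have "max a (x0 - e) < min b (x0 + e)" using x0 e assms by auto
  then obtain x where "max a (x0 - e) < x" "x < min b (x0 + e)" "x \<notin> grid T"
    using real_avoid_finite[OF finite_grid] by metis
  then show ?thesis using that[of x] e by auto
qed

lemma interior_point_neighbours:
  assumes "pt w x y \<in> interior \<Omega>" "x \<notin> grid T"
  obtains y1 y2 \<sigma>1 \<sigma>2 where "y1 < y" "y < y2" "\<sigma>1 \<in> faces T" "\<sigma>2 \<in> faces T" "pt w x y1 \<in> \<sigma>1" "pt w x y2 \<in> \<sigma>2"
     "\<forall>z\<in>grid T. y1 \<le> z \<and> z \<le> y2 \<longrightarrow> z = y"
proof -
  obtain e where e: "e > 0" "\<And>x' y'. \<bar>x' - x\<bar> < e \<Longrightarrow> \<bar>y' - y\<bar> < e \<Longrightarrow> pt w x' y' \<in> interior \<Omega>"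
    using open_contains_box assms by (metis open_interior)
  obtain d where d: "d > 0" "\<And>z. z \<in> grid T \<Longrightarrow> \<bar>z - y\<bar> \<le> d \<Longrightarrow> z = y"
    using finite_real_isolated finite_grid by metis
  define h where "h = min (e/2) d"
  have h: "0 < h" "h < e" "h \<le> d" using e d by (auto simp: h_def)
  have "pt w x (y - h) \<in> \<Omega>" "pt w x (y + h) \<in> \<Omega>"
    using e(2)[of x "y - h"] e(2)[of x "y + h"] h interior_subset by auto
  moreover have "y - h \<notin> grid T" "y + h \<notin> grid T" using d(2)[of "y - h"] d(2)[of "y + h"] h by auto
  ultimately obtain \<sigma>1 \<sigma>2 where "\<sigma>1 \<in> faces T" "\<sigma>2 \<in> faces T" "pt w x (y - h) \<in> \<sigma>1" "pt w x (y + h) \<in> \<sigma>2"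
    using face_at_generic assms(2) by metis
  then show ?thesis using h d by (intro that[of "y - h" "y + h"]) (auto simp: abs_le_iff)
qed

text \<open>A generic point of the edge has a face on either side (\<open>faces_across_level\<close>), and there
  is room for only one on each.\<close>
lemma interior_edge_faces:
  assumes "seg w a b c \<in> interior_edges T" "a < b"
  obtains a1 b1 c1 a2 b2 d2 where
    "rect w a1 b1 c1 c \<in> faces T" "rect w a2 b2 c d2 \<in> faces T" "c1 < c" "c < d2"
    "a1 \<le> a" "b \<le> b1" "a2 \<le> a" "b \<le> b2"
    "{\<sigma> \<in> faces T. seg w a b c \<subseteq> closure \<sigma>} = {rect w a1 b1 c1 c, rect w a2 b2 c d2}"
proof -
  have e: "seg w a b c \<in> edges T" using assms by (simp add: interior_edges_def)
  obtain x where x: "a < x" "x < b" "x \<notin> grid T" "pt w x c \<in> interior \<Omega>"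
    using interior_edge_generic_point assms by metis
  then obtain y1 y2 \<sigma>1 \<sigma>2 where y: "y1 < c" "c < y2" "\<sigma>1 \<in> faces T" "\<sigma>2 \<in> faces T"
      "pt w x y1 \<in> \<sigma>1" "pt w x y2 \<in> \<sigma>2"
     "\<forall>z\<in>grid T. y1 \<le> z \<and> z \<le> y2 \<longrightarrow> z = c"
    using interior_point_neighbours by metis
  have on: "pt w x c \<in> seg w a b c" using x by simp
  obtain a' b' a1 b1 c1 a2 b2 d2 where *: "a' < x" "x < b'" "seg w a' b' c \<in> edges T"
       "seg w a' b' c \<subseteq> closure \<sigma>1" "seg w a' b' c \<subseteq> closure \<sigma>2"
       "\<sigma>1 = rect w a1 b1 c1 c" "\<sigma>2 = rect w a2 b2 c d2"
    using faces_across_level[OF x(3) y(1,2,7) y(3,5,4,6)] e on by blast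
  have "pt w x c \<in> seg w a' b' c" using * by simp
  then have "seg w a' b' c = seg w a b c" using edge_through_generic_unique e on x * by blast
  with * have sub: "seg w a b c \<subseteq> closure \<sigma>1" "seg w a b c \<subseteq> closure \<sigma>2" by auto
  have cd: "a1 < b1" "c1 < c" "a2 < b2" "c < d2" using y(5,6) * by auto
  have "pt w a c \<in> closure \<sigma>1" "pt w b c \<in> closure \<sigma>1" "pt w a c \<in> closure \<sigma>2" "pt w b c \<in> closure \<sigma>2"
    using sub assms(2) by (auto intro!: subsetD[OF sub(1)] subsetD[OF sub(2)])
  then have ab: "a1 \<le> a" "b \<le> b1" "a2 \<le> a" "b \<le> b2" using * cd by (auto simp: mem_closure_rect)
  have "\<sigma> = \<sigma>1 \<or> \<sigma> = \<sigma>2" if \<sigma>: "\<sigma> \<in> faces T" "seg w a b c \<subseteq> closure \<sigma>" for \<sigma>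
  proof -
    obtain a3 b3 c3 d3 where r: "\<sigma> = rect w a3 b3 c3 d3" "a3 \<le> a" "b \<le> b3" "c3 < d3" "c = c3 \<or> c = d3"
      using edge_in_closed_face[OF e assms(2) \<sigma>] by metis
    from r(5) show ?thesis
    proof
      assume "c = c3"
      then show ?thesis using face_on_side_unique[of a b a3 b3 a2 b2 c3 d3 c d2 w] \<sigma> y * r ab cd assms(2) by simp
    next
      assume "c = d3"
      then show ?thesis using face_on_side_unique[of a b a3 b3 a1 b1 c3 d3 c1 c w] \<sigma> y * r ab cd assms(2) by simp
    qed
  qed
  then have "{\<sigma> \<in> faces T. seg w a b c \<subseteq> closure \<sigma>} = {rect w a1 b1 c1 c, rect w a2 b2 c d2}"
    using y(3,4) sub unfolding *(6,7) by blast
  moreover have "rect w a1 b1 c1 c \<in> faces T" "rect w a2 b2 c d2 \<in> faces T"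
    using y(3,4) unfolding *(6,7) .
  ultimately show ?thesis using cd(2,4) ab by (intro that)
qed

lemma interior_edge_relative_interior:
  assumes "seg w a b c \<in> interior_edges T" "a < x" "x < b"
  shows "pt w x c \<in> interior \<Omega>"
proof -
  have ab: "a < b" using assms by simp
  obtain a1 b1 c1 a2 b2 d2 where f: "rect w a1 b1 c1 c \<in> faces T" "rect w a2 b2 c d2 \<in> faces T" "c1 < c" "c < d2"
    "a1 \<le> a" "b \<le> b1" "a2 \<le> a" "b \<le> b2"
    by (rule interior_edge_faces[OF assms(1) ab]) blast
  have "rect w a b c1 d2 \<subseteq> \<Omega>"
  proof
    fix p assume "p \<in> rect w a b c1 d2"
    then obtain x y where p: "p = pt w x y" "a < x" "x < b" "c1 < y" "y < d2" by (metis pt_co mem_rect)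
    then have "p \<in> closure (rect w a1 b1 c1 c) \<or> p \<in> closure (rect w a2 b2 c d2)"
      using f by (auto simp: mem_closure_rect)
    then show "p \<in> \<Omega>" using f face_subset_domain by blast
  qed
  then have "rect w a b c1 d2 \<subseteq> interior \<Omega>" by (simp add: interior_maximal)
  then show ?thesis using assms f by auto
qed

text \<open>Suppose that a transversal edge meets \<open>\<tau>\<close> in a point between its ends.  The face that it
  bounds then has a side overlapping \<open>\<tau>\<close> that ends at this point.  By uniqueness of edges through
  generic points \<open>\<tau>\<close> is part of that side, although it continues beyond the end of the side.\<close>
lemma vertex_on_edge_is_endpoint:
  assumes "\<gamma> \<in> vertices T" "\<tau> \<in> edges T" "\<gamma> \<in> \<tau>"
  shows "\<gamma> \<in> endpoints \<tau>"
proof -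
  obtain w a b y0 where \<tau>: "a < b" "\<tau> = seg w a b y0" using edge_segE assms by metis
  obtain x0 where \<gamma>: "\<gamma> = pt w x0 y0" "a \<le> x0" "x0 \<le> b" using assms \<tau> by (metis pt_co mem_seg)
  show ?thesis
  proof (rule ccontr)
    assume "\<gamma> \<notin> endpoints \<tau>"
    then have x0: "a < x0" "x0 < b" using \<tau> \<gamma> by (auto simp: endpoints_def edge_ends_seg)
    obtain p q x1 where \<tau>': "p < q" "seg (\<not> w) p q x1 \<in> edges T" "\<gamma> \<in> seg (\<not> w) p q x1"
      using vertex_edge assms(1) by metis
    then have x1: "x1 = x0" "p \<le> y0" "y0 \<le> q" using \<gamma> by (auto simp: mem_seg_Not)
    obtain \<sigma> where \<sigma>: "\<sigma> \<in> faces T" "seg (\<not> w) p q x1 \<subseteq> closure \<sigma>"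
      using edge_in_frontier[OF \<tau>'(2)] by (auto simp: frontier_def)
    obtain c d a' b' where r': "\<sigma> = rect (\<not> w) c d a' b'" "c \<le> p" "q \<le> d" "a' < b'" "x1 = a' \<or> x1 = b'"
      using edge_in_closed_face[OF \<tau>'(2,1) \<sigma>] by metis
    then have r: "\<sigma> = rect w a' b' c d" "c < d" "c \<le> y0" "y0 \<le> d" "x0 = a' \<or> x0 = b'"
      using x1 \<tau>'(1) by (auto simp: rect_Not)
    \<comment> \<open>A generic point of \<open>\<tau>\<close> on the side of the vertex where the face lies.\<close>
    have "max a a' < min b b'" using r(5) r'(4) x0 by auto
    then obtain x where x: "max a a' < x" "x < min b b'" "x \<notin> grid T"
      using real_avoid_finite[OF finite_grid] by metis
    have on: "pt w x y0 \<in> \<tau>" using x \<tau> by auto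
    then have "pt w x y0 \<notin> \<sigma>" using edge_disjoint_face assms(2) \<sigma> by blast
    moreover have "pt w x y0 \<in> closure \<sigma>" using x r r'(4) by (auto simp: mem_closure_rect)
    ultimately have "pt w x y0 \<in> frontier \<sigma>" using r by (simp add: frontier_rect)
    then obtain \<tau>'' where "\<tau>'' \<in> edges T" "pt w x y0 \<in> \<tau>''" "\<tau>'' \<subseteq> frontier \<sigma>"
      using frontier_point_edge \<sigma> by metis
    moreover from this have "\<tau>'' = \<tau>" using edge_through_generic_unique assms(2) on x(3) by blast
    ultimately have "\<tau> \<subseteq> closure \<sigma>" by (auto simp: frontier_def)
    moreover have "pt w a y0 \<in> \<tau>" "pt w b y0 \<in> \<tau>" using \<tau> by auto
    ultimately have "pt w a y0 \<in> closure \<sigma>" "pt w b y0 \<in> closure \<sigma>" by auto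
    then have "a' \<le> a" "b \<le> b'" using r r'(4) by (auto simp: mem_closure_rect)
    then show False using x0 r(5) by auto
  qed
qed

section \<open>The complement of the domain\<close>

lemma compact_domain: "compact \<Omega>"
  unfolding mesh_domain_def
proof (rule compact_UN)
  fix \<sigma> assume "\<sigma> \<in> faces T"
  then obtain a b c d where "a < b" "c < d" "\<sigma> = rect False a b c d" using face_rectE by metis
  then show "compact (closure \<sigma>)" by (simp add: closure_rect compact_Times)
qed (rule finite_faces)

text \<open>A finite union of compact convex sets is an absolute neighbourhood retract.\<close>
lemma locally_path_connected_domain: "locally path_connected \<Omega>"
proof (rule ANR_imp_locally_path_connected)
  have "ANR (\<Union> (closure ` faces T))"
  proof (rule ANR_finite_Union_convex_closed)
    fix C assume "C \<in> closure ` faces T"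
    then obtain \<sigma> where "\<sigma> \<in> faces T" "C = closure \<sigma>" by blast
    then obtain a b c d where "a < b" "c < d" "C = closure (rect False a b c d)" using face_rectE by metis
    then show "convex C" "closed C" by (auto simp: closure_rect convex_Times closed_Times)
  qed (simp add: finite_faces)
  then show "ANR \<Omega>" by (simp add: mesh_domain_def)
qed

lemma no_grid_between:
  fixes x x1 u z d :: real
  assumes "min x x1 < u" "u < max x x1" "\<bar>x1 - x\<bar> < d" "\<bar>z - x\<bar> \<le> d \<Longrightarrow> z = x"
  shows "z \<le> u \<Longrightarrow> z \<le> x1" "u \<le> z \<Longrightarrow> x1 \<le> z"
  using assms by linarith+

text \<open>Close to \<open>(x, y)\<close> the domain is a union of sectors bounded by the axes through this point.  So if
  it misses one point \<open>q\<close> of an open quadrant near \<open>(x, y)\<close>, then it misses all the points of that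
  quadrant close by, and the box spanned by \<open>(x, y)\<close> and \<open>q\<close> contains no interior point of the domain.\<close>
lemma crossing_equiv_to_outside:
  assumes "pt False x y \<notin> interior \<Omega>"
  obtains q where "q \<notin> \<Omega>" "crossing_equiv (interior \<Omega>) (pt False x y) q"
proof -
  obtain dx where dx: "dx > 0" "\<And>z. z \<in> grid T \<Longrightarrow> \<bar>z - x\<bar> \<le> dx \<Longrightarrow> z = x"
    using finite_real_isolated finite_grid by metis
  obtain dy where dy: "dy > 0" "\<And>z. z \<in> grid T \<Longrightarrow> \<bar>z - y\<bar> \<le> dy \<Longrightarrow> z = y"
    using finite_real_isolated finite_grid by metis
  have "open (rect False (x - dx) (x + dx) (y - dy) (y + dy))" "pt False x y \<in> rect False (x - dx) (x + dx) (y - dy) (y + dy)"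
    using dx dy by auto
  moreover have "pt False x y \<in> closure (- \<Omega>)" using assms by (simp add: closure_complement)
  ultimately have "rect False (x - dx) (x + dx) (y - dy) (y + dy) \<inter> - \<Omega> \<noteq> {}"
    using open_Int_closure_eq_empty by blast
  then obtain q0 where "q0 \<in> rect False (x - dx) (x + dx) (y - dy) (y + dy)" "q0 \<in> - \<Omega>" by blast
  moreover have "open (- \<Omega>)" using compact_domain compact_imp_closed by blast
  ultimately have opn: "open (rect False (x - dx) (x + dx) (y - dy) (y + dy) \<inter> - \<Omega>)"
    and "q0 \<in> rect False (x - dx) (x + dx) (y - dy) (y + dy) \<inter> - \<Omega>" by auto
  moreover obtain x0 y0 where q0: "q0 = pt False x0 y0" by (metis pt_co)
  ultimately obtain e where e: "e > 0"
    "\<And>x' y'. \<bar>x' - x0\<bar> < e \<Longrightarrow> \<bar>y' - y0\<bar> < e \<Longrightarrow> pt False x' y' \<in> rect False (x - dx) (x + dx) (y - dy) (y + dy) \<inter> - \<Omega>"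
    using open_contains_box by metis
  \<comment> \<open>Move \<open>q0\<close> off both lines through \<open>(x, y)\<close> without entering the domain.\<close>
  obtain x1 where x1: "x0 < x1" "x1 < x0 + e" "x1 \<notin> {x}" using real_avoid_finite[of "{x}" x0 "x0 + e"] e by auto
  obtain y1 where y1: "y0 < y1" "y1 < y0 + e" "y1 \<notin> {y}" using real_avoid_finite[of "{y}" y0 "y0 + e"] e by auto
  have q: "pt False x1 y1 \<in> rect False (x - dx) (x + dx) (y - dy) (y + dy)" "pt False x1 y1 \<notin> \<Omega>"
    using e(2)[of x1 y1] x1 y1 by auto
  show ?thesis
  proof (rule that[OF q(2)], rule crossing_equiv_box, rule notI)
    fix u v assume uv: "min x x1 \<le> u" "u \<le> max x x1" "min y y1 \<le> v" "v \<le> max y y1" "pt False u v \<in> interior \<Omega>"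
    obtain e' where e': "e' > 0" "\<And>u' v'. \<bar>u' - u\<bar> < e' \<Longrightarrow> \<bar>v' - v\<bar> < e' \<Longrightarrow> pt False u' v' \<in> interior \<Omega>"
      using open_contains_box uv(5) by (metis open_interior)
    \<comment> \<open>An interior point of the domain in the closed box has points of the domain in the open box nearby.\<close>
    have "max (min x x1) (u - e') < min (max x x1) (u + e')" using uv x1 e' by (auto simp: max_def min_def)
    then obtain u' where u': "max (min x x1) (u - e') < u'" "u' < min (max x x1) (u + e')" using dense by blast
    have "max (min y y1) (v - e') < min (max y y1) (v + e')" using uv y1 e' by (auto simp: max_def min_def)
    then obtain v' where v': "max (min y y1) (v - e') < v'" "v' < min (max y y1) (v + e')" using dense by blast
    have "pt False u' v' \<in> \<Omega>" 
    proof (rule subsetD[OF interior_subset], rule e'(2))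
      show "\<bar>u' - u\<bar> < e'" "\<bar>v' - v\<bar> < e'" using u' v' by (auto simp: abs_less_iff)
    qed
    then obtain \<sigma> where \<sigma>: "\<sigma> \<in> faces T" "pt False u' v' \<in> closure \<sigma>" by (auto simp: mesh_domain_def)
    obtain a b c d where r: "a < b" "c < d" "\<sigma> = rect False a b c d" using face_rectE[OF \<sigma>(1)] by metis
    have g: "a \<in> grid T" "b \<in> grid T" "c \<in> grid T" "d \<in> grid T" using grid_face[of False a b c d] \<sigma>(1) r by auto
    have in1: "a \<le> u'" "u' \<le> b" "c \<le> v'" "v' \<le> d" using \<sigma>(2) r by (auto simp: mem_closure_rect)
    \<comment> \<open>No side of a face separates \<open>u'\<close> from \<open>x1\<close> or \<open>v'\<close> from \<open>y1\<close>, hence the closed face of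
    \<open>(u', v')\<close> also contains \<open>(x1, y1)\<close>.\<close>
    have "\<bar>x1 - x\<bar> < dx" "\<bar>y1 - y\<bar> < dy" using q(1) by (auto simp: abs_less_iff)
    moreover have "min x x1 < u'" "u' < max x x1" "min y y1 < v'" "v' < max y y1" using u' v' by auto
    ultimately have "a \<le> x1" "x1 \<le> b" "c \<le> y1" "y1 \<le> d"
      using in1 dx(2)[OF g(1)] dx(2)[OF g(2)] dy(2)[OF g(3)] dy(2)[OF g(4)] no_grid_between by blast+
    then have "pt False x1 y1 \<in> closure \<sigma>" using r by (simp add: mem_closure_rect)
    then show False using q(2) face_subset_domain \<sigma> by blast
  qed
qed

lemma outside_crossing_equiv:
  assumes "simply_connected \<Omega>"
  obtains p0 where "\<And>p. p \<notin> interior \<Omega> \<Longrightarrow> crossing_equiv (interior \<Omega>) p p0"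
proof -
  have con: "connected (- \<Omega>)"
    using connected_Compl_simply_connected_compact compact_domain assms locally_path_connected_domain by blast
  have opn: "open (- \<Omega>)" using compact_domain compact_imp_closed by blast
  have dis: "- \<Omega> \<inter> interior \<Omega> = {}" using interior_subset by blast
  have "\<Omega> \<noteq> UNIV" using compact_domain not_compact_UNIV by metis
  then obtain p0 where p0: "p0 \<in> - \<Omega>" by blast
  show ?thesis
  proof (rule that[of p0])
    fix p assume "p \<notin> interior \<Omega>"
    then obtain q where q: "q \<notin> \<Omega>" "crossing_equiv (interior \<Omega>) p q"
      using crossing_equiv_to_outside by (metis pt_co)
    then have "crossing_equiv (interior \<Omega>) q p0"
      using crossing_equiv_connected[OF opn con _ p0 dis] by blast
    then show "crossing_equiv (interior \<Omega>) p p0" using q crossing_equiv_trans by blast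
  qed
qed

section \<open>Relative cycles are jumps\<close>

lemma finite_interior_edges: "finite (interior_edges T)"
  using finite_edges by (simp add: interior_edges_def)

lemma finite_vertices: "finite (vertices T)"
  using finite_edges by (auto simp: vertices_def endpoints_def)

lemma interior_edge_in_edges: "\<tau> \<in> interior_edges T \<Longrightarrow> \<tau> \<in> edges T"
  by (simp add: interior_edges_def)

lemma edge_along_cases: "\<tau> \<in> edges T \<Longrightarrow> along False \<tau> \<longleftrightarrow> \<not> along True \<tau>"
  by (metis along_seg edge_segE)

lemma face_contains_edge_bounds:
  assumes "a < b" "\<sigma> \<in> faces T" "\<sigma> = rect w a' b' c' d'" "c' < d'" "seg w a b c \<subseteq> closure \<sigma>"
  shows "a' \<le> a" "b \<le> b'"
proof -
  obtain a'' b'' c'' d'' where r: "a'' < b''" "c'' < d''" "\<sigma> = rect w a'' b'' c'' d''" using face_rectE assms(2) by metis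
  then have "pt w ((a'' + b'') / 2) ((c'' + d'') / 2) \<in> \<sigma>" by simp
  then have ab: "a' < b'" unfolding assms(3) by auto
  have "pt w a c \<in> closure \<sigma>" "pt w b c \<in> closure \<sigma>"
    using assms(1) by (auto intro!: subsetD[OF assms(5)])
  then show "a' \<le> a" "b \<le> b'" using ab assms by (auto simp: mem_closure_rect)
qed

lemma lower_upper_face:
  assumes "seg w a b c \<in> interior_edges T" "a < b"
  obtains a1 b1 c1 a2 b2 d2 where
    "lower_face T (seg w a b c) = rect w a1 b1 c1 c" "upper_face T (seg w a b c) = rect w a2 b2 c d2"
    "rect w a1 b1 c1 c \<in> faces T" "rect w a2 b2 c d2 \<in> faces T" "c1 < c" "c < d2"
    "a1 \<le> a" "b \<le> b1" "a2 \<le> a" "b \<le> b2"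
    "{\<sigma> \<in> faces T. seg w a b c \<subseteq> closure \<sigma>} = {rect w a1 b1 c1 c, rect w a2 b2 c d2}"
proof -
  let ?\<tau> = "seg w a b c"
  obtain a1 b1 c1 a2 b2 d2 where f:
    "rect w a1 b1 c1 c \<in> faces T" "rect w a2 b2 c d2 \<in> faces T" "c1 < c" "c < d2"
    "a1 \<le> a" "b \<le> b1" "a2 \<le> a" "b \<le> b2"
    and set: "{\<sigma> \<in> faces T. ?\<tau> \<subseteq> closure \<sigma>} = {rect w a1 b1 c1 c, rect w a2 b2 c d2}"
    by (rule interior_edge_faces[OF assms]) blast
  have low: "\<sigma> = rect w a1 b1 c1 c"
    if \<sigma>: "\<sigma> \<in> faces T \<and> ?\<tau> \<subseteq> closure \<sigma> \<and>
     (\<exists>w' a' b' c' a'' b'' c''. a' < b' \<and> ?\<tau> = seg w' a' b' c' \<and> c'' < c' \<and> \<sigma> = rect w' a'' b'' c'' c')" for \<sigma>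
  proof -
    from \<sigma> obtain w' a' b' c' a'' b'' c'' where
      "a' < b'" "?\<tau> = seg w' a' b' c'" "c'' < c'" "\<sigma> = rect w' a'' b'' c'' c'" by blast
    then have *: "c'' < c" "\<sigma> = rect w a'' b'' c'' c" using assms(2) by (auto simp: seg_eq_iff)
    then have "a'' \<le> a" "b \<le> b''" using face_contains_edge_bounds[OF assms(2) _ *(2,1)] \<sigma> by auto
    then show ?thesis using face_on_side_unique[of a b a'' b'' a1 b1 c'' c c1 c w] \<sigma> * f assms(2) by simp
  qed
  have up: "\<sigma> = rect w a2 b2 c d2"
    if \<sigma>: "\<sigma> \<in> faces T \<and> ?\<tau> \<subseteq> closure \<sigma> \<and>
     (\<exists>w' a' b' c' a'' b'' d''. a' < b' \<and> ?\<tau> = seg w' a' b' c' \<and> c' < d'' \<and> \<sigma> = rect w' a'' b'' c' d'')" for \<sigma>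
  proof -
    from \<sigma> obtain w' a' b' c' a'' b'' d'' where
      "a' < b'" "?\<tau> = seg w' a' b' c'" "c' < d''" "\<sigma> = rect w' a'' b'' c' d''" by blast
    then have *: "c < d''" "\<sigma> = rect w a'' b'' c d''" using assms(2) by (auto simp: seg_eq_iff)
    then have "a'' \<le> a" "b \<le> b''" using face_contains_edge_bounds[OF assms(2) _ *(2,1)] \<sigma> by auto
    then show ?thesis using face_on_side_unique[of a b a'' b'' a2 b2 c d'' c d2 w] \<sigma> * f assms(2) by simp
  qed
  have sub: "?\<tau> \<subseteq> closure (rect w a1 b1 c1 c)" "?\<tau> \<subseteq> closure (rect w a2 b2 c d2)"
    using set by blast+
  have "lower_face T ?\<tau> = rect w a1 b1 c1 c"
    unfolding lower_face_def
  proof (rule some_equality[OF _ low])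
    show "rect w a1 b1 c1 c \<in> faces T \<and> ?\<tau> \<subseteq> closure (rect w a1 b1 c1 c) \<and>
     (\<exists>w' a' b' c' a'' b'' c''. a' < b' \<and> ?\<tau> = seg w' a' b' c' \<and> c'' < c' \<and> rect w a1 b1 c1 c = rect w' a'' b'' c'' c')"
      using f sub assms(2) by (intro conjI exI) (rule refl | assumption)+
  qed
  moreover have "upper_face T ?\<tau> = rect w a2 b2 c d2"
    unfolding upper_face_def
  proof (rule some_equality[OF _ up])
    show "rect w a2 b2 c d2 \<in> faces T \<and> ?\<tau> \<subseteq> closure (rect w a2 b2 c d2) \<and>
     (\<exists>w' a' b' c' a'' b'' d''. a' < b' \<and> ?\<tau> = seg w' a' b' c' \<and> c' < d'' \<and> rect w a2 b2 c d2 = rect w' a'' b'' c' d'')"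
      using f sub assms(2) by (intro conjI exI) (rule refl | assumption)+
  qed
  ultimately show ?thesis using f set by (intro that)
qed

lemma sum_edges_by_direction:
  assumes A: "A \<subseteq> edges T"
  shows "(\<Sum>\<tau>\<in>A. f \<tau>) = (\<Sum>\<tau> | \<tau> \<in> A \<and> along False \<tau>. f \<tau>) + (\<Sum>\<tau> | \<tau> \<in> A \<and> along True \<tau>. f \<tau> :: 'v::real_vector)"
proof -
  have "finite A" using A finite_edges finite_subset by blast
  moreover have "A = {\<tau> \<in> A. along False \<tau>} \<union> {\<tau> \<in> A. along True \<tau>}"
    using A edge_along_cases by blast
  moreover have "{\<tau> \<in> A. along False \<tau>} \<inter> {\<tau> \<in> A. along True \<tau>} = {}"
    using A edge_along_cases by blast
  ultimately show ?thesis by (metis (no_types, lifting) finite_Un sum.union_disjoint)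
qed

text \<open>The coefficient at \<open>\<gamma>\<close> of the cellular boundary of the \<open>1\<close>-chain \<open>c\<close>, before the
  boundary vertices are set to zero.\<close>
definition net_inflow :: "((real \<times> real) set \<Rightarrow> 'v::real_vector) \<Rightarrow> real \<times> real \<Rightarrow> 'v" where
  "net_inflow c \<gamma> = (\<Sum>\<tau> | \<tau> \<in> interior_edges T \<and> edge_end \<tau> = \<gamma>. c \<tau>)
                  - (\<Sum>\<tau> | \<tau> \<in> interior_edges T \<and> edge_start \<tau> = \<gamma>. c \<tau>)"

text \<open>Summation by parts on the graph of interior edges.\<close>
lemma sum_net_inflow:
  fixes c :: "(real \<times> real) set \<Rightarrow> 'v::real_vector" and u :: "real \<times> real \<Rightarrow> real"
  shows "(\<Sum>\<gamma>\<in>vertices T. u \<gamma> *\<^sub>R net_inflow c \<gamma>) =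
    (\<Sum>\<tau>\<in>interior_edges T. (u (edge_end \<tau>) - u (edge_start \<tau>)) *\<^sub>R c \<tau>)"
proof -
  have "edge_end ` interior_edges T \<subseteq> vertices T" "edge_start ` interior_edges T \<subseteq> vertices T"
    by (auto simp: vertices_def endpoints_def interior_edges_def)
  note group = this[THEN sum.group[OF finite_interior_edges finite_vertices]]
  have "(\<Sum>\<gamma>\<in>vertices T. u \<gamma> *\<^sub>R net_inflow c \<gamma>) =
     (\<Sum>\<gamma>\<in>vertices T. \<Sum>\<tau> | \<tau> \<in> interior_edges T \<and> edge_end \<tau> = \<gamma>. u (edge_end \<tau>) *\<^sub>R c \<tau>)
   - (\<Sum>\<gamma>\<in>vertices T. \<Sum>\<tau> | \<tau> \<in> interior_edges T \<and> edge_start \<tau> = \<gamma>. u (edge_start \<tau>) *\<^sub>R c \<tau>)"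
    unfolding net_inflow_def by (simp add: scaleR_diff_right scaleR_sum_right sum_subtractf)
  also have "\<dots> = (\<Sum>\<tau>\<in>interior_edges T. u (edge_end \<tau>) *\<^sub>R c \<tau>) - (\<Sum>\<tau>\<in>interior_edges T. u (edge_start \<tau>) *\<^sub>R c \<tau>)"
    by (simp only: group)
  finally show ?thesis by (simp add: scaleR_diff_left sum_subtractf)
qed

lemma quadrant_step:
  assumes "a < b" "y1 \<le> y2"
  shows "(quadrant (pt w a c) (pt w x y2) - quadrant (pt w b c) (pt w x y2))
       - (quadrant (pt w a c) (pt w x y1) - quadrant (pt w b c) (pt w x y1))
       = of_bool (a < x \<and> x \<le> b \<and> y1 \<le> c \<and> c < y2)"
  using assms by (auto simp: quadrant_pt of_bool_def)

text \<open>The segment from \<open>pt w x y1\<close> to \<open>pt w x y2\<close> crosses \<open>\<tau>\<close>.  The half-open conditions are those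
  under which the strict inequalities in \<^const>\<open>quadrant\<close> change.\<close>
definition crosses :: "bool \<Rightarrow> real \<Rightarrow> real \<Rightarrow> real \<Rightarrow> (real \<times> real) set \<Rightarrow> bool" where
  "crosses w x y1 y2 \<tau> \<longleftrightarrow> (\<exists>a b c. \<tau> = seg w a b c \<and> a < x \<and> x \<le> b \<and> y1 \<le> c \<and> c < y2)"

text \<open>The relative homology of \<open>(\<Omega>, \<partial>\<Omega>)\<close> in degree \<open>1\<close> vanishes.  The function \<open>G w\<close> sums, with
  coefficients, the edges of the cycle in direction \<open>w\<close> that lie below \<open>z\<close> (for \<open>w = False\<close>) or to the
  left of \<open>z\<close> (for \<open>w = True\<close>), together with the pieces in this direction of the paths that
  close up the cycle outside the interior of \<open>\<Omega>\<close>.\<close>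
theorem cycle_is_jump:
  fixes c :: "(real \<times> real) set \<Rightarrow> 'v::real_vector"
  assumes sc: "simply_connected \<Omega>" and S: "subspace S" "\<And>\<tau>. \<tau> \<in> interior_edges T \<Longrightarrow> c \<tau> \<in> S"
    and cycle: "\<And>\<gamma>. \<gamma> \<in> interior_vertices T \<Longrightarrow> net_inflow c \<gamma> = 0"
  obtains g where "\<And>\<sigma>. g \<sigma> \<in> S" "\<And>\<tau>. \<tau> \<in> interior_edges T \<Longrightarrow> jump T g \<tau> = c \<tau>"
proof -
  let ?W = "interior \<Omega>" and ?E = "interior_edges T" and ?B = "vertices T - interior \<Omega>"
  obtain p0 where p0: "\<And>p. p \<notin> ?W \<Longrightarrow> crossing_equiv ?W p p0"
    using outside_crossing_equiv sc by metis
  then have "\<forall>p. \<exists>h. p \<notin> ?W \<longrightarrow> (\<forall>z. h False z + h True z = quadrant p z - quadrant p0 z) \<and>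
     (\<forall>w x y1 y2. y1 \<le> y2 \<longrightarrow> (\<forall>y. y1 \<le> y \<and> y \<le> y2 \<longrightarrow> pt w x y \<in> ?W) \<longrightarrow>
        h w (pt w x y1) = h w (pt w x y2))"
    unfolding crossing_equiv_def by blast
  then obtain h where "\<forall>p. p \<notin> ?W \<longrightarrow> (\<forall>z. h p False z + h p True z = quadrant p z - quadrant p0 z) \<and>
     (\<forall>w x y1 y2. y1 \<le> y2 \<longrightarrow> (\<forall>y. y1 \<le> y \<and> y \<le> y2 \<longrightarrow> pt w x y \<in> ?W) \<longrightarrow>
        h p w (pt w x y1) = h p w (pt w x y2))"
    by (rule choice[THEN exE])
  then have h1: "\<And>p z. p \<notin> ?W \<Longrightarrow> h p False z + h p True z = quadrant p z - quadrant p0 z"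
    and h2: "\<And>p w x y1 y2. p \<notin> ?W \<Longrightarrow> y1 \<le> y2 \<Longrightarrow> (\<And>y. y1 \<le> y \<Longrightarrow> y \<le> y2 \<Longrightarrow> pt w x y \<in> ?W) \<Longrightarrow>
        h p w (pt w x y1) = h p w (pt w x y2)"
    by blast+
  define b where "b = net_inflow c"
  define G where "G w z = (\<Sum>\<tau> | \<tau> \<in> ?E \<and> along w \<tau>. (quadrant (edge_start \<tau>) z - quadrant (edge_end \<tau>) z) *\<^sub>R c \<tau>)
                     + (\<Sum>\<gamma>\<in>?B. h \<gamma> w z *\<^sub>R b \<gamma>)" for w z
  \<comment> \<open>By hypothesis the boundary \<open>b\<close> of the cycle sits on the vertices outside the interior.\<close>
  have b0: "b \<gamma> = 0" if "\<gamma> \<in> vertices T - ?B" for \<gamma>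
    using that cycle by (simp add: b_def interior_vertices_def)
  have G0: "G False z = - G True z" for z
  proof -
    have Etot: "(\<Sum>\<tau> | \<tau> \<in> ?E \<and> along False \<tau>. (quadrant (edge_start \<tau>) z - quadrant (edge_end \<tau>) z) *\<^sub>R c \<tau>)
      + (\<Sum>\<tau> | \<tau> \<in> ?E \<and> along True \<tau>. (quadrant (edge_start \<tau>) z - quadrant (edge_end \<tau>) z) *\<^sub>R c \<tau>)
      = (\<Sum>\<tau>\<in>?E. (quadrant (edge_start \<tau>) z - quadrant (edge_end \<tau>) z) *\<^sub>R c \<tau>)"
      using interior_edge_in_edges by (intro sum_edges_by_direction[symmetric]) auto
    have "(\<Sum>\<tau>\<in>?E. (quadrant (edge_start \<tau>) z - quadrant (edge_end \<tau>) z) *\<^sub>R c \<tau>)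
        = - (\<Sum>\<tau>\<in>?E. (quadrant (edge_end \<tau>) z - quadrant (edge_start \<tau>) z) *\<^sub>R c \<tau>)"
      unfolding sum_negf[symmetric] by (intro sum.cong) (auto simp: scaleR_diff_left)
    also have "\<dots> = - (\<Sum>\<gamma>\<in>vertices T. quadrant \<gamma> z *\<^sub>R b \<gamma>)"
      unfolding b_def sum_net_inflow[of "\<lambda>\<gamma>. quadrant \<gamma> z" c] ..
    also have "(\<Sum>\<gamma>\<in>vertices T. quadrant \<gamma> z *\<^sub>R b \<gamma>) = (\<Sum>\<gamma>\<in>?B. quadrant \<gamma> z *\<^sub>R b \<gamma>)"
      using finite_vertices b0 by (intro sum.mono_neutral_right) auto
    finally have E: "(\<Sum>\<tau>\<in>?E. (quadrant (edge_start \<tau>) z - quadrant (edge_end \<tau>) z) *\<^sub>R c \<tau>)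
        = - (\<Sum>\<gamma>\<in>?B. quadrant \<gamma> z *\<^sub>R b \<gamma>)" .
    have "(\<Sum>\<gamma>\<in>?B. b \<gamma>) = (\<Sum>\<gamma>\<in>vertices T. 1 *\<^sub>R b \<gamma>)"
      unfolding scaleR_one using finite_vertices b0 by (intro sum.mono_neutral_left) auto
    also have "\<dots> = 0" unfolding b_def sum_net_inflow[of "\<lambda>_. 1" c] by simp
    \<comment> \<open>The total boundary of any chain is zero, hence nothing is left at \<open>p0\<close>, where all the paths end.\<close>
    finally have bsum: "(\<Sum>\<gamma>\<in>?B. b \<gamma>) = 0" .
    have "(\<Sum>\<gamma>\<in>?B. h \<gamma> False z *\<^sub>R b \<gamma>) + (\<Sum>\<gamma>\<in>?B. h \<gamma> True z *\<^sub>R b \<gamma>)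
       = (\<Sum>\<gamma>\<in>?B. (h \<gamma> False z + h \<gamma> True z) *\<^sub>R b \<gamma>)"
      by (simp add: scaleR_add_left sum.distrib)
    also have "\<dots> = (\<Sum>\<gamma>\<in>?B. (quadrant \<gamma> z - quadrant p0 z) *\<^sub>R b \<gamma>)"
      using h1 by (intro sum.cong) auto
    also have "\<dots> = (\<Sum>\<gamma>\<in>?B. quadrant \<gamma> z *\<^sub>R b \<gamma>) - quadrant p0 z *\<^sub>R (\<Sum>\<gamma>\<in>?B. b \<gamma>)"
      by (simp add: scaleR_diff_left sum_subtractf scaleR_sum_right)
    finally have "(\<Sum>\<gamma>\<in>?B. h \<gamma> False z *\<^sub>R b \<gamma>) + (\<Sum>\<gamma>\<in>?B. h \<gamma> True z *\<^sub>R b \<gamma>) = (\<Sum>\<gamma>\<in>?B. quadrant \<gamma> z *\<^sub>R b \<gamma>)"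
      using bsum by simp
    note Htot = this
    have "u1 + v1 + (u2 + v2) = 0" if "u1 + u2 = e" "e = - d" "v1 + v2 = d" for u1 v1 u2 v2 e d :: 'v
      using that by (metis add.left_commute add.assoc add.left_inverse)
    from this[OF Etot E Htot] have "G False z + G True z = 0" unfolding G_def .
    then show ?thesis by (simp add: eq_neg_iff_add_eq_0)
  qed
  \<comment> \<open>Along a segment inside the interior of \<open>\<Omega>\<close> the paths contribute no change, so that only the edges crossed
  by it count.\<close>
  have Gdiff: "G w (pt w x y2) - G w (pt w x y1) =
      (\<Sum>\<tau> | \<tau> \<in> ?E \<and> along w \<tau>. of_bool (crosses w x y1 y2 \<tau>) *\<^sub>R c \<tau>)"
    if "y1 \<le> y2" "\<And>y. y1 \<le> y \<Longrightarrow> y \<le> y2 \<Longrightarrow> pt w x y \<in> ?W" for w x y1 y2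
  proof -
    have "(\<Sum>\<gamma>\<in>?B. h \<gamma> w (pt w x y1) *\<^sub>R b \<gamma>) = (\<Sum>\<gamma>\<in>?B. h \<gamma> w (pt w x y2) *\<^sub>R b \<gamma>)"
      using h2 that by (intro sum.cong) auto
    then have "G w (pt w x y2) - G w (pt w x y1) =
      (\<Sum>\<tau> | \<tau> \<in> ?E \<and> along w \<tau>. ((quadrant (edge_start \<tau>) (pt w x y2) - quadrant (edge_end \<tau>) (pt w x y2))
         - (quadrant (edge_start \<tau>) (pt w x y1) - quadrant (edge_end \<tau>) (pt w x y1))) *\<^sub>R c \<tau>)"
      unfolding G_def by (simp add: scaleR_diff_left sum_subtractf)
    also have "\<dots> = (\<Sum>\<tau> | \<tau> \<in> ?E \<and> along w \<tau>. of_bool (crosses w x y1 y2 \<tau>) *\<^sub>R c \<tau>)"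
    proof (intro sum.cong refl)
      fix \<tau> assume "\<tau> \<in> {\<tau> \<in> ?E. along w \<tau>}"
      then obtain a b c' where \<tau>: "a < b" "\<tau> = seg w a b c'" using alongE by blast
      have "crosses w x y1 y2 \<tau> \<longleftrightarrow> (a < x \<and> x \<le> b \<and> y1 \<le> c' \<and> c' < y2)"
        unfolding crosses_def using \<tau> by (metis order.strict_trans2 seg_eq_iff)
      then show "((quadrant (edge_start \<tau>) (pt w x y2) - quadrant (edge_end \<tau>) (pt w x y2))
         - (quadrant (edge_start \<tau>) (pt w x y1) - quadrant (edge_end \<tau>) (pt w x y1))) *\<^sub>R c \<tau>
         = of_bool (crosses w x y1 y2 \<tau>) *\<^sub>R c \<tau>"
        using quadrant_step[OF \<tau>(1) that(1), of w c' x] \<tau> by (simp add: edge_ends_seg)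
    qed
    finally show ?thesis .
  qed
  have Gface_le: "G w (pt w x y1) = G w (pt w x y2)"
    if "\<sigma> \<in> faces T" "pt w x y1 \<in> \<sigma>" "pt w x y2 \<in> \<sigma>" "y1 \<le> y2" for w x y1 y2 \<sigma>
  proof -
    obtain a' b' c' d' where r: "\<sigma> = rect w a' b' c' d'" using face_rectE \<open>\<sigma> \<in> faces T\<close> by metis
    have in\<sigma>: "pt w x y \<in> \<sigma>" if "y1 \<le> y" "y \<le> y2" for y
      using that \<open>pt w x y1 \<in> \<sigma>\<close> \<open>pt w x y2 \<in> \<sigma>\<close> unfolding r by auto
    then have "\<And>y. y1 \<le> y \<Longrightarrow> y \<le> y2 \<Longrightarrow> pt w x y \<in> ?W" using face_in_interior that(1) by blast
    from Gdiff[OF that(4) this]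
    have "G w (pt w x y2) - G w (pt w x y1) =
      (\<Sum>\<tau> | \<tau> \<in> ?E \<and> along w \<tau>. of_bool (crosses w x y1 y2 \<tau>) *\<^sub>R c \<tau>)" .
    also have "\<dots> = 0"
    proof (intro sum.neutral ballI)
      fix \<tau> assume \<tau>: "\<tau> \<in> {\<tau> \<in> ?E. along w \<tau>}"
      have "\<not> crosses w x y1 y2 \<tau>"
      proof
        assume "crosses w x y1 y2 \<tau>"
        then obtain a' b' c' where s: "\<tau> = seg w a' b' c'" "a' < x" "x \<le> b'" "y1 \<le> c'" "c' < y2"
          unfolding crosses_def by blast
        then have "pt w x c' \<in> \<tau>" "pt w x c' \<in> \<sigma>" using in\<sigma> by auto
        then show False using edge_disjoint_face[of \<tau> \<sigma>] \<tau> that(1) interior_edge_in_edges by blast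
      qed
      then show "of_bool (crosses w x y1 y2 \<tau>) *\<^sub>R c \<tau> = 0" by simp
    qed
    finally show ?thesis by simp
  qed
  have Gface: "G w (pt w x y1) = G w (pt w x y2)"
    if "\<sigma> \<in> faces T" "pt w x y1 \<in> \<sigma>" "pt w x y2 \<in> \<sigma>" for w x y1 y2 \<sigma>
    using Gface_le[OF that] Gface_le[OF that(1,3,2), THEN sym] linear by blast
  \<comment> \<open>Two points of a face are joined by a vertical and a horizontal segment inside it.  On the first one
  \<open>G False\<close> is constant; on the second one \<open>G True\<close> is, and hence \<open>G False = - G True\<close>.\<close>
  have const: "G False z = G False z'" if "\<sigma> \<in> faces T" "z \<in> \<sigma>" "z' \<in> \<sigma>" for z z' \<sigma>
  proof -
    obtain x y x' y' where z: "z = pt False x y" "z' = pt False x' y'" by (metis pt_co)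
    obtain a' b' c' d' where r: "\<sigma> = rect False a' b' c' d'" using face_rectE \<open>\<sigma> \<in> faces T\<close> by metis
    have corner: "pt False x y' \<in> \<sigma>" using that z unfolding r by auto
    have swap: "pt False x y' = pt True y' x" "pt False x' y' = pt True y' x'" by (simp_all add: pt_def)
    have "G False (pt False x y) = G False (pt False x y')"
      using Gface that z corner by blast
    moreover have "G True (pt False x y') = G True (pt False x' y')"
      using Gface[of \<sigma> True y' x x'] that z corner unfolding swap by blast
    ultimately show ?thesis using G0 z by simp
  qed
  define g where "g = (\<lambda>\<sigma>. G False (SOME z. z \<in> \<sigma>))"
  have g: "g \<sigma> = G False z" if "\<sigma> \<in> faces T" "z \<in> \<sigma>" for \<sigma> z
    unfolding g_def using const that someI[of "\<lambda>z. z \<in> \<sigma>" z] by blast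
  have bS: "b \<gamma> \<in> S" for \<gamma>
    unfolding b_def net_inflow_def using S by (intro subspace_diff subspace_sum) auto
  have gS: "g \<sigma> \<in> S" for \<sigma>
    unfolding g_def G_def using S bS by (intro subspace_add subspace_sum subspace_scale) auto
  have "jump T g \<tau> = c \<tau>" if \<tau>E: "\<tau> \<in> ?E" for \<tau>
  proof -
    obtain w a b c0 where \<tau>: "a < b" "\<tau> = seg w a b c0" using edge_segE interior_edge_in_edges[OF \<tau>E] by metis
    obtain a1 b1 c1 a2 b2 d2 where f: "lower_face T \<tau> = rect w a1 b1 c1 c0" "upper_face T \<tau> = rect w a2 b2 c0 d2"
       "rect w a1 b1 c1 c0 \<in> faces T" "rect w a2 b2 c0 d2 \<in> faces T" "c1 < c0" "c0 < d2"
       "a1 \<le> a" "b \<le> b1" "a2 \<le> a" "b \<le> b2"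
      unfolding \<tau>(2) by (rule lower_upper_face[OF \<tau>E[unfolded \<tau>(2)] \<tau>(1)]) blast
    \<comment> \<open>A transversal through a generic point of \<open>\<tau>\<close>, from the face below to the face above, meets no other edge.\<close>
    obtain x where x: "a < x" "x < b" "x \<notin> grid T" using real_avoid_finite[OF finite_grid \<tau>(1)] by metis
    define y1 y2 where "y1 = (c1 + c0) / 2" and "y2 = (c0 + d2) / 2"
    have y: "c1 < y1" "y1 < c0" "c0 < y2" "y2 < d2" using f by (auto simp: y1_def y2_def)
    have inlow: "pt w x y \<in> rect w a1 b1 c1 c0" if "y1 \<le> y" "y < c0" for y using that f x y by auto
    have inup: "pt w x y \<in> rect w a2 b2 c0 d2" if "c0 < y" "y \<le> y2" for y using that f x y by auto
    have inW: "pt w x y \<in> ?W" if "y1 \<le> y" "y \<le> y2" for y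
    proof -
      consider "y < c0" | "y = c0" | "c0 < y" by linarith
      then show ?thesis
      proof cases
        case 1 then show ?thesis using inlow that face_in_interior f(3) by blast
      next
        case 2 then show ?thesis using interior_edge_relative_interior \<tau>E \<tau> x by blast
      next
        case 3 then show ?thesis using inup that face_in_interior f(4) by blast
      qed
    qed
    have "G w (pt w x y2) - G w (pt w x y1) =
      (\<Sum>\<tau>' | \<tau>' \<in> ?E \<and> along w \<tau>'. of_bool (crosses w x y1 y2 \<tau>') *\<^sub>R c \<tau>')"
      using Gdiff[of y1 y2 w x] y inW by simp
    also have "\<dots> = (\<Sum>\<tau>' | \<tau>' \<in> ?E \<and> along w \<tau>'. if \<tau>' = \<tau> then c \<tau>' else 0)"
    proof (intro sum.cong refl)
      fix \<tau>' assume \<tau>': "\<tau>' \<in> {\<tau>' \<in> ?E. along w \<tau>'}"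
      have "crosses w x y1 y2 \<tau>' \<longleftrightarrow> \<tau>' = \<tau>"
      proof
        assume "crosses w x y1 y2 \<tau>'"
        then obtain a' b' c' where s: "\<tau>' = seg w a' b' c'" "a' < x" "x \<le> b'" "y1 \<le> c'" "c' < y2"
          unfolding crosses_def by blast
        then have on: "pt w x c' \<in> \<tau>'" by simp
        have dis: "pt w x c' \<notin> \<sigma>" if "\<sigma> \<in> faces T" for \<sigma>
          using edge_disjoint_face[of \<tau>' \<sigma>] \<tau>' that on interior_edge_in_edges by blast
        have "c' = c0"
        proof (rule ccontr)
          assume "c' \<noteq> c0"
          then consider "c' < c0" | "c0 < c'" by linarith
          then show False
            using inlow[of c'] inup[of c'] s(4,5) dis[OF f(3)] dis[OF f(4)] by cases auto
        qed
        then show "\<tau>' = \<tau>" using edge_through_generic_unique[of \<tau>' \<tau> w x c0] on \<tau> \<tau>' x \<tau>E interior_edge_in_edges by auto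
      next
        assume "\<tau>' = \<tau>"
        then show "crosses w x y1 y2 \<tau>'"
          unfolding crosses_def using \<tau> x y by (metis less_imp_le)
      qed
      then show "of_bool (crosses w x y1 y2 \<tau>') *\<^sub>R c \<tau>' = (if \<tau>' = \<tau> then c \<tau>' else 0)"
        by simp
    qed
    also have "\<dots> = c \<tau>" using finite_interior_edges \<tau>E \<tau> by (simp add: along_seg)
    finally have Gc: "G w (pt w x y2) - G w (pt w x y1) = c \<tau>" .
    have asc: "ascent T g \<tau> = G False (pt w x y2) - G False (pt w x y1)"
      unfolding ascent_def f(1,2) using g[OF f(3) inlow[of y1]] g[OF f(4) inup[of y2]] y by simp
    show "jump T g \<tau> = c \<tau>"
    proof (cases w)
      case True
      then have "vertical \<tau>" using \<tau> by (simp add: vertical_seg)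
      then show ?thesis unfolding jump_def asc using Gc G0 True by simp
    next
      case False
      then have "\<not> vertical \<tau>" using \<tau> by (simp add: vertical_seg)
      then show ?thesis unfolding jump_def asc using Gc False by simp
    qed
  qed
  with gS that show ?thesis by blast
qed

section \<open>The star of an interior vertex\<close>

text \<open>The sum has at most one term, because at most one edge passes through a generic point.\<close>
lemma sum_ascent_through:
  fixes g :: "(real \<times> real) set \<Rightarrow> 'v::real_vector"
  assumes x: "x \<notin> grid T" and y: "y1 < y" "y < y2" and N: "\<forall>z\<in>grid T. y1 \<le> z \<and> z \<le> y2 \<longrightarrow> z = y"
    and \<sigma>: "\<sigma>1 \<in> faces T" "pt w x y1 \<in> \<sigma>1" "\<sigma>2 \<in> faces T" "pt w x y2 \<in> \<sigma>2"
    and int: "pt w x y \<in> interior \<Omega>"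
  shows "(\<Sum>\<tau> | \<tau> \<in> interior_edges T \<and> pt w x y \<in> \<tau>. ascent T g \<tau>) = g \<sigma>2 - g \<sigma>1"
  using faces_across_level[OF x y N \<sigma>]
proof (elim disjE conjE exE)
  assume "\<sigma>1 = \<sigma>2" "\<forall>\<tau>\<in>edges T. pt w x y \<notin> \<tau>"
  then have "{\<tau>. \<tau> \<in> interior_edges T \<and> pt w x y \<in> \<tau>} = {}" using interior_edge_in_edges by blast
  then show ?thesis using \<open>\<sigma>1 = \<sigma>2\<close> by (simp only: sum.empty) simp
next
  fix a b a1 b1 c1 a2 b2 d2
  let ?\<tau> = "seg w a b y"
  assume \<tau>: "a < x" "x < b" "?\<tau> \<in> edges T" "?\<tau> \<subseteq> closure \<sigma>1" "?\<tau> \<subseteq> closure \<sigma>2"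
  have ab: "a < b" and on: "pt w x y \<in> ?\<tau>" using \<tau> by auto
  then have E: "?\<tau> \<in> interior_edges T" using \<tau>(3) int unfolding interior_edges_def by blast
  have "{\<tau>. \<tau> \<in> interior_edges T \<and> pt w x y \<in> \<tau>} = {?\<tau>}"
    using edge_through_generic_unique[of _ ?\<tau> w x y] x on E interior_edge_in_edges by blast
  then have *: "(\<Sum>\<tau> | \<tau> \<in> interior_edges T \<and> pt w x y \<in> \<tau>. ascent T g \<tau>) = ascent T g ?\<tau>" by simp
  obtain a1' b1' c1' a2' b2' d2' where f: "lower_face T ?\<tau> = rect w a1' b1' c1' y" "upper_face T ?\<tau> = rect w a2' b2' y d2'"
    "{\<sigma> \<in> faces T. ?\<tau> \<subseteq> closure \<sigma>} = {rect w a1' b1' c1' y, rect w a2' b2' y d2'}"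
    by (rule lower_upper_face[OF E ab]) blast
  have "\<sigma>1 \<in> {lower_face T ?\<tau>, upper_face T ?\<tau>}" "\<sigma>2 \<in> {lower_face T ?\<tau>, upper_face T ?\<tau>}"
    using f \<sigma> \<tau> by blast+
  moreover have "\<sigma>1 \<noteq> upper_face T ?\<tau>" "\<sigma>2 \<noteq> lower_face T ?\<tau>"
    unfolding f(1,2) using \<sigma>(2,4) y by auto
  ultimately have "ascent T g ?\<tau> = g \<sigma>2 - g \<sigma>1" unfolding ascent_def by simp
  then show ?thesis using * by simp
qed

text \<open>At a distance from the vertex that is smaller than the gaps of the grid, an edge through \<open>(x0 + e, y0)\<close> in direction
  \<open>w\<close> reaches back to the vertex, and cannot extend beyond it.\<close>
lemma edges_right_of_vertex:
  assumes \<gamma>: "pt w x0 y0 \<in> vertices T" and e: "e > 0" "\<forall>z\<in>grid T. \<bar>z - x0\<bar> \<le> e \<longrightarrow> z = x0"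
  shows "{\<tau>. \<tau> \<in> interior_edges T \<and> pt w (x0 + e) y0 \<in> \<tau>}
       = {\<tau>. (\<tau> \<in> interior_edges T \<and> edge_start \<tau> = pt w x0 y0) \<and> along w \<tau>}"
proof (intro equalityI subsetI CollectI conjI)
  fix \<tau> assume "\<tau> \<in> {\<tau>. \<tau> \<in> interior_edges T \<and> pt w (x0 + e) y0 \<in> \<tau>}"
  then have \<tau>: "\<tau> \<in> interior_edges T" "\<tau> \<in> edges T" "pt w (x0 + e) y0 \<in> \<tau>" using interior_edge_in_edges by auto
  have "x0 + e \<notin> grid T" using e by force
  then obtain a b where s: "a < x0 + e" "x0 + e < b" "\<tau> = seg w a b y0" using edge_through_generic \<tau> by metis
  then have ab: "a < b" by simp
  have "a \<in> grid T" using grid_edge \<tau>(2) s ab by auto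
  then have "a \<le> x0" using bspec[OF e(2), of a] s(1) by (cases "a \<le> x0") auto
  then have "pt w x0 y0 \<in> \<tau>" using s e by auto
  then have "pt w x0 y0 \<in> endpoints \<tau>" using vertex_on_edge_is_endpoint \<gamma> \<tau> by blast
  then have "edge_start \<tau> = pt w x0 y0" using s e(1) ab by (auto simp: endpoints_def edge_ends_seg)
  then show "\<tau> \<in> interior_edges T" "edge_start \<tau> = pt w x0 y0" "along w \<tau>" using \<tau> s ab by (auto simp: along_seg)
next
  fix \<tau> assume "\<tau> \<in> {\<tau>. (\<tau> \<in> interior_edges T \<and> edge_start \<tau> = pt w x0 y0) \<and> along w \<tau>}"
  then have \<tau>: "\<tau> \<in> interior_edges T" "\<tau> \<in> edges T" "edge_start \<tau> = pt w x0 y0" "along w \<tau>"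
    using interior_edge_in_edges by auto
  obtain a b c where s: "a < b" "\<tau> = seg w a b c" using \<tau>(4) alongE by metis
  then have eq: "a = x0" "c = y0" using \<tau>(3) by (auto simp: edge_ends_seg)
  have "b \<in> grid T" using grid_edge \<tau>(2) s by auto
  then have "x0 + e < b" using bspec[OF e(2), of b] s eq by (cases "x0 + e < b") auto
  then show "\<tau> \<in> interior_edges T" "pt w (x0 + e) y0 \<in> \<tau>" using \<tau>(1) s eq e by auto
qed

lemma edges_left_of_vertex:
  assumes \<gamma>: "pt w x0 y0 \<in> vertices T" and e: "e > 0" "\<forall>z\<in>grid T. \<bar>z - x0\<bar> \<le> e \<longrightarrow> z = x0"
  shows "{\<tau>. \<tau> \<in> interior_edges T \<and> pt w (x0 - e) y0 \<in> \<tau>}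
       = {\<tau>. (\<tau> \<in> interior_edges T \<and> edge_end \<tau> = pt w x0 y0) \<and> along w \<tau>}"
proof (intro equalityI subsetI CollectI conjI)
  fix \<tau> assume "\<tau> \<in> {\<tau>. \<tau> \<in> interior_edges T \<and> pt w (x0 - e) y0 \<in> \<tau>}"
  then have \<tau>: "\<tau> \<in> interior_edges T" "\<tau> \<in> edges T" "pt w (x0 - e) y0 \<in> \<tau>" using interior_edge_in_edges by auto
  have "x0 - e \<notin> grid T" using e by force
  then obtain a b where s: "a < x0 - e" "x0 - e < b" "\<tau> = seg w a b y0" using edge_through_generic \<tau> by metis
  then have ab: "a < b" by simp
  have "b \<in> grid T" using grid_edge \<tau>(2) s ab by auto
  then have "b \<ge> x0" using bspec[OF e(2), of b] s(2) by (cases "b \<ge> x0") auto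
  then have "pt w x0 y0 \<in> \<tau>" using s e by auto
  then have "pt w x0 y0 \<in> endpoints \<tau>" using vertex_on_edge_is_endpoint \<gamma> \<tau> by blast
  then have "edge_end \<tau> = pt w x0 y0" using s e(1) ab by (auto simp: endpoints_def edge_ends_seg)
  then show "\<tau> \<in> interior_edges T" "edge_end \<tau> = pt w x0 y0" "along w \<tau>" using \<tau> s ab by (auto simp: along_seg)
next
  fix \<tau> assume "\<tau> \<in> {\<tau>. (\<tau> \<in> interior_edges T \<and> edge_end \<tau> = pt w x0 y0) \<and> along w \<tau>}"
  then have \<tau>: "\<tau> \<in> interior_edges T" "\<tau> \<in> edges T" "edge_end \<tau> = pt w x0 y0" "along w \<tau>"
    using interior_edge_in_edges by auto
  obtain a b c where s: "a < b" "\<tau> = seg w a b c" using \<tau>(4) alongE by metis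
  then have eq: "b = x0" "c = y0" using \<tau>(3) by (auto simp: edge_ends_seg)
  have "a \<in> grid T" using grid_edge \<tau>(2) s by auto
  then have "a < x0 - e" using bspec[OF e(2), of a] s eq by (cases "a < x0 - e") auto
  then show "\<tau> \<in> interior_edges T" "pt w (x0 - e) y0 \<in> \<tau>" using \<tau>(1) s eq e by auto
qed

text \<open>The four quadrants at an interior vertex; some of these faces may coincide, for instance at a
  T-junction.\<close>
lemma vertex_star:
  assumes "pt False x0 y0 \<in> interior_vertices T"
  obtains e ne nw se sw where "e > 0"
    "\<forall>z\<in>grid T. \<bar>z - x0\<bar> \<le> e \<longrightarrow> z = x0" "\<forall>z\<in>grid T. \<bar>z - y0\<bar> \<le> e \<longrightarrow> z = y0"
    "{ne, nw, se, sw} \<subseteq> faces T"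
    "pt False (x0 + e) (y0 + e) \<in> ne" "pt False (x0 - e) (y0 + e) \<in> nw"
    "pt False (x0 + e) (y0 - e) \<in> se" "pt False (x0 - e) (y0 - e) \<in> sw"
    "\<And>x y. \<bar>x - x0\<bar> \<le> e \<Longrightarrow> \<bar>y - y0\<bar> \<le> e \<Longrightarrow> pt False x y \<in> interior \<Omega>"
proof -
  obtain d where d: "d > 0" "\<And>x' y'. \<bar>x' - x0\<bar> < d \<Longrightarrow> \<bar>y' - y0\<bar> < d \<Longrightarrow> pt False x' y' \<in> interior \<Omega>"
    using open_contains_box[of "interior \<Omega>" False x0 y0] assms unfolding interior_vertices_def by blast
  obtain d1 where d1: "d1 > 0" "\<And>z. z \<in> grid T \<Longrightarrow> \<bar>z - x0\<bar> \<le> d1 \<Longrightarrow> z = x0"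
    using finite_real_isolated[OF finite_grid] by metis
  obtain d2 where d2: "d2 > 0" "\<And>z. z \<in> grid T \<Longrightarrow> \<bar>z - y0\<bar> \<le> d2 \<Longrightarrow> z = y0"
    using finite_real_isolated[OF finite_grid] by metis
  define e where "e = min (d/2) (min d1 d2)"
  have e: "e > 0" "e < d" "e \<le> d1" "e \<le> d2" using d(1) d1(1) d2(1) by (auto simp: e_def)
  have i1: "\<forall>z\<in>grid T. \<bar>z - x0\<bar> \<le> e \<longrightarrow> z = x0" using d1(2) e by force
  have i2: "\<forall>z\<in>grid T. \<bar>z - y0\<bar> \<le> e \<longrightarrow> z = y0" using d2(2) e by force
  have box: "\<And>x y. \<bar>x - x0\<bar> \<le> e \<Longrightarrow> \<bar>y - y0\<bar> \<le> e \<Longrightarrow> pt False x y \<in> interior \<Omega>" using d(2) e by force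
  have n: "x0 + e \<notin> grid T" "x0 - e \<notin> grid T" "y0 + e \<notin> grid T" "y0 - e \<notin> grid T"
    using i1 i2 e by force+
  have "pt False (x0 + e) (y0 + e) \<in> \<Omega>" "pt False (x0 - e) (y0 + e) \<in> \<Omega>"
    "pt False (x0 + e) (y0 - e) \<in> \<Omega>" "pt False (x0 - e) (y0 - e) \<in> \<Omega>"
    by (rule subsetD[OF interior_subset], rule box; use e in simp)+
  then obtain ne nw se sw where "ne \<in> faces T" "pt False (x0 + e) (y0 + e) \<in> ne" "nw \<in> faces T" "pt False (x0 - e) (y0 + e) \<in> nw"
    "se \<in> faces T" "pt False (x0 + e) (y0 - e) \<in> se" "sw \<in> faces T" "pt False (x0 - e) (y0 - e) \<in> sw"
    using face_at_generic n by metis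
  then show ?thesis by (intro that[OF e(1) i1 i2 _ _ _ _ _ box]) auto
qed

lemma pt_True: "pt True x y = pt False y x"
  by (simp add: pt_def)

lemma sum_ascents_at_vertex:
  assumes \<gamma>: "pt False x0 y0 \<in> interior_vertices T"
  obtains e ne nw se sw where "e > 0" "ne \<in> faces T"
    "pt False (x0 + e) (y0 + e) \<in> ne" "pt False (x0 - e) (y0 + e) \<in> nw" "pt False (x0 + e) (y0 - e) \<in> se"
    "\<And>g :: _ \<Rightarrow> 'v::real_vector.
      (\<Sum>\<tau> | (\<tau> \<in> interior_edges T \<and> edge_start \<tau> = pt False x0 y0) \<and> along False \<tau>. ascent T g \<tau>) = g ne - g se"
    "\<And>g :: _ \<Rightarrow> 'v.
      (\<Sum>\<tau> | (\<tau> \<in> interior_edges T \<and> edge_end \<tau> = pt False x0 y0) \<and> along False \<tau>. ascent T g \<tau>) = g nw - g sw"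
    "\<And>g :: _ \<Rightarrow> 'v.
      (\<Sum>\<tau> | (\<tau> \<in> interior_edges T \<and> edge_start \<tau> = pt False x0 y0) \<and> along True \<tau>. ascent T g \<tau>) = g ne - g nw"
    "\<And>g :: _ \<Rightarrow> 'v.
      (\<Sum>\<tau> | (\<tau> \<in> interior_edges T \<and> edge_end \<tau> = pt False x0 y0) \<and> along True \<tau>. ascent T g \<tau>) = g se - g sw"
proof -
  obtain e ne nw se sw where e: "e > 0"
    and i1: "\<forall>z\<in>grid T. \<bar>z - x0\<bar> \<le> e \<longrightarrow> z = x0" and i2: "\<forall>z\<in>grid T. \<bar>z - y0\<bar> \<le> e \<longrightarrow> z = y0"
    and f: "{ne, nw, se, sw} \<subseteq> faces T"
    "pt False (x0 + e) (y0 + e) \<in> ne" "pt False (x0 - e) (y0 + e) \<in> nw"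
    "pt False (x0 + e) (y0 - e) \<in> se" "pt False (x0 - e) (y0 - e) \<in> sw"
    and box: "\<And>x y. \<bar>x - x0\<bar> \<le> e \<Longrightarrow> \<bar>y - y0\<bar> \<le> e \<Longrightarrow> pt False x y \<in> interior \<Omega>"
    by (rule vertex_star[OF \<gamma>]) blast
  have n: "x0 + e \<notin> grid T" "x0 - e \<notin> grid T" "y0 + e \<notin> grid T" "y0 - e \<notin> grid T"
    using i1 i2 e by force+
  have V: "pt False x0 y0 \<in> vertices T" "pt True y0 x0 \<in> vertices T" using \<gamma> by (auto simp: interior_vertices_def pt_True)
  have N1: "\<forall>z\<in>grid T. x0 - e \<le> z \<and> z \<le> x0 + e \<longrightarrow> z = x0" using i1 by (simp add: abs_le_iff)
  have N2: "\<forall>z\<in>grid T. y0 - e \<le> z \<and> z \<le> y0 + e \<longrightarrow> z = y0" using i2 by (simp add: abs_le_iff)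
  have t: "x0 - e < x0" "x0 < x0 + e" "y0 - e < y0" "y0 < y0 + e" using e by auto
  have F: "ne \<in> faces T" "nw \<in> faces T" "se \<in> faces T" "sw \<in> faces T" using f(1) by auto
  note f' = f(2-5)[folded pt_True]
  have b: "pt False (x0 + e) y0 \<in> interior \<Omega>" "pt False (x0 - e) y0 \<in> interior \<Omega>"
    "pt True (y0 + e) x0 \<in> interior \<Omega>" "pt True (y0 - e) x0 \<in> interior \<Omega>"
    using e by (auto simp: pt_True intro!: box)
  show ?thesis
  proof (rule that[OF e F(1) f(2,3,4)])
    fix g :: "(real \<times> real) set \<Rightarrow> 'v"
    show "(\<Sum>\<tau> | (\<tau> \<in> interior_edges T \<and> edge_start \<tau> = pt False x0 y0) \<and> along False \<tau>. ascent T g \<tau>) = g ne - g se"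
      using sum_ascent_through[OF n(1) t(3,4) N2 F(3) f(4) F(1) f(2) b(1), of g]
      unfolding edges_right_of_vertex[OF V(1) e i1] .
    show "(\<Sum>\<tau> | (\<tau> \<in> interior_edges T \<and> edge_end \<tau> = pt False x0 y0) \<and> along False \<tau>. ascent T g \<tau>) = g nw - g sw"
      using sum_ascent_through[OF n(2) t(3,4) N2 F(4) f(5) F(2) f(3) b(2), of g]
      unfolding edges_left_of_vertex[OF V(1) e i1] .
    show "(\<Sum>\<tau> | (\<tau> \<in> interior_edges T \<and> edge_start \<tau> = pt False x0 y0) \<and> along True \<tau>. ascent T g \<tau>) = g ne - g nw"
      using sum_ascent_through[OF n(3) t(1,2) N1 F(2) f'(2) F(1) f'(1) b(3), of g]
      unfolding edges_right_of_vertex[OF V(2) e i2] unfolding pt_True .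
    show "(\<Sum>\<tau> | (\<tau> \<in> interior_edges T \<and> edge_end \<tau> = pt False x0 y0) \<and> along True \<tau>. ascent T g \<tau>) = g se - g sw"
      using sum_ascent_through[OF n(4) t(1,2) N1 F(4) f'(4) F(3) f'(3) b(4), of g]
      unfolding edges_left_of_vertex[OF V(2) e i2] unfolding pt_True .
  qed
qed

text \<open>The four differences between adjacent quadrants add up to zero around the vertex.\<close>
lemma net_inflow_jump:
  fixes g :: "(real \<times> real) set \<Rightarrow> 'v::real_vector"
  assumes "\<gamma> \<in> interior_vertices T"
  shows "net_inflow (jump T g) \<gamma> = 0"
proof -
  obtain x0 y0 where \<gamma>: "\<gamma> = pt False x0 y0" by (metis pt_co)
  obtain ne nw se sw where s:
    "(\<Sum>\<tau> | (\<tau> \<in> interior_edges T \<and> edge_start \<tau> = \<gamma>) \<and> along False \<tau>. ascent T g \<tau>) = g ne - g se"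
    "(\<Sum>\<tau> | (\<tau> \<in> interior_edges T \<and> edge_end \<tau> = \<gamma>) \<and> along False \<tau>. ascent T g \<tau>) = g nw - g sw"
    "(\<Sum>\<tau> | (\<tau> \<in> interior_edges T \<and> edge_start \<tau> = \<gamma>) \<and> along True \<tau>. ascent T g \<tau>) = g ne - g nw"
    "(\<Sum>\<tau> | (\<tau> \<in> interior_edges T \<and> edge_end \<tau> = \<gamma>) \<and> along True \<tau>. ascent T g \<tau>) = g se - g sw"
    unfolding \<gamma> by (rule sum_ascents_at_vertex[OF assms[unfolded \<gamma>], where 'v = 'v]) blast
  have split: "(\<Sum>\<tau>\<in>A. jump T g \<tau>) = (\<Sum>\<tau> | \<tau> \<in> A \<and> along False \<tau>. ascent T g \<tau>) - (\<Sum>\<tau> | \<tau> \<in> A \<and> along True \<tau>. ascent T g \<tau>)"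
    if "A \<subseteq> edges T" for A
  proof -
    have "(\<Sum>\<tau> | \<tau> \<in> A \<and> along False \<tau>. jump T g \<tau>) = (\<Sum>\<tau> | \<tau> \<in> A \<and> along False \<tau>. ascent T g \<tau>)"
      using that edge_along_cases by (intro sum.cong) (auto simp: jump_def along_def)
    moreover have "(\<Sum>\<tau> | \<tau> \<in> A \<and> along True \<tau>. jump T g \<tau>) = - (\<Sum>\<tau> | \<tau> \<in> A \<and> along True \<tau>. ascent T g \<tau>)"
      unfolding sum_negf[symmetric] by (intro sum.cong) (auto simp: jump_def along_def)
    ultimately show ?thesis using sum_edges_by_direction[OF that, of "jump T g"] by simp
  qed
  have "{\<tau>. \<tau> \<in> interior_edges T \<and> edge_start \<tau> = \<gamma>} \<subseteq> edges T" "{\<tau>. \<tau> \<in> interior_edges T \<and> edge_end \<tau> = \<gamma>} \<subseteq> edges T"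
    using interior_edge_in_edges by auto
  from this[THEN split] show ?thesis unfolding net_inflow_def mem_Collect_eq using s by simp
qed

text \<open>Without an edge to the right and without an edge upwards, three quadrants at \<open>\<gamma>\<close> lie in one
  face.  Being a rectangle, this face contains \<open>\<gamma>\<close>, but \<open>\<gamma>\<close> lies on an edge.\<close>
lemma interior_vertex_starts_edge:
  assumes "\<gamma> \<in> interior_vertices T"
  shows "\<exists>\<tau>\<in>interior_edges T. edge_start \<tau> = \<gamma>"
proof (rule ccontr)
  assume none: "\<not> ?thesis"
  obtain x0 y0 where \<gamma>: "\<gamma> = pt False x0 y0" by (metis pt_co)
  obtain e ne nw se where e: "e > 0" and f: "ne \<in> faces T" "pt False (x0 + e) (y0 + e) \<in> ne"
      "pt False (x0 - e) (y0 + e) \<in> nw" "pt False (x0 + e) (y0 - e) \<in> se"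
    and right: "\<And>g :: _ \<Rightarrow> real.
      (\<Sum>\<tau> | (\<tau> \<in> interior_edges T \<and> edge_start \<tau> = \<gamma>) \<and> along False \<tau>. ascent T g \<tau>) = g ne - g se"
    and up: "\<And>g :: _ \<Rightarrow> real.
      (\<Sum>\<tau> | (\<tau> \<in> interior_edges T \<and> edge_start \<tau> = \<gamma>) \<and> along True \<tau>. ascent T g \<tau>) = g ne - g nw"
    unfolding \<gamma> by (rule sum_ascents_at_vertex[OF assms[unfolded \<gamma>], where 'v = real]) blast
  have empty: "{\<tau>. (\<tau> \<in> interior_edges T \<and> edge_start \<tau> = \<gamma>) \<and> along w \<tau>} = {}" for w using none by blast
  have eq: "g ne = g se" "g ne = g nw" for g :: "(real \<times> real) set \<Rightarrow> real"
    using right[of g, unfolded empty] up[of g, unfolded empty] by simp_all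
  \<comment> \<open>Test functions that separate the face \<open>ne\<close> from all others.\<close>
  have "se = ne" using eq(1)[of "\<lambda>\<sigma>. of_bool (\<sigma> = ne)"] by (simp split: if_splits)
  moreover have "nw = ne" using eq(2)[of "\<lambda>\<sigma>. of_bool (\<sigma> = ne)"] by (simp split: if_splits)
  ultimately have "pt False (x0 + e) (y0 - e) \<in> ne" "pt False (x0 - e) (y0 + e) \<in> ne" using f by auto
  moreover obtain a b c d where "ne = rect False a b c d" using face_rectE[OF f(1)] by metis
  ultimately have "\<gamma> \<in> ne" using f(2) e unfolding \<gamma> by auto
  moreover have "\<gamma> \<in> vertices T" using assms by (simp add: interior_vertices_def)
  then obtain a b c where "seg False a b c \<in> edges T" "\<gamma> \<in> seg False a b c" by (rule vertex_edge)
  ultimately show False using edge_disjoint_face f(1) by blast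
qed

section \<open>The dimension formula\<close>

lemma lookup_boundary:
  "Poly_Mapping.lookup (boundary T c) \<gamma> =
    (if \<gamma> \<in> interior_vertices T then net_inflow (Poly_Mapping.lookup c) \<gamma> else 0)"
proof -
  have *: "Poly_Mapping.lookup (vertex_chain T \<delta> p) \<gamma> = (if \<delta> = \<gamma> \<and> \<gamma> \<in> interior_vertices T then p else 0)" for \<delta> p
    by (auto simp: vertex_chain_def lookup_single when_def)
  have sums: "(\<Sum>\<tau>\<in>interior_edges T. if f \<tau> = \<gamma> \<and> \<gamma> \<in> interior_vertices T then g \<tau> else 0) =
      (if \<gamma> \<in> interior_vertices T then \<Sum>\<tau> | \<tau> \<in> interior_edges T \<and> f \<tau> = \<gamma>. g \<tau> else 0)" for f and g :: "_ \<Rightarrow> poly2"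
    using finite_interior_edges by (auto simp: sum.inter_filter)
  show ?thesis
    unfolding boundary_def lookup_sum lookup_minus * sum_subtractf sums net_inflow_def by simp
qed

lemma linear_boundary: "linear (boundary T)"
  by (rule linearI)
     (auto intro!: poly_mapping_eqI simp: lookup_boundary lookup_add net_inflow_def sum.distrib scaleR_sum_right
        algebra_simps)

lemma boundary_single:
  "\<tau> \<in> interior_edges T \<Longrightarrow>
    boundary T (Poly_Mapping.single \<tau> p) = vertex_chain T (edge_end \<tau>) p - vertex_chain T (edge_start \<tau>) p"
proof -
  assume \<tau>: "\<tau> \<in> interior_edges T"
  have z: "vertex_chain T \<gamma> 0 = 0" for \<gamma> by (simp add: vertex_chain_def)
  have "boundary T (Poly_Mapping.single \<tau> p) = (\<Sum>\<tau>'\<in>interior_edges T.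
     if \<tau>' = \<tau> then vertex_chain T (edge_end \<tau>) p - vertex_chain T (edge_start \<tau>) p else 0)"
    unfolding boundary_def by (intro sum.cong) (auto simp: lookup_single when_def z)
  then show ?thesis using \<tau> finite_interior_edges by simp
qed

lemma linear_vertex_chain: "linear (vertex_chain T \<gamma>)"
  using linear_single[of \<gamma>]
  by (cases "\<gamma> \<in> interior_vertices T") (simp_all add: vertex_chain_def[abs_def] linear_zero)

text \<open>The map from \<open>2\<close>-chains to \<open>1\<close>-chains, that is, the cellular boundary for suitable orientations of the faces.\<close>
definition jump_chain :: "((real \<times> real) set, poly2) poly_mapping \<Rightarrow> ((real \<times> real) set, poly2) poly_mapping" where
  "jump_chain f = (\<Sum>\<tau>\<in>interior_edges T. Poly_Mapping.single \<tau> (jump T (Poly_Mapping.lookup f) \<tau>))"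

lemma lookup_jump_chain:
  "Poly_Mapping.lookup (jump_chain f) \<tau> = (if \<tau> \<in> interior_edges T then jump T (Poly_Mapping.lookup f) \<tau> else 0)"
  using finite_interior_edges by (auto simp: jump_chain_def lookup_sum lookup_single when_def)

lemma linear_jump_chain: "linear jump_chain"
  by (rule linearI)
     (auto intro!: poly_mapping_eqI simp: lookup_jump_chain lookup_add jump_def ascent_def algebra_simps)

lemma boundary_jump_chain: "boundary T (jump_chain f) = 0"
proof (rule poly_mapping_eqI)
  fix \<gamma>
  have "net_inflow (Poly_Mapping.lookup (jump_chain f)) \<gamma> = net_inflow (jump T (Poly_Mapping.lookup f)) \<gamma>"
    unfolding net_inflow_def by (intro arg_cong2[of _ _ _ _ "(-)"] sum.cong) (auto simp: lookup_jump_chain)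
  then show "Poly_Mapping.lookup (boundary T (jump_chain f)) \<gamma> = Poly_Mapping.lookup 0 \<gamma>"
    by (simp add: lookup_boundary net_inflow_jump)
qed

lemma finite_interior_vertices: "finite (interior_vertices T)"
  using finite_vertices by (simp add: interior_vertices_def)

lemma interior_edge_ends:
  "\<tau> \<in> interior_edges T \<Longrightarrow> edge_start \<tau> \<in> \<tau>" "\<tau> \<in> interior_edges T \<Longrightarrow> edge_end \<tau> \<in> \<tau>"
proof -
  assume "\<tau> \<in> interior_edges T"
  then obtain w a b c where "a < b" "\<tau> = seg w a b c" using edge_segE interior_edge_in_edges by metis
  then show "edge_start \<tau> \<in> \<tau>" "edge_end \<tau> \<in> \<tau>" by (auto simp: edge_ends_seg)
qed

lemma upper_lower_in_faces:
  assumes "\<tau> \<in> interior_edges T"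
  shows "lower_face T \<tau> \<in> faces T" "upper_face T \<tau> \<in> faces T"
    "{\<sigma> \<in> faces T. \<tau> \<subseteq> closure \<sigma>} = {lower_face T \<tau>, upper_face T \<tau>}"
proof -
  obtain w a b c where \<tau>: "a < b" "\<tau> = seg w a b c" using edge_segE interior_edge_in_edges assms by metis
  obtain a1 b1 c1 a2 b2 d2 where
    "lower_face T \<tau> = rect w a1 b1 c1 c" "upper_face T \<tau> = rect w a2 b2 c d2"
    "rect w a1 b1 c1 c \<in> faces T" "rect w a2 b2 c d2 \<in> faces T"
    "{\<sigma> \<in> faces T. \<tau> \<subseteq> closure \<sigma>} = {rect w a1 b1 c1 c, rect w a2 b2 c d2}"
    unfolding \<tau>(2) by (rule lower_upper_face[OF assms[unfolded \<tau>(2)] \<tau>(1)]) blast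
  then show "lower_face T \<tau> \<in> faces T" "upper_face T \<tau> \<in> faces T"
    "{\<sigma> \<in> faces T. \<tau> \<subseteq> closure \<sigma>} = {lower_face T \<tau>, upper_face T \<tau>}" by simp_all
qed

lemma spline_space_eq:
  "spline_space T m m' r = {f \<in> chains (faces T) (\<lambda>_. polys m m'). jump_chain f \<in> I_1 T m m' r}"
proof -
  have "(\<forall>\<tau>\<in>interior_edges T. \<forall>\<sigma>\<in>faces T. \<forall>\<sigma>'\<in>faces T. \<tau> \<subseteq> closure \<sigma> \<inter> closure \<sigma>' \<longrightarrow>
          edge_poly \<tau> ^ nat (r \<tau> + 1) dvd Poly_Mapping.lookup f \<sigma> - Poly_Mapping.lookup f \<sigma>')
      \<longleftrightarrow> jump_chain f \<in> I_1 T m m' r" if f: "f \<in> chains (faces T) (\<lambda>_. polys m m')" for f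
  proof -
    have "(\<forall>\<sigma>\<in>faces T. \<forall>\<sigma>'\<in>faces T. \<tau> \<subseteq> closure \<sigma> \<inter> closure \<sigma>' \<longrightarrow>
          edge_poly \<tau> ^ nat (r \<tau> + 1) dvd Poly_Mapping.lookup f \<sigma> - Poly_Mapping.lookup f \<sigma>')
      \<longleftrightarrow> jump T (Poly_Mapping.lookup f) \<tau> \<in> edge_ideal m m' r \<tau>" if \<tau>: "\<tau> \<in> interior_edges T" for \<tau>
    proof -
      note F = upper_lower_in_faces[OF \<tau>]
      have "jump T (Poly_Mapping.lookup f) \<tau> \<in> polys m m'"
        unfolding jump_def ascent_def using f F subspace_polys[of m m']
        by (auto simp: mem_chains_iff intro!: subspace_diff subspace_neg split: if_splits)
      then have "jump T (Poly_Mapping.lookup f) \<tau> \<in> edge_ideal m m' r \<tau> \<longleftrightarrow>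
         edge_poly \<tau> ^ nat (r \<tau> + 1) dvd Poly_Mapping.lookup f (upper_face T \<tau>) - Poly_Mapping.lookup f (lower_face T \<tau>)"
        by (cases "vertical \<tau>") (simp_all add: edge_ideal_def jump_def ascent_def del: minus_diff_eq)
      also have "\<dots> \<longleftrightarrow> (\<forall>\<sigma>\<in>{lower_face T \<tau>, upper_face T \<tau>}. \<forall>\<sigma>'\<in>{lower_face T \<tau>, upper_face T \<tau>}.
          edge_poly \<tau> ^ nat (r \<tau> + 1) dvd Poly_Mapping.lookup f \<sigma> - Poly_Mapping.lookup f \<sigma>')"
        using dvd_minus_iff[of "edge_poly \<tau> ^ nat (r \<tau> + 1)"
          "Poly_Mapping.lookup f (upper_face T \<tau>) - Poly_Mapping.lookup f (lower_face T \<tau>)"] by auto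
      also have "\<dots> \<longleftrightarrow> (\<forall>\<sigma>\<in>faces T. \<forall>\<sigma>'\<in>faces T. \<tau> \<subseteq> closure \<sigma> \<inter> closure \<sigma>' \<longrightarrow>
          edge_poly \<tau> ^ nat (r \<tau> + 1) dvd Poly_Mapping.lookup f \<sigma> - Poly_Mapping.lookup f \<sigma>')"
        unfolding F(3)[symmetric] by auto
      finally show ?thesis by blast
    qed
    then show ?thesis by (auto simp: I_1_def mem_chains_iff lookup_jump_chain)
  qed
  then show ?thesis unfolding spline_space_def by blast
qed

lemma subspace_I_1: "subspace (I_1 T m m' r)" and subspace_I_0: "subspace (I_0 T m m' r)"
  unfolding I_1_def I_0_def vertex_ideal_def by (intro subspace_chains subspace_edge_ideal subspace_span)+

lemma I_1_subset: "I_1 T m m' r \<subseteq> chains (interior_edges T) (\<lambda>_. polys m m')"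
  unfolding I_1_def by (rule chains_mono) (auto simp: edge_ideal_def)

lemma I_0_subset: "I_0 T m m' r \<subseteq> chains (interior_vertices T) (\<lambda>_. polys m m')"
  unfolding I_0_def by (rule chains_mono) (rule vertex_ideal_subset_polys)

lemma boundary_I_1: "c \<in> I_1 T m m' r \<Longrightarrow> boundary T c \<in> I_0 T m m' r"
proof -
  assume c: "c \<in> I_1 T m m' r"
  have "net_inflow (Poly_Mapping.lookup c) \<gamma> \<in> vertex_ideal T m m' r \<gamma>" for \<gamma>
    unfolding net_inflow_def vertex_ideal_def
    by (intro span_diff span_sum span_base)
       (use c interior_edge_ends in \<open>force simp: I_1_def mem_chains_iff\<close>)+
  then show ?thesis by (simp add: I_0_def mem_chains_iff lookup_boundary)
qed

lemma H_0_zero_iff: "H_0_zero T m m' r \<longleftrightarrow> I_0 T m m' r \<subseteq> boundary T ` I_1 T m m' r"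
proof -
  let ?Z = "boundary T ` I_1 T m m' r"
  have sub: "subspace ?Z" using linear_subspace_image[OF linear_boundary subspace_I_1] .
  have *: "(+) v ` ?Z = ?Z \<longleftrightarrow> v \<in> ?Z" for v
    using coset_eq_iff[OF sub, of v 0] by simp
  show ?thesis
  proof
    assume "H_0_zero T m m' r"
    then have "(+) v ` ?Z = ?Z" if "v \<in> I_0 T m m' r" for v
      using that unfolding H_0_zero_def H_0_def quotient_space_def by blast
    then show "I_0 T m m' r \<subseteq> ?Z" using * by (meson subsetI)
  next
    assume "I_0 T m m' r \<subseteq> ?Z"
    then have "(\<lambda>v. (+) v ` ?Z) ` I_0 T m m' r = (\<lambda>v. ?Z) ` I_0 T m m' r"
      using * by (intro image_cong refl) (simp add: subsetD)
    moreover have "I_0 T m m' r \<noteq> {}" using subspace_0[OF subspace_I_0] by (metis empty_iff)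
    ultimately show "H_0_zero T m m' r" unfolding H_0_zero_def H_0_def quotient_space_def
      by (simp only: image_constant_conv if_False)
  qed
qed

text \<open>The relative homology of \<open>(\<Omega>, \<partial>\<Omega>)\<close> in degree \<open>0\<close> vanishes.  An edge that starts at \<open>\<gamma>\<close>
  replaces \<open>[\<gamma>] p\<close> by \<open>[\<gamma>'] p\<close>, where the sum of the coordinates of \<open>\<gamma>'\<close> is larger;
  after finitely many steps the boundary is reached, where the chain is zero.\<close>
lemma boundary_surj:
  assumes "c \<in> chains (interior_vertices T) (\<lambda>_. polys m m')"
  shows "c \<in> boundary T ` chains (interior_edges T) (\<lambda>_. polys m m')"
proof -
  let ?Z = "boundary T ` chains (interior_edges T) (\<lambda>_. polys m m')"
  have sub: "subspace ?Z"
    by (intro linear_subspace_image[OF linear_boundary] subspace_chains subspace_polys)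
  have vc: "vertex_chain T \<gamma> p \<in> ?Z" if p: "p \<in> polys m m'" for \<gamma> p
  proof (induction "card {\<delta> \<in> interior_vertices T. fst \<gamma> + snd \<gamma> < fst \<delta> + snd \<delta>}" arbitrary: \<gamma> rule: less_induct)
    case less
    show ?case
    proof (cases "\<gamma> \<in> interior_vertices T")
      case False then show ?thesis using sub by (simp add: vertex_chain_def subspace_0)
    next
      case True
      then obtain \<tau> where \<tau>: "\<tau> \<in> interior_edges T" "edge_start \<tau> = \<gamma>" using interior_vertex_starts_edge by blast
      obtain w a b c where s: "a < b" "\<tau> = seg w a b c" using edge_segE interior_edge_in_edges \<tau> by metis
      have lt: "fst \<gamma> + snd \<gamma> < fst (edge_end \<tau>) + snd (edge_end \<tau>)"
        unfolding \<tau>(2)[symmetric] s(2) using s(1) by (auto simp: edge_ends_seg pt_def)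
      have "vertex_chain T (edge_end \<tau>) p \<in> ?Z"
      proof (cases "edge_end \<tau> \<in> interior_vertices T")
        case False then show ?thesis using sub by (simp add: vertex_chain_def subspace_0)
      next
        case True
        show ?thesis
        proof (rule less.hyps, rule psubset_card_mono)
          show "finite {\<delta> \<in> interior_vertices T. fst \<gamma> + snd \<gamma> < fst \<delta> + snd \<delta>}" using finite_interior_vertices by simp
          show "{\<delta> \<in> interior_vertices T. fst (edge_end \<tau>) + snd (edge_end \<tau>) < fst \<delta> + snd \<delta>}
              \<subset> {\<delta> \<in> interior_vertices T. fst \<gamma> + snd \<gamma> < fst \<delta> + snd \<delta>}"
            using lt True by force
        qed
      qed
      moreover have "boundary T (Poly_Mapping.single \<tau> p) \<in> ?Z"
        by (intro imageI single_in_chains \<tau> p subspace_polys)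
      ultimately have "vertex_chain T (edge_end \<tau>) p - boundary T (Poly_Mapping.single \<tau> p) \<in> ?Z"
        using sub subspace_diff by blast
      then show ?thesis using boundary_single[OF \<tau>(1), of p] \<tau>(2) by simp
    qed
  qed
  have "(\<Sum>\<gamma>\<in>interior_vertices T. Poly_Mapping.single \<gamma> (Poly_Mapping.lookup c \<gamma>)) \<in> ?Z"
  proof (rule subspace_sum[OF sub])
    fix \<gamma> assume \<gamma>: "\<gamma> \<in> interior_vertices T"
    then have "Poly_Mapping.lookup c \<gamma> \<in> polys m m'" using assms[unfolded mem_chains_iff, rule_format, of \<gamma>] by simp
    then show "Poly_Mapping.single \<gamma> (Poly_Mapping.lookup c \<gamma>) \<in> ?Z" using vc[of _ \<gamma>] \<gamma> by (simp add: vertex_chain_def)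
  qed
  then show ?thesis using chain_eq_sum_single[OF finite_interior_vertices assms] by simp
qed

lemma jump_chain_in_chains:
  assumes "f \<in> chains (faces T) (\<lambda>_. polys m m')"
  shows "jump_chain f \<in> chains (interior_edges T) (\<lambda>_. polys m m')"
  using assms upper_lower_in_faces subspace_polys[of m m']
  by (auto simp: mem_chains_iff lookup_jump_chain jump_def ascent_def intro!: subspace_diff subspace_neg)

lemma relative_cycle_is_jump_chain:
  assumes sc: "simply_connected \<Omega>"
    and c: "c \<in> chains (interior_edges T) (\<lambda>_. polys m m')" "boundary T c = 0"
  obtains f where "f \<in> chains (faces T) (\<lambda>_. polys m m')" "jump_chain f = c"
proof -
  have "net_inflow (Poly_Mapping.lookup c) \<gamma> = 0" if "\<gamma> \<in> interior_vertices T" for \<gamma>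
    using lookup_boundary[of c \<gamma>] that c(2) by simp
  moreover have "Poly_Mapping.lookup c \<tau> \<in> polys m m'" if "\<tau> \<in> interior_edges T" for \<tau>
    using c(1) that by (auto simp: mem_chains_iff)
  ultimately obtain g where g: "\<And>\<sigma>. g \<sigma> \<in> polys m m'" "\<And>\<tau>. \<tau> \<in> interior_edges T \<Longrightarrow> jump T g \<tau> = Poly_Mapping.lookup c \<tau>"
    using cycle_is_jump[OF sc subspace_polys[of m m'], of "Poly_Mapping.lookup c"] by blast
  define f where "f = (\<Sum>\<sigma>\<in>faces T. Poly_Mapping.single \<sigma> (g \<sigma>))"
  have f: "Poly_Mapping.lookup f \<sigma> = (if \<sigma> \<in> faces T then g \<sigma> else 0)" for \<sigma>
    using finite_faces by (auto simp: f_def lookup_sum lookup_single when_def)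
  show ?thesis
  proof (rule that)
    show "f \<in> chains (faces T) (\<lambda>_. polys m m')" using f g by (simp add: mem_chains_iff)
    show "jump_chain f = c"
    proof (rule poly_mapping_eqI)
      fix \<tau>
      show "Poly_Mapping.lookup (jump_chain f) \<tau> = Poly_Mapping.lookup c \<tau>"
      proof (cases "\<tau> \<in> interior_edges T")
        case True
        then have "jump T (Poly_Mapping.lookup f) \<tau> = jump T g \<tau>"
          using upper_lower_in_faces[OF True] by (simp add: jump_def ascent_def f)
        then show ?thesis using g True by (simp add: lookup_jump_chain)
      next
        case False then show ?thesis using c(1) by (simp add: lookup_jump_chain mem_chains_iff)
      qed
    qed
  qed
qed

text \<open>With \<open>N\<close> the \<open>1\<close>-chains whose boundary lies in \<open>I\<^sub>0\<close>, exactness says that \<open>N = im jump + I\<^sub>1\<close> and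
  \<open>C\<^sub>0 = im \<partial> + I\<^sub>0\<close>.  Eliminating \<open>dim N\<close> from the two resulting equations gives the Euler characteristic.\<close>
theorem dim_spline_space:
  assumes sc: "simply_connected \<Omega>" and H: "H_0_zero T m m' r"
  shows "int (dim (spline_space T m m' r)) = euler_Q T m m' r"
proof -
  let ?C2 = "chains (faces T) (\<lambda>_. polys m m')" and ?C1 = "chains (interior_edges T) (\<lambda>_. polys m m')"
    and ?C0 = "chains (interior_vertices T) (\<lambda>_. polys m m')" and ?I1 = "I_1 T m m' r" and ?I0 = "I_0 T m m' r"
  have fin: "fin_subspace ?C2" "fin_subspace ?C1" "fin_subspace ?C0"
    by (intro fin_subspace_chains_polys finite_faces finite_interior_edges finite_interior_vertices)+
  have finI1: "fin_subspace ?I1" using fin_subspace_subset[OF fin(2) subspace_I_1 I_1_subset] .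
  have finI0: "fin_subspace ?I0" using fin_subspace_subset[OF fin(3) subspace_I_0 I_0_subset] .
  have sC1: "subspace ?C1" and sC0: "subspace ?C0" using fin by (auto simp: fin_subspace_def)
  interpret B: linear "boundary T" by (rule linear_boundary)
  let ?N = "{c \<in> ?C1. boundary T c \<in> ?I0}"
  have N: "?N = {jump_chain f + i | f i. f \<in> ?C2 \<and> i \<in> ?I1}"
  proof (intro equalityI subsetI)
    fix c assume "c \<in> ?N"
    then have c: "c \<in> ?C1" "boundary T c \<in> ?I0" by auto
    then obtain i where i: "i \<in> ?I1" "boundary T c = boundary T i" using H by (auto simp: H_0_zero_iff)
    then have "c - i \<in> ?C1" using c I_1_subset sC1 by (blast intro: subspace_diff)
    moreover have "boundary T (c - i) = 0" using i by (simp add: B.diff)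
    ultimately obtain f where "f \<in> ?C2" "jump_chain f = c - i" using relative_cycle_is_jump_chain[OF sc] by metis
    then have "c = jump_chain f + i" by simp
    then show "c \<in> {jump_chain f + i | f i. f \<in> ?C2 \<and> i \<in> ?I1}" using \<open>f \<in> ?C2\<close> i by blast
  next
    fix c assume "c \<in> {jump_chain f + i | f i. f \<in> ?C2 \<and> i \<in> ?I1}"
    then obtain f i where c: "c = jump_chain f + i" "f \<in> ?C2" "i \<in> ?I1" by blast
    have "c \<in> ?C1" unfolding c(1) using c jump_chain_in_chains I_1_subset sC1 by (blast intro: subspace_add)
    moreover have "boundary T c \<in> ?I0" unfolding c(1) using boundary_I_1 c by (simp add: B.add boundary_jump_chain)
    ultimately show "c \<in> ?N" by blast
  qed
  have C0: "?C0 = {boundary T c + i | c i. c \<in> ?C1 \<and> i \<in> ?I0}"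
  proof (intro equalityI subsetI)
    fix x assume "x \<in> ?C0"
    then obtain c where "c \<in> ?C1" "x = boundary T c" using boundary_surj by blast
    then have "x = boundary T c + 0" by simp
    then show "x \<in> {boundary T c + i | c i. c \<in> ?C1 \<and> i \<in> ?I0}" using \<open>c \<in> ?C1\<close> subspace_0[OF subspace_I_0] by blast
  next
    fix x assume "x \<in> {boundary T c + i | c i. c \<in> ?C1 \<and> i \<in> ?I0}"
    then obtain c i where x: "x = boundary T c + i" "c \<in> ?C1" "i \<in> ?I0" by blast
    have "boundary T c \<in> ?C0" using x(2) subspace_polys[of m m']
      by (auto simp: mem_chains_iff lookup_boundary net_inflow_def intro!: subspace_diff subspace_sum split: if_splits)
    then show "x \<in> ?C0" unfolding x(1) using x(3) I_0_subset sC0 by (blast intro: subspace_add)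
  qed
  have "dim (spline_space T m m' r) + dim ?N = dim ?C2 + dim ?I1"
    unfolding spline_space_eq by (rule dim_preimage_add_dim_sum[OF linear_jump_chain fin(1) finI1 N])
  moreover have "dim ?N + dim ?C0 = dim ?C1 + dim ?I0"
    by (rule dim_preimage_add_dim_sum[OF linear_boundary fin(2) finI0 C0])
  ultimately show ?thesis
    unfolding euler_Q_def quotient_dim_eq[OF fin(2) subspace_I_1 I_1_subset] quotient_dim_eq[OF fin(3) subspace_I_0 I_0_subset]
    by linarith
qed

section \<open>Lowering the smoothness along a segment\<close>

text \<open>The edges whose ends satisfy \<open>P\<close> and those whose ends do not have disjoint closed unions, because two
  distinct edges meet in a common endpoint only.\<close>
lemma segment_vertices_connected:
  assumes A: "A \<subseteq> edges T" and con: "connected (\<Union>A)"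
    and step: "\<And>\<tau>. \<tau> \<in> A \<Longrightarrow> P (edge_start \<tau>) \<longleftrightarrow> P (edge_end \<tau>)"
    and \<gamma>: "\<gamma> \<in> segment_vertices A" "P \<gamma>" "\<gamma>' \<in> segment_vertices A"
  shows "P \<gamma>'"
proof (rule ccontr)
  assume nP: "\<not> P \<gamma>'"
  have ends: "P \<delta> \<longleftrightarrow> P (edge_start \<tau>)" if "\<tau> \<in> A" "\<delta> \<in> endpoints \<tau>" for \<tau> \<delta>
    using that step by (auto simp: endpoints_def)
  define A1 where "A1 = {\<tau> \<in> A. P (edge_start \<tau>)}"
  define A2 where "A2 = {\<tau> \<in> A. \<not> P (edge_start \<tau>)}"
  have closed: "closed (\<Union>B)" if "B \<subseteq> A" for B
  proof (rule closed_Union)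
    show "finite B" using that A finite_edges by (meson finite_subset)
    show "\<forall>\<tau>\<in>B. closed \<tau>"
    proof
      fix \<tau> assume "\<tau> \<in> B"
      then have "\<tau> \<in> edges T" using that A by blast
      then obtain w a b c where "\<tau> = seg w a b c" using edge_segE by metis
      then show "closed \<tau>" by (auto simp: seg_def closed_Times)
    qed
  qed
  have disj: "\<Union>A1 \<inter> \<Union>A2 = {}"
  proof (rule ccontr)
    assume "\<Union>A1 \<inter> \<Union>A2 \<noteq> {}"
    then obtain p \<tau>1 \<tau>2 where p: "\<tau>1 \<in> A1" "\<tau>2 \<in> A2" "p \<in> \<tau>1" "p \<in> \<tau>2" by auto
    then have e: "\<tau>1 \<in> edges T" "\<tau>2 \<in> edges T" "\<tau>1 \<in> A" "\<tau>2 \<in> A" using A by (auto simp: A1_def A2_def)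
    have "\<tau>1 \<noteq> \<tau>2" using p by (auto simp: A1_def A2_def)
    note e = e this
    then have "p \<in> vertices T" using edges_meet(1) p by blast
    then have "p \<in> endpoints \<tau>1" "p \<in> endpoints \<tau>2" using vertex_on_edge_is_endpoint e p by blast+
    then show False using ends[of \<tau>1 p] ends[of \<tau>2 p] e(3,4) p(1,2) by (simp add: A1_def A2_def)
  qed
  have nonempty: "\<Union>B \<inter> \<Union>A \<noteq> {}" if "\<tau> \<in> B" "B \<subseteq> A" for \<tau> B
  proof -
    have "\<tau> \<in> edges T" using that A by blast
    then obtain w a b c where "a < b" "\<tau> = seg w a b c" using edge_segE by metis
    then have "pt w a c \<in> \<tau>" by simp
    then show ?thesis using that by blast
  qed
  have sub: "A1 \<subseteq> A" "A2 \<subseteq> A" by (auto simp: A1_def A2_def)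
  obtain \<tau>1 \<tau>2 where "\<tau>1 \<in> A" "\<gamma> \<in> endpoints \<tau>1" "\<tau>2 \<in> A" "\<gamma>' \<in> endpoints \<tau>2"
    using \<gamma> by (auto simp: segment_vertices_def)
  then have "\<tau>1 \<in> A1" "\<tau>2 \<in> A2" using ends \<gamma>(2) nP by (simp_all add: A1_def A2_def)
  then have "\<Union>A1 \<inter> \<Union>A \<noteq> {}" "\<Union>A2 \<inter> \<Union>A \<noteq> {}" using nonempty sub by metis+
  moreover have "\<Union>A \<inter> \<Union>A1 \<inter> \<Union>A2 = {}" "\<Union>A \<subseteq> \<Union>A1 \<union> \<Union>A2" using disj by (auto simp: A1_def A2_def)
  ultimately show False using connected_closedD[OF con _ _ closed[OF sub(1)] closed[OF sub(2)]] by blast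
qed

text \<open>For \<open>p\<close> in the common ideal \<open>J\<close> of the lowered edges, the classes of \<open>[\<gamma>] p\<close> agree for
  all vertices \<open>\<gamma>\<close> of \<open>A\<close> (\<open>slide\<close>).  They are zero (\<open>vanish\<close>) since the old ideals at one neighbouring
  edge, or at several transversal edges together, are large enough.\<close>
theorem H_0_zero_lower_segment:
  assumes sd: "smoothness_distribution T r" and H: "H_0_zero T m m' r"
    and A: "A \<subseteq> interior_edges T" "\<And>\<tau>. \<tau> \<in> A \<Longrightarrow> along w \<tau>" "A \<noteq> {}" "connected (\<Union>A)"
    and r0: "- 1 \<le> r0" "\<And>\<tau>. \<tau> \<in> A \<Longrightarrow> r0 \<le> r \<tau>"
    and s: "s = (\<lambda>\<tau>. if \<tau> \<in> A then r0 else r \<tau>)"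
    and cond: "(\<exists>B. B \<subseteq> interior_edges T \<and> (\<forall>\<tau>\<in>B. along w \<tau>) \<and> connected (\<Union>B) \<and> A \<subset> B \<and> (\<forall>\<tau>\<in>B. s \<tau> \<le> r0)) \<or>
      int (bidegree m m' w) + 1 \<le> (\<Sum>\<gamma>\<in>segment_vertices A.
         max (int (bidegree m m' w) - Min (r ` {\<tau> \<in> edges T. along (\<not> w) \<tau> \<and> \<gamma> \<in> \<tau>})) 0)"
  shows "H_0_zero T m m' s"
proof -
  let ?Z = "boundary T ` I_1 T m m' s"
  let ?vc = "vertex_chain T"
  have sZ: "subspace ?Z" using linear_subspace_image[OF linear_boundary subspace_I_1] .
  have AE: "A \<subseteq> edges T" using A(1) interior_edge_in_edges by blast
  have SV: "segment_vertices A \<subseteq> vertices T" using AE by (auto simp: segment_vertices_def vertices_def)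
  have "s \<tau> \<le> r \<tau>" for \<tau> using s r0 by auto
  then have mono: "edge_ideal m m' r \<tau> \<subseteq> edge_ideal m m' s \<tau>" for \<tau> by (rule edge_ideal_antimono)
  have along_edge: "?vc (edge_start \<tau>) p \<in> ?Z \<longleftrightarrow> ?vc (edge_end \<tau>) p \<in> ?Z"
    if "\<tau> \<in> interior_edges T" "p \<in> edge_ideal m m' s \<tau>" for \<tau> p
  proof -
    have "Poly_Mapping.single \<tau> p \<in> I_1 T m m' s"
      unfolding I_1_def by (intro single_in_chains that subspace_edge_ideal)
    then have d: "?vc (edge_end \<tau>) p - ?vc (edge_start \<tau>) p \<in> ?Z"
      unfolding boundary_single[OF that(1), symmetric] by (rule imageI)
    show ?thesis
    proof
      assume "?vc (edge_start \<tau>) p \<in> ?Z"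
      then have "(?vc (edge_end \<tau>) p - ?vc (edge_start \<tau>) p) + ?vc (edge_start \<tau>) p \<in> ?Z" using d sZ subspace_add by blast
      then show "?vc (edge_end \<tau>) p \<in> ?Z" by simp
    next
      assume "?vc (edge_end \<tau>) p \<in> ?Z"
      then have "?vc (edge_end \<tau>) p - (?vc (edge_end \<tau>) p - ?vc (edge_start \<tau>) p) \<in> ?Z" using d sZ subspace_diff by blast
      then show "?vc (edge_start \<tau>) p \<in> ?Z" by simp
    qed
  qed
  \<comment> \<open>What lies in an old ideal is a boundary because \<open>H\<^sub>0\<close> vanishes for \<open>r\<close>.\<close>
  have old: "?vc \<gamma> p \<in> ?Z" if "\<tau> \<in> interior_edges T" "\<gamma> \<in> \<tau>" "p \<in> edge_ideal m m' r \<tau>" for \<tau> \<gamma> p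
  proof (cases "\<gamma> \<in> interior_vertices T")
    case True
    have "p \<in> vertex_ideal T m m' r \<gamma>" unfolding vertex_ideal_def using that by (intro span_base) auto
    then have "Poly_Mapping.single \<gamma> p \<in> I_0 T m m' r"
      unfolding I_0_def using True by (intro single_in_chains) (auto simp: vertex_ideal_def)
    then have "Poly_Mapping.single \<gamma> p \<in> boundary T ` I_1 T m m' r" using H H_0_zero_iff by blast
    moreover have "I_1 T m m' r \<subseteq> I_1 T m m' s" unfolding I_1_def by (intro chains_mono mono)
    ultimately show ?thesis using True by (auto simp: vertex_chain_def)
  next
    case False then show ?thesis using sZ by (simp add: vertex_chain_def subspace_0)
  qed
  obtain \<tau>0 where "\<tau>0 \<in> A" using A(3) by blast
  then obtain a0 b0 c where \<tau>0: "a0 < b0" "\<tau>0 = seg w a0 b0 c" using alongE[OF A(2)[OF \<open>\<tau>0 \<in> A\<close>]] by blast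
  \<comment> \<open>All edges of \<open>A\<close> lie on one line, and therefore have the same ideal for \<open>s\<close>.\<close>
  have level: "co (\<not> w) \<gamma> = c" if "\<gamma> \<in> segment_vertices A" for \<gamma>
  proof (rule segment_vertices_connected[OF AE A(4), of "\<lambda>\<gamma>. co (\<not> w) \<gamma> = c", OF _ _ _ that])
    fix \<tau> assume "\<tau> \<in> A"
    then obtain a b c' where "a < b" "\<tau> = seg w a b c'" using alongE[OF A(2)] by blast
    then show "co (\<not> w) (edge_start \<tau>) = c \<longleftrightarrow> co (\<not> w) (edge_end \<tau>) = c" by (simp add: edge_ends_seg)
  next
    show "edge_start \<tau>0 \<in> segment_vertices A" using \<open>\<tau>0 \<in> A\<close> by (auto simp: segment_vertices_def endpoints_def)
    show "co (\<not> w) (edge_start \<tau>0) = c" using \<tau>0 by (simp add: edge_ends_seg)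
  qed
  define J where "J = {p \<in> polys m m'. univariate (\<not> w) ([:- c, 1:] ^ nat (r0 + 1)) dvd p}"
  have edge_J: "edge_ideal m m' s \<tau> = J" if "\<tau> \<in> A" for \<tau>
  proof -
    obtain a b c' where \<tau>: "a < b" "\<tau> = seg w a b c'" using alongE[OF A(2)[OF \<open>\<tau> \<in> A\<close>]] by blast
    have "edge_start \<tau> \<in> segment_vertices A" using that by (auto simp: segment_vertices_def endpoints_def)
    from level[OF this] have "c' = c" using \<tau> by (simp add: edge_ends_seg)
    then show ?thesis using \<tau> that s by (simp add: edge_ideal_seg J_def)
  qed
  have slide: "?vc \<gamma>' p \<in> ?Z"
    if "p \<in> J" "\<gamma> \<in> segment_vertices A" "?vc \<gamma> p \<in> ?Z" "\<gamma>' \<in> segment_vertices A" for p \<gamma> \<gamma>'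
  proof (rule segment_vertices_connected[OF AE A(4), of "\<lambda>\<gamma>. ?vc \<gamma> p \<in> ?Z", OF _ that(2-4)])
    fix \<tau> assume "\<tau> \<in> A"
    then show "?vc (edge_start \<tau>) p \<in> ?Z \<longleftrightarrow> ?vc (edge_end \<tau>) p \<in> ?Z"
      using A(1) edge_J that(1) by (intro along_edge) auto
  qed
  have vanish: "?vc \<gamma> p \<in> ?Z" if p: "p \<in> J" and \<gamma>: "\<gamma> \<in> segment_vertices A" for \<gamma> p
    using cond
  proof
    assume "\<exists>B. B \<subseteq> interior_edges T \<and> (\<forall>\<tau>\<in>B. along w \<tau>) \<and> connected (\<Union>B) \<and> A \<subset> B \<and> (\<forall>\<tau>\<in>B. s \<tau> \<le> r0)"
    then obtain B where B: "B \<subseteq> interior_edges T" "\<forall>\<tau>\<in>B. along w \<tau>" "connected (\<Union>B)" "A \<subset> B" "\<forall>\<tau>\<in>B. s \<tau> \<le> r0"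
      by blast
    have BE: "B \<subseteq> edges T" using B(1) interior_edge_in_edges by blast
    \<comment> \<open>Otherwise the vertices of \<open>A\<close> would be cut off from the rest of \<open>B\<close>.\<close>
    have "\<exists>\<tau>\<in>B - A. endpoints \<tau> \<inter> segment_vertices A \<noteq> {}"
    proof (rule ccontr)
      assume none: "\<not> ?thesis"
      obtain \<tau>1 where \<tau>1: "\<tau>1 \<in> B - A" using B(4) by blast
      have "edge_start \<tau>1 \<in> segment_vertices A"
      proof (rule segment_vertices_connected[OF BE B(3), of "\<lambda>\<gamma>. \<gamma> \<in> segment_vertices A"])
        show "\<gamma> \<in> segment_vertices B" using \<gamma> B(4) by (auto simp: segment_vertices_def)
        show "\<gamma> \<in> segment_vertices A" by (rule \<gamma>)
        show "edge_start \<tau>1 \<in> segment_vertices B" using \<tau>1 by (auto simp: segment_vertices_def endpoints_def)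
        fix \<tau> assume "\<tau> \<in> B"
        show "edge_start \<tau> \<in> segment_vertices A \<longleftrightarrow> edge_end \<tau> \<in> segment_vertices A"
        proof (cases "\<tau> \<in> A")
          case True then show ?thesis by (auto simp: segment_vertices_def endpoints_def)
        next
          case False
          then have "endpoints \<tau> \<inter> segment_vertices A = {}" using none \<open>\<tau> \<in> B\<close> by blast
          then show ?thesis by (auto simp: endpoints_def)
        qed
      qed
      then show False using none \<tau>1 by (auto simp: endpoints_def)
    qed
    then obtain \<tau> \<delta> where \<tau>: "\<tau> \<in> B" "\<tau> \<notin> A" "\<delta> \<in> endpoints \<tau>" "\<delta> \<in> segment_vertices A" by blast
    obtain a b c' where seg: "a < b" "\<tau> = seg w a b c'" using alongE[OF bspec[OF B(2) \<tau>(1)]] by blast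
    then have "c' = c" using level[OF \<tau>(4)] \<tau>(3) by (auto simp: endpoints_def edge_ends_seg)
    moreover have "r \<tau> \<le> r0" using B(5) \<tau> s by auto
    then have "univariate (\<not> w) ([:- c, 1:] ^ nat (r \<tau> + 1)) dvd univariate (\<not> w) ([:- c, 1:] ^ nat (r0 + 1))"
      unfolding univariate_power by (intro le_imp_power_dvd) simp
    ultimately have "p \<in> edge_ideal m m' r \<tau>" using p seg by (auto simp: edge_ideal_seg J_def dest: dvd_trans)
    moreover have "\<tau> \<in> interior_edges T" "\<delta> \<in> \<tau>"
      using \<tau> B(1) interior_edge_ends by (auto simp: endpoints_def)
    ultimately have "?vc \<delta> p \<in> ?Z" using old by blast
    then show ?thesis using slide p \<tau>(4) \<gamma> by blast
  next
    let ?d = "bidegree m m' w" and ?\<rho> = "\<lambda>\<gamma>. Min (r ` {\<tau> \<in> edges T. along (\<not> w) \<tau> \<and> \<gamma> \<in> \<tau>})"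
    assume weight: "int ?d + 1 \<le> (\<Sum>\<gamma>\<in>segment_vertices A. max (int ?d - ?\<rho> \<gamma>) 0)"
    have \<rho>: "\<exists>\<tau>. \<tau> \<in> edges T \<and> along (\<not> w) \<tau> \<and> \<delta> \<in> \<tau> \<and> r \<tau> = ?\<rho> \<delta> \<and> - 1 \<le> ?\<rho> \<delta>" if "\<delta> \<in> segment_vertices A" for \<delta>
    proof -
      have "\<delta> \<in> vertices T" using that SV by blast
      then obtain a b c' where "a < b" "seg (\<not> w) a b c' \<in> edges T" "\<delta> \<in> seg (\<not> w) a b c'"
        by (rule vertex_edge)
      then have "seg (\<not> w) a b c' \<in> {\<tau> \<in> edges T. along (\<not> w) \<tau> \<and> \<delta> \<in> \<tau>}" by (simp add: along_seg)
      then have "{\<tau> \<in> edges T. along (\<not> w) \<tau> \<and> \<delta> \<in> \<tau>} \<noteq> {}" by blast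
      then have "?\<rho> \<delta> \<in> r ` {\<tau> \<in> edges T. along (\<not> w) \<tau> \<and> \<delta> \<in> \<tau>}"
        using finite_edges by (intro Min_in) auto
      then show ?thesis using sd unfolding smoothness_distribution_def by auto
    qed
    have weight': "?d + 1 \<le> (\<Sum>\<gamma>\<in>segment_vertices A. ?d + 1 - nat (?\<rho> \<gamma> + 1))"
    proof -
      have "(\<Sum>\<gamma>\<in>segment_vertices A. max (int ?d - ?\<rho> \<gamma>) 0) = (\<Sum>\<gamma>\<in>segment_vertices A. int (?d + 1 - nat (?\<rho> \<gamma> + 1)))"
        using \<rho> by (intro sum.cong refl) force
      then have "int (?d + 1) \<le> int (\<Sum>\<gamma>\<in>segment_vertices A. ?d + 1 - nat (?\<rho> \<gamma> + 1))" using weight by simp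
      then show ?thesis by (simp only: of_nat_le_iff)
    qed
    \<comment> \<open>Fix the factor \<open>b\<close> in the variable across the segment.  The factors \<open>a\<close> for which the
    class vanishes form a subspace.  At every vertex \<open>\<delta>\<close> of \<open>A\<close> it contains the multiples of the power
    prescribed by a transversal edge of least smoothness: for interior \<open>\<delta>\<close> that edge is interior as well, and
    for boundary vertices the class is zero anyway.\<close>
    have prod: "?vc \<gamma> (univariate w a * univariate (\<not> w) b) \<in> ?Z"
      if a: "degree a \<le> ?d" and b: "degree b \<le> bidegree m m' (\<not> w)" "[:- c, 1:] ^ nat (r0 + 1) dvd b" for a b
    proof -
      let ?S = "{a. ?vc \<gamma> (univariate w a * univariate (\<not> w) b) \<in> ?Z}"
      have lin: "linear (\<lambda>a. ?vc \<gamma> (univariate w a * univariate (\<not> w) b))"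
        using linear_compose[OF linear_univariate_mult linear_vertex_chain] by (simp add: o_def)
      have "a \<in> ?S"
      proof (rule span_power_linear_multiples[of ?S "segment_vertices A" "co w" ?d "\<lambda>\<gamma>. nat (?\<rho> \<gamma> + 1)"])
        show "subspace ?S" using linear_subspace_vimage[OF lin sZ] by (simp add: vimage_def)
        show "finite (segment_vertices A)" using SV finite_vertices finite_subset by blast
        show "inj_on (co w) (segment_vertices A)" using level by (intro inj_onI) (metis pt_co)
        show "?d + 1 \<le> (\<Sum>\<gamma>\<in>segment_vertices A. ?d + 1 - nat (?\<rho> \<gamma> + 1))" by (rule weight')
        show "degree a \<le> ?d" by (rule a)
        fix \<delta> q assume \<delta>: "\<delta> \<in> segment_vertices A" and q: "degree q \<le> ?d" "[:- co w \<delta>, 1:] ^ nat (?\<rho> \<delta> + 1) dvd q"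
        let ?p = "univariate w q * univariate (\<not> w) b"
        have pJ: "?p \<in> J"
          unfolding J_def using univariate_mult_univariate_in_polys[OF q(1) b(1)] b(2)
          by (auto intro!: dvd_mult univariate_dvd)
        have "?vc \<delta> ?p \<in> ?Z"
        proof (cases "\<delta> \<in> interior_vertices T")
          case True
          obtain \<tau> where \<tau>: "\<tau> \<in> edges T" "along (\<not> w) \<tau>" "\<delta> \<in> \<tau>" "r \<tau> = ?\<rho> \<delta>" using \<rho>[OF \<delta>] by blast
          have "\<tau> \<in> interior_edges T" using \<tau> True by (auto simp: interior_edges_def interior_vertices_def)
          moreover obtain a' b' c' where seg: "a' < b'" "\<tau> = seg (\<not> w) a' b' c'" using alongE[OF \<tau>(2)] by blast
          moreover have "c' = co w \<delta>" using \<tau>(3) mem_seg_Not[of w "co w \<delta>" "co (\<not> w) \<delta>"] seg(2) by simp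
          moreover have "?p \<in> edge_ideal m m' r \<tau>"
            using univariate_mult_univariate_in_polys[OF q(1) b(1)] q(2) \<tau>(4) seg \<open>c' = co w \<delta>\<close>
            by (auto simp: edge_ideal_seg intro!: dvd_mult2 univariate_dvd)
          ultimately show ?thesis using old \<tau>(3) by blast
        next
          case False then show ?thesis using sZ by (simp add: vertex_chain_def subspace_0)
        qed
        then have "?vc \<gamma> ?p \<in> ?Z" using slide pJ \<delta> \<gamma> by blast
        then show "q \<in> ?S" by simp
      qed
      then show ?thesis by simp
    qed
    have pp: "p \<in> polys m m'" using p by (simp add: J_def)
    obtain g where g: "p = univariate (\<not> w) ([:- c, 1:] ^ nat (r0 + 1)) * g" using p by (auto simp: J_def)
    have dv: "[:- c, 1:] ^ nat (r0 + 1) dvd slice w i p" for i unfolding g slice_univariate_mult by simp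
    have "?vc \<gamma> (\<Sum>i\<le>?d. univariate w (monom 1 i) * univariate (\<not> w) (slice w i p)) \<in> ?Z"
      unfolding linear_sum[OF linear_vertex_chain]
      by (intro subspace_sum[OF sZ] prod degree_slice[OF pp] dv) (simp add: degree_monom_eq)
    then show ?thesis using polys_eq_sum_slices[OF pp, of w] by simp
  qed
  have "c \<in> ?Z" if c: "c \<in> I_0 T m m' s" for c
  proof -
    have "Poly_Mapping.single \<gamma> (Poly_Mapping.lookup c \<gamma>) \<in> ?Z" if \<gamma>: "\<gamma> \<in> interior_vertices T" for \<gamma>
    proof -
      have "Poly_Mapping.lookup c \<gamma> \<in> vertex_ideal T m m' s \<gamma>"
        using c \<gamma> unfolding I_0_def mem_chains_iff by (metis (full_types))
      also have "vertex_ideal T m m' s \<gamma> \<subseteq> {p. ?vc \<gamma> p \<in> ?Z}"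
        unfolding vertex_ideal_def
      proof (rule span_minimal)
        show "subspace {p. ?vc \<gamma> p \<in> ?Z}"
          using linear_subspace_vimage[OF linear_vertex_chain sZ] by (simp add: vimage_def)
        show "(\<Union>\<tau>\<in>{\<tau> \<in> interior_edges T. \<gamma> \<in> \<tau>}. edge_ideal m m' s \<tau>) \<subseteq> {p. ?vc \<gamma> p \<in> ?Z}"
        proof clarify
          fix \<tau> p assume \<tau>: "\<tau> \<in> interior_edges T" "\<gamma> \<in> \<tau>" and p: "p \<in> edge_ideal m m' s \<tau>"
          show "?vc \<gamma> p \<in> ?Z"
          proof (cases "\<tau> \<in> A")
            case True
            have "\<gamma> \<in> endpoints \<tau>"
              using vertex_on_edge_is_endpoint \<tau> \<gamma> interior_edge_in_edges by (auto simp: interior_vertices_def)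
            then have "\<gamma> \<in> segment_vertices A" using True by (auto simp: segment_vertices_def)
            then show ?thesis using vanish p edge_J True by blast
          next
            case False
            then have "p \<in> edge_ideal m m' r \<tau>" using p s by (simp add: edge_ideal_def)
            then show ?thesis using old \<tau> by blast
          qed
        qed
      qed
      finally show ?thesis using \<gamma> by (simp add: vertex_chain_def)
    qed
    then have "(\<Sum>\<gamma>\<in>interior_vertices T. Poly_Mapping.single \<gamma> (Poly_Mapping.lookup c \<gamma>)) \<in> ?Z"
      by (rule subspace_sum[OF sZ])
    then show ?thesis using chain_eq_sum_single[OF finite_interior_vertices c[unfolded I_0_def]] by simp
  qed
  then show ?thesis unfolding H_0_zero_iff by blast
qed

end

theorem theorem4p2:
  fixes T :: tmesh and m m' :: nat
    and r s :: "(real \<times> real) set \<Rightarrow> int" and r0 :: int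
    and A :: "(real \<times> real) set set"
  assumes "simply_connected_tmesh T"
    and "smoothness_distribution T r"
    and "H_0_zero T m m' r"
    and "segment T A"
    and "- 1 \<le> r0"
    and "\<And>\<tau>. \<tau> \<in> A \<Longrightarrow> r0 \<le> r \<tau>"
    and "s = (\<lambda>\<tau>. if \<tau> \<in> A then r0 else r \<tau>)"
    and "(\<exists>B. segment T B \<and> A \<subset> B \<and> (\<forall>\<tau>\<in>B. s \<tau> \<le> r0)) \<or>
         (horizontal_segment T A \<and> horizontal_weight T m s A \<ge> int m + 1 \<or>
          vertical_segment T A \<and> vertical_weight T m' r A \<ge> int m' + 1)"
  shows "H_0_zero T m m' s \<and> int (dim (spline_space T m m' s)) = euler_Q T m m' s"
proof -
  have mesh: "mesh T" using assms(1) by (simp add: mesh_def simply_connected_tmesh_def)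
  have seg_iff: "segment T B \<longleftrightarrow> (\<exists>w. B \<subseteq> interior_edges T \<and> (\<forall>\<tau>\<in>B. along w \<tau>) \<and> B \<noteq> {} \<and> connected (\<Union>B))" for B
    unfolding segment_def horizontal_segment_def vertical_segment_def by (auto simp: along_def)
  obtain w where A: "A \<subseteq> interior_edges T" "\<forall>\<tau>\<in>A. along w \<tau>" "A \<noteq> {}" "connected (\<Union>A)"
    using assms(4) unfolding seg_iff by blast
  obtain \<tau>0 where \<tau>0: "\<tau>0 \<in> A" using A by blast
  have same: "w' = w" if "\<tau>0 \<in> B" "\<forall>\<tau>\<in>B. along w' \<tau>" for B w'
  proof -
    have "along w \<tau>0" "along w' \<tau>0" using that \<tau>0 A by auto
    moreover from this(1) obtain a b c where "a < b" "\<tau>0 = seg w a b c" by (rule alongE)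
    ultimately show ?thesis by (simp add: along_seg)
  qed
  have "H_0_zero T m m' s"
  proof (rule mesh.H_0_zero_lower_segment[OF mesh assms(2,3) A(1) _ A(3,4) assms(5,6,7)])
    show "\<And>\<tau>. \<tau> \<in> A \<Longrightarrow> along w \<tau>" using A(2) by blast
    let ?d = "bidegree m m' w"
    show "(\<exists>B. B \<subseteq> interior_edges T \<and> (\<forall>\<tau>\<in>B. along w \<tau>) \<and> connected (\<Union>B) \<and> A \<subset> B \<and> (\<forall>\<tau>\<in>B. s \<tau> \<le> r0)) \<or>
      int ?d + 1 \<le> (\<Sum>\<gamma>\<in>segment_vertices A.
         max (int ?d - Min (r ` {\<tau> \<in> edges T. along (\<not> w) \<tau> \<and> \<gamma> \<in> \<tau>})) 0)"
      using assms(8)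
    proof (elim disjE conjE exE)
      fix B assume B: "segment T B" "A \<subset> B" "\<forall>\<tau>\<in>B. s \<tau> \<le> r0"
      from B(1) obtain w' where w': "B \<subseteq> interior_edges T" "\<forall>\<tau>\<in>B. along w' \<tau>" "connected (\<Union>B)"
        unfolding seg_iff by blast
      moreover have "w' = w" using same[of B w'] w' B \<tau>0 by blast
      ultimately show ?thesis using B by blast
    next
      assume h: "horizontal_segment T A" "int m + 1 \<le> horizontal_weight T m s A"
      then have w: "w = False" using same[of A False] \<tau>0 by (auto simp: horizontal_segment_def along_def)
      have "s ` {\<tau> \<in> edges T. vertical \<tau> \<and> \<gamma> \<in> \<tau>} = r ` {\<tau> \<in> edges T. along True \<tau> \<and> \<gamma> \<in> \<tau>}" for \<gamma>
      proof (rule image_cong)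
        fix \<tau> assume "\<tau> \<in> {\<tau> \<in> edges T. along True \<tau> \<and> \<gamma> \<in> \<tau>}"
        then have "\<tau> \<notin> A" using A(2) w mesh.edge_along_cases[OF mesh] by blast
        then show "s \<tau> = r \<tau>" using assms(7) by simp
      qed (simp add: along_def)
      then have "horizontal_weight T m s A = (\<Sum>\<gamma>\<in>segment_vertices A.
         max (int ?d - Min (r ` {\<tau> \<in> edges T. along (\<not> w) \<tau> \<and> \<gamma> \<in> \<tau>})) 0)"
        unfolding horizontal_weight_def r_h_def by (simp add: w bidegree_def)
      then show ?thesis using h w by (simp add: bidegree_def)
    next
      assume v: "vertical_segment T A" "int m' + 1 \<le> vertical_weight T m' r A"
      then have w: "w = True" using same[of A True] \<tau>0 by (auto simp: vertical_segment_def along_def)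
      have "vertical_weight T m' r A = (\<Sum>\<gamma>\<in>segment_vertices A.
         max (int ?d - Min (r ` {\<tau> \<in> edges T. along (\<not> w) \<tau> \<and> \<gamma> \<in> \<tau>})) 0)"
        unfolding vertical_weight_def r_v_def by (simp add: w bidegree_def along_def)
      then show ?thesis using v w by (simp add: bidegree_def)
    qed
  qed
  moreover have "simply_connected (mesh_domain T)" using assms(1) by (simp add: simply_connected_tmesh_def)
  ultimately show ?thesis using mesh.dim_spline_space[OF mesh] by blast
qed

end
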